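(* Let $(X_1^*,X_2^* )$ be the values at two distinct sites of a process $X^*$ whose marginal distribution is the same at every site, and write $X^*$ also for a generic variable with this marginal distribution. Let $\epsilon_1,\epsilon_2$ be i.i.d. $N(0,\tau^2)$ with $\tau^2>0$, independent of $(X_1^*,X_2^* )$, let $\epsilon$ denote a generic $N(0,\tau^2)$ variable, and set $X_i=X_i^*+\epsilon_i$, $i=1,2$. Let $\chi_{X^*},\eta_{X^*}$ and $\chi_X,\eta_X$ be the upper tail dependence parameter and the coefficient of tail dependence (defined in the context) of $(X_1^*,X_2^* )$ and of $(X_1,X_2)$, respectively. Then: 1. If $X^*$ has a regularly varying tail, or a Weibull-like tail with Weibull index $\alpha<1$, then $\chi_X=\chi_{X^*}$ and $\eta_X=\eta_{X^*}$. 2. If $X^*$ has a Weibull-like tail with Weibull index $\alpha=1$ and rate parameter $\theta$, then $$\chi_X\in\left[\frac{E\left(e^{\theta\min(\epsilon_1,\epsilon_2)}\right)}{E\left(e^{\theta\epsilon}\right)}\,\chi_{X^*},\ \frac{E\left(e^{\theta\max(\epsilon_1,\epsilon_2)}\right)}{E\left(e^{\theta\epsilon}\right)}\,\chi_{X^*}\right]$$ and $\eta_X=\eta_{X^*}$. Note that if $\chi_{X^*}=0$ then $\chi_X=0$. 3. If $X^*$ has a Weibull-like tail with Weibull index $\alpha>1$, then: (a) if $\alpha\in(1,2)$, then $\eta_X=\eta_{X^*}$; (b) if $\alpha=2$, with rate parameter $\theta_*$ for $X^*$, then $$\eta_X\in\left[\frac{\theta_*}{2\theta_*^{\wedge}}\,\frac{\theta_*^{\wedge}+1/\tau^2}{\theta_*+1/(2\tau^2)},\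 \min\left\{\frac{\theta_*}{\theta_*^{\wedge}}\,\frac{\theta_*^{\wedge}+1/(2\tau^2)}{\theta_*+1/(2\tau^2)},\ \frac{\theta_*}{2\theta_*^{\vee}}\,\frac{\theta_*^{\vee}+1/\tau^2}{\theta_*+1/(2\tau^2)}\right\}\right],$$ where $\theta_*^{\wedge}$ and $\theta_*^{\vee}$ are the exponential rate constants of the tails of $\min(X_1^*,X_2^* )$ and $\max(X_1^*,X_2^* )$, that is, $-\log P(\min(X_1^*,X_2^* )>x)\sim\theta_*^{\wedge}x^2$ and $-\log P(\max(X_1^*,X_2^* )>x)\sim\theta_*^{\vee}x^2$ as $x\to\infty$; (c) if $\alpha>2$, then $\eta_X=1/2$.
   Context: Regular variation: a measurable $g:\mathbb{R}_+\to\mathbb{R}_+$ is regularly varying at infinity with index $\kappa$, written $g\in\mathrm{RV}_\kappa$, if $\lim_{t\to\infty}g(tx)/g(t)=x^\kappa$ for all $x>0$. A function $\mathcal{L}$ is slowly varying at zero if $\lim_{t\to0}\mathcal{L}(tx)/\mathcal{L}(t)=1$ for all $x>0$. The notation $f(x)\sim g(x)$ means $f(x)/g(x)\to1$. Marginal tail classes: $X^*$ has a regularly varying tail if $x\mapsto P(X^*>x)$ is in $\mathrm{RV}_{-\alpha}$ for some $\alpha>0$. $X^*$ has a Weibull-like tail with Weibull index $\alpha>0$ and rate parameter $\theta>0$ if $P(X^*>x)\sim u(x)\exp(-\theta x^\alpha)$ as $x\to\infty$ with $u\in\mathrm{RV}_\kappa$ for some $\kappa$; it is also assumed in this case that $X^*$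 has a density satisfying $f_{X^*}(x)\sim v(x)\exp(-\theta x^\alpha)$ with $v(x)=u(x)\,\theta\alpha x^{\alpha-1}$. Dependence measures: for a pair $(W_1,W_2)$ with common marginal distribution function $F$, the upper tail dependence parameter is $\chi_W=\lim_{u\to1}P(F(W_1)>u\mid F(W_2)>u)$. The coefficient of tail dependence $\eta_W\in(0,1]$ is defined through the joint tail assumption of Ledford and Tawn, $$P(F(W_1)>u\mid F(W_2)>u)=\mathcal{L}(1-u)\,(1-u)^{1/\eta_W-1},$$ with $\mathcal{L}$ slowly varying at zero. In part 3(b), when $\alpha=2$, the constants satisfy $\theta_*^{\wedge}=\theta_*/\eta_{X^*}$ and $\theta_*^{\vee}=\theta_*$. *)

theory Defs
  imports "HOL-Probability.Probability" "HOL-Library.Landau_Symbols"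
begin

text \<open>Functions on the nonnegative half-line are functions on all reals of which only the values
  on \<open>{0..}\<close> are constrained.\<close>

definition regularly_varying :: "(real \<Rightarrow> real) \<Rightarrow> real \<Rightarrow> bool" where
  "regularly_varying g \<kappa> \<longleftrightarrow>
     g \<in> borel_measurable (restrict_space borel {0..}) \<and>
     (\<forall>t\<ge>0. g t \<ge> 0) \<and>
     (\<forall>x>0. ((\<lambda>t. g (t * x) / g t) \<longlongrightarrow> x powr \<kappa>) at_top)"

definition slowly_varying_at_zero :: "(real \<Rightarrow> real) \<Rightarrow> bool" where
  "slowly_varying_at_zero L \<longleftrightarrow> (\<forall>x>0. ((\<lambda>t. L (t * x) / L t) \<longlongrightarrow> 1) (at_right 0))"

definition tail :: "'a measure \<Rightarrow> ('a \<Rightarrow> real) \<Rightarrow> real \<Rightarrow> real" where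
  "tail M X x = \<P>(\<omega> in M. X \<omega> > x)"

definition regularly_varying_tail :: "'a measure \<Rightarrow> ('a \<Rightarrow> real) \<Rightarrow> bool" where
  "regularly_varying_tail M X \<longleftrightarrow> (\<exists>\<alpha>>0. regularly_varying (tail M X) (- \<alpha>))"

definition weibull_like_tail :: "'a measure \<Rightarrow> ('a \<Rightarrow> real) \<Rightarrow> real \<Rightarrow> real \<Rightarrow> bool" where
  "weibull_like_tail M X \<alpha> \<theta> \<longleftrightarrow> \<alpha> > 0 \<and> \<theta> > 0 \<and>
     (\<exists>u \<kappa> f. regularly_varying u \<kappa> \<and>
        tail M X \<sim>[at_top] (\<lambda>x. u x * exp (- \<theta> * x powr \<alpha>)) \<and>
        (\<forall>x. f x \<ge> 0) \<and> distributed M lborel X (\<lambda>x. ennreal (f x)) \<and>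
        f \<sim>[at_top] (\<lambda>x. u x * \<theta> * \<alpha> * x powr (\<alpha> - 1) * exp (- \<theta> * x powr \<alpha>)))"

text \<open>The conditional probability of \<open>F(W\<^sub>1) > u\<close> given \<open>F(W\<^sub>2) > u\<close>, for a pair with common
  marginal distribution function \<open>F\<close>; here \<open>F\<close> is read off from \<open>W\<^sub>1\<close>, so this is meaningful only
  if \<open>W\<^sub>1\<close> and \<open>W\<^sub>2\<close> have the same distribution.\<close>

definition cond_exceedance :: "'a measure \<Rightarrow> ('a \<Rightarrow> real) \<Rightarrow> ('a \<Rightarrow> real) \<Rightarrow> real \<Rightarrow> real" where
  "cond_exceedance M W1 W2 u =
     (let F = cdf (distr M borel W1) in \<P>(\<omega> in M. F (W1 \<omega>) > u \<bar> F (W2 \<omega>) > u))"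

text \<open>Both dependence parameters are relations rather than functions, because they need not exist;
  each determines its value uniquely.\<close>

definition has_tail_dependence ::
    "'a measure \<Rightarrow> ('a \<Rightarrow> real) \<Rightarrow> ('a \<Rightarrow> real) \<Rightarrow> real \<Rightarrow> bool" where
  "has_tail_dependence M W1 W2 chi \<longleftrightarrow> (cond_exceedance M W1 W2 \<longlongrightarrow> chi) (at_left 1)"

definition has_coeff_tail_dependence ::
    "'a measure \<Rightarrow> ('a \<Rightarrow> real) \<Rightarrow> ('a \<Rightarrow> real) \<Rightarrow> real \<Rightarrow> bool" where
  "has_coeff_tail_dependence M W1 W2 \<eta> \<longleftrightarrow> 0 < \<eta> \<and> \<eta> \<le> 1 \<and>
     (\<exists>L. slowly_varying_at_zero L \<and>
        (\<forall>u\<in>{0<..<1}. cond_exceedance M W1 W2 u = L (1 - u) * (1 - u) powr (1 / \<eta> - 1)))"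

definition gaussian_rate :: "'a measure \<Rightarrow> ('a \<Rightarrow> real) \<Rightarrow> real \<Rightarrow> bool" where
  "gaussian_rate M Y \<theta> \<longleftrightarrow> (\<lambda>x. - ln (tail M Y x)) \<sim>[at_top] (\<lambda>x. \<theta> * x\<^sup>2)"

end

theory Submission
  imports Defs "HOL-Real_Asymp.Real_Asymp"
begin

text \<open>Write \<open>T\<close> for the marginal tail, \<open>G(x) = P(min X\<^sub>1 X\<^sub>2 > x)\<close> for the joint tail and
  \<open>H(s) = P(F(X\<^sub>1) > 1 - s, F(X\<^sub>2) > 1 - s)\<close>, so that \<open>G = H \<circ> T\<close>. The coefficient \<open>\<eta>\<close> exists iff the
  monotone function \<open>H\<close> is regularly varying at 0 with index \<open>1/\<eta>\<close>, and \<open>\<chi>\<close> is the limit of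
  \<open>H(s)/s\<close>. The joint tail of the noisy pair lies between the tails of \<open>min X\<^sup>* + min \<epsilon>\<close> and
  \<open>min X\<^sup>* + max \<epsilon>\<close>, and below that of \<open>max X\<^sup>* + (\<epsilon>\<^sub>1 + \<epsilon>\<^sub>2)/2\<close>.

  If \<open>T(x - y)/T(x)\<close> converges to \<open>exp (\<theta> y)\<close> (with \<open>\<theta> = 0\<close> for regularly varying tails and for
  Weibull index below 1), dominated convergence shows that the noise multiplies tails
  by exponential moments, which gives the statements about \<open>\<chi>\<close> and the first part. All remaining
  statements about \<open>\<eta>\<close> compare the rates \<open>r\<close> in \<open>exp (- r x\<^sup>p)\<close> of the joint and the marginal tail:
  the lighter summand does not change the rate of the heavier one, and two Gaussian rates \<open>a\<close>, \<open>b\<close>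
  combine to \<open>ab/(a + b)\<close>, the minimum of \<open>a s\<^sup>2 + b (1 - s)\<^sup>2\<close>.\<close>

section \<open>Regular variation at zero\<close>

text \<open>Regular and slow variation are bare pointwise limits here, and \<open>L\<close> carries
  no measurability, so the uniform convergence theorem is not at hand. Monotonicity of H replaces
  it: it traps varying arguments between constant multiples, and it yields power bounds by repeated
  halving. For the Weibull class the unknown factor \<open>u\<close> is eliminated altogether: the
  density makes the hazard rate asymptotic to the derivative of \<theta> x^\<alpha>, which controls
  the increments of ln T.

  The two envelopes of the noisy joint tail are asymptotically equal only in the long-tailed case,
  and there the existence of both parameters is proved. Otherwise they fix it up to a constant
  factor or up to its rate, from which no limit can be inferred; the conclusions then constrain a
  parameter that exists. The exception is \<chi> = 0, where both envelopes are negligible.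

  The envelope with (\<epsilon>1 + \<epsilon>2)/2 is there because averaging halves the variance of
  the noise: the mean has the same rate 1/\<tau>^2 as the minimum of the two noises, and so upper
  and lower bounds meet at 1/2 when \<alpha> > 2.\<close>

definition regularly_varying_at_zero :: "(real \<Rightarrow> real) \<Rightarrow> real \<Rightarrow> bool" where
  "regularly_varying_at_zero H \<rho> \<longleftrightarrow>
     (\<forall>x>0. ((\<lambda>s. H (s * x) / H s) \<longlongrightarrow> x powr \<rho>) (at_right 0))"

text \<open>At \<open>x = 1\<close> the ratio tends to 1, whereas division by zero yields 0 in HOL;
  so \<open>H s\<close> cannot vanish near 0.\<close>

lemma regularly_varying_at_zero_ev_pos:
  assumes "regularly_varying_at_zero H \<rho>" "\<And>s. H s \<ge> 0"
  shows "\<forall>\<^sub>F s in at_right 0. H s > 0"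
proof -
  have "((\<lambda>s. H (s * 1) / H s) \<longlongrightarrow> 1 powr \<rho>) (at_right 0)"
    using assms(1) unfolding regularly_varying_at_zero_def by (rule allE[of _ 1]) simp
  then have "\<forall>\<^sub>F s in at_right 0. H (s * 1) / H s > 0"
    by (rule order_tendstoD) simp
  then show ?thesis
  proof eventually_elim
    case (elim s)
    then show ?case using assms(2)[of s] by (cases "H s = 0") auto
  qed
qed

text \<open>Stands in for the uniform convergence theorem. Eventually \<open>f\<close> lies above
  \<open>m * g\<close> for each constant m < l and below it for each m > l; monotonicity carries
  this to H, and the pointwise limits m^\<rho> come arbitrarily close to l^\<rho>.\<close>

lemma regularly_varying_at_zero_ratio:
  fixes f g :: "'b \<Rightarrow> real"
  assumes rv: "regularly_varying_at_zero H \<rho>" and nn: "\<And>s. H s \<ge> 0" and mono: "mono H"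
    and g: "filterlim g (at_right 0) F" and fg: "((\<lambda>x. f x / g x) \<longlongrightarrow> l) F" and l: "l > 0"
  shows "((\<lambda>x. H (f x) / H (g x)) \<longlongrightarrow> l powr \<rho>) F"
proof -
  have gpos: "\<forall>\<^sub>F x in F. g x > 0"
    using g by (auto simp: filterlim_at elim: eventually_mono)
  have Hg: "\<forall>\<^sub>F x in F. H (g x) > 0"
    by (rule eventually_compose_filterlim[OF regularly_varying_at_zero_ev_pos[OF rv nn] g])
  have lim: "((\<lambda>x. H (g x * m) / H (g x)) \<longlongrightarrow> m powr \<rho>) F" if "m > 0" for m
    using rv that g unfolding regularly_varying_at_zero_def
    by (auto intro: filterlim_compose[where f = g])
  have cont: "((\<lambda>m. m powr \<rho>) \<longlongrightarrow> l powr \<rho>) (at l)"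
    using l by (intro tendsto_intros) auto
  show ?thesis
  proof (rule order_tendstoI)
    fix c assume "c < l powr \<rho>"
    then have "\<forall>\<^sub>F m in at l. c < m powr \<rho>" using cont by (rule order_tendstoD(1)[rotated])
    then have "\<forall>\<^sub>F m in at_left l. c < m powr \<rho>" by (simp add: eventually_at_split)
    moreover have "\<forall>\<^sub>F m in at_left l. 0 < m \<and> m < l"
      using eventually_at_left_real[OF l] by (auto elim: eventually_mono)
    ultimately have "\<forall>\<^sub>F m in at_left l. c < m powr \<rho> \<and> 0 < m \<and> m < l" by eventually_elim auto
    then obtain m where m: "c < m powr \<rho>" "0 < m" "m < l"
      by (metis (no_types, lifting) eventually_happens trivial_limit_at_left_real)
    from order_tendstoD(1)[OF lim[OF m(2)] m(1)] order_tendstoD(1)[OF fg m(3)] gpos Hg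
    show "\<forall>\<^sub>F x in F. c < H (f x) / H (g x)"
    proof eventually_elim
      case (elim x)
      have "H (g x * m) \<le> H (f x)"
        using elim by (intro monoD[OF mono]) (simp add: pos_less_divide_eq mult.commute)
      then show ?case using elim by (smt (verit) divide_right_mono)
    qed
  next
    fix c assume "c > l powr \<rho>"
    then have "\<forall>\<^sub>F m in at l. c > m powr \<rho>" using cont by (rule order_tendstoD(2)[rotated])
    then have "\<forall>\<^sub>F m in at_right l. c > m powr \<rho>" by (simp add: eventually_at_split)
    moreover have "\<forall>\<^sub>F m in at_right l. m > l" by (rule eventually_at_right_less)
    ultimately have "\<forall>\<^sub>F m in at_right l. c > m powr \<rho> \<and> m > l" by eventually_elim auto
    then obtain m where m: "c > m powr \<rho>" "m > l"
      by (metis (no_types, lifting) eventually_happens trivial_limit_at_right_real)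
    then have "m > 0" using l by simp
    from order_tendstoD(2)[OF lim[OF this] m(1)] order_tendstoD(2)[OF fg m(2)] gpos Hg
    show "\<forall>\<^sub>F x in F. c > H (f x) / H (g x)"
    proof eventually_elim
      case (elim x)
      have "H (f x) \<le> H (g x * m)"
        using elim by (intro monoD[OF mono]) (simp add: pos_divide_less_eq mult.commute)
      then show ?case using elim by (smt (verit) divide_right_mono)
    qed
  qed
qed

text \<open>Dyadic induction on the reals: the claim on the block from \<open>s0 / 2\<close> to
  \<open>s0\<close> spreads to all smaller positive points, because each of them reaches the block
  after finitely many doublings.\<close>

lemma halving_induct:
  fixes s0 :: real
  assumes "s0 > 0" and base: "\<And>s. s0 / 2 \<le> s \<Longrightarrow> s \<le> s0 \<Longrightarrow> P s"
    and step: "\<And>s. 0 < s \<Longrightarrow> s \<le> s0 \<Longrightarrow> P s \<Longrightarrow> P (s / 2)" and s: "0 < s" "s \<le> s0"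
  shows "P s"
proof -
  have *: "\<forall>s. s0 / 2 ^ Suc n \<le> s \<longrightarrow> s \<le> s0 \<longrightarrow> P s" for n
  proof (induction n)
    case (Suc n)
    show ?case
    proof (intro allI impI)
      fix s assume s: "s0 / 2 ^ Suc (Suc n) \<le> s" "s \<le> s0"
      show "P s"
      proof (cases "s0 / 2 \<le> s")
        case False
        have "s0 / 2 ^ Suc (Suc n) > 0" using \<open>s0 > 0\<close> by simp
        then have "s > 0" using s(1) by linarith
        have "s0 / 2 ^ Suc n \<le> 2 * s" using s by simp
        then have "P (2 * s)" using Suc False by auto
        from step[OF _ _ this] show ?thesis using False \<open>s > 0\<close> by simp
      qed (use base s in auto)
    qed
  qed (use base in auto)
  have "(\<lambda>n. s0 / 2 ^ Suc n) \<longlonglongrightarrow> 0" by real_asymp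
  then have "\<forall>\<^sub>F n in sequentially. s0 / 2 ^ Suc n < s"
    using s by (auto dest: order_tendstoD(2))
  then obtain n where "s0 / 2 ^ Suc n < s" by (meson eventually_happens sequentially_bot)
  then show ?thesis using * s by (meson less_imp_le)
qed

text \<open>One half of Potter's bounds. Each halving of s shrinks H at least by (1/2)^q, for an
  exponent q between r and \<rho>, which iterates to H \<le> C s^q; the gap between q and r then
  swallows C.\<close>

lemma regularly_varying_at_zero_upper:
  assumes rv: "regularly_varying_at_zero H \<rho>" and nn: "\<And>s. H s \<ge> 0" and mono: "mono H"
    and r: "r < \<rho>" "r > 0"
  shows "\<forall>\<^sub>F s in at_right 0. H s \<le> s powr r"
proof -
  obtain q where q: "r < q" "q < \<rho>" using r dense by blast
  have "((\<lambda>s. H (s * (1/2)) / H s) \<longlongrightarrow> (1/2) powr \<rho>) (at_right 0)"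
    using rv unfolding regularly_varying_at_zero_def by (rule allE[of _ "1/2"]) simp
  moreover have "(1/2) powr \<rho> < (1/2::real) powr q" using q by (intro powr_less_mono') auto
  ultimately have "\<forall>\<^sub>F s in at_right 0. H (s * (1/2)) / H s < (1/2) powr q"
    by (rule order_tendstoD(2))
  with regularly_varying_at_zero_ev_pos[OF rv nn]
  have "\<forall>\<^sub>F s in at_right 0. H (s / 2) \<le> (1/2) powr q * H s"
    by eventually_elim (simp add: field_simps)
  then obtain s1 where s1: "s1 > 0" "\<And>s. 0 < s \<Longrightarrow> s < s1 \<Longrightarrow> H (s / 2) \<le> (1/2) powr q * H s"
    unfolding eventually_at_right_field by auto
  define s0 where "s0 = s1 / 2"
  have s0: "s0 > 0" "\<And>s. 0 < s \<Longrightarrow> s \<le> s0 \<Longrightarrow> H (s / 2) \<le> (1/2) powr q * H s"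
    using s1 by (auto simp: s0_def)
  \<comment> \<open>Chosen for the base block: there H is at most \<open>H s0\<close>, while
    \<open>s powr q\<close> is at least \<open>(s0 / 2) powr q\<close>.\<close>
  define C where "C = H s0 / (s0 / 2) powr q"
  have "H s \<le> C * s powr q" if "0 < s" "s \<le> s0" for s
    using s0(1) _ _ that
  proof (rule halving_induct)
    fix s assume s: "s0 / 2 \<le> s" "s \<le> s0"
    have "H s \<le> H s0" using s by (intro monoD[OF mono])
    also have "\<dots> = C * (s0 / 2) powr q" using s0 by (simp add: C_def)
    also have "\<dots> \<le> C * s powr q"
      using s s0 q r by (intro mult_left_mono powr_mono2) (auto simp: C_def nn)
    finally show "H s \<le> C * s powr q" .
  next
    fix s assume s: "0 < s" "s \<le> s0" "H s \<le> C * s powr q"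
    have "H (s / 2) \<le> (1/2) powr q * H s" using s0 s by blast
    also have "\<dots> \<le> (1/2) powr q * (C * s powr q)" using s by (intro mult_left_mono) auto
    also have "\<dots> = C * ((1/2) * s) powr q" using s by (subst powr_mult) auto
    finally show "H (s / 2) \<le> C * (s / 2) powr q" by simp
  qed
  then have 1: "\<forall>\<^sub>F s in at_right 0. H s \<le> C * s powr q"
    unfolding eventually_at_right_field using s0 by (auto intro!: exI[of _ s0])
  have "((\<lambda>s. C * s powr (q - r)) \<longlongrightarrow> C * 0) (at_right 0)"
    using q by (intro tendsto_mult tendsto_const) real_asymp
  then have "\<forall>\<^sub>F s in at_right 0. C * s powr (q - r) < 1" by (rule order_tendstoD) simp
  with 1 eventually_at_right_less show ?thesis
  proof eventually_elim
    case (elim s)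
    have "H s \<le> (C * s powr (q - r)) * s powr r"
      using elim by (simp add: powr_diff)
    also have "\<dots> \<le> 1 * s powr r" using elim by (intro mult_right_mono) auto
    finally show ?case by simp
  qed
qed

text \<open>The other half of Potter's bounds: a halving shrinks H by no more than (1/2)^q. Here q
  exceeds 0 as well as \<rho>, so that s^q increases over the base block, and
  \<open>H (s0 / 2) > 0\<close> makes C positive.\<close>

lemma regularly_varying_at_zero_lower:
  assumes rv: "regularly_varying_at_zero H \<rho>" and nn: "\<And>s. H s \<ge> 0" and mono: "mono H"
    and r: "\<rho> < r" "r > 0"
  shows "\<forall>\<^sub>F s in at_right 0. s powr r \<le> H s"
proof -
  obtain q where q: "max 0 \<rho> < q" "q < r" using r dense[of "max 0 \<rho>" r] by auto
  have "((\<lambda>s. H (s * (1/2)) / H s) \<longlongrightarrow> (1/2) powr \<rho>) (at_right 0)"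
    using rv unfolding regularly_varying_at_zero_def by (rule allE[of _ "1/2"]) simp
  moreover have "(1/2::real) powr q < (1/2) powr \<rho>" using q by (intro powr_less_mono') auto
  ultimately have "\<forall>\<^sub>F s in at_right 0. (1/2) powr q < H (s * (1/2)) / H s"
    by (rule order_tendstoD(1))
  with regularly_varying_at_zero_ev_pos[OF rv nn]
  have "\<forall>\<^sub>F s in at_right 0. (1/2) powr q * H s \<le> H (s / 2) \<and> H s > 0"
    by eventually_elim (simp add: field_simps)
  then obtain s1 where s1: "s1 > 0"
    "\<And>s. 0 < s \<Longrightarrow> s < s1 \<Longrightarrow> (1/2) powr q * H s \<le> H (s / 2) \<and> H s > 0"
    unfolding eventually_at_right_field by auto
  define s0 where "s0 = s1 / 2"
  have s0: "s0 > 0" "\<And>s. 0 < s \<Longrightarrow> s \<le> s0 \<Longrightarrow> (1/2) powr q * H s \<le> H (s / 2)" "H (s0 / 2) > 0"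
    using s1 by (auto simp: s0_def)
  define C where "C = H (s0 / 2) / s0 powr q"
  have C: "C > 0" using s0 by (auto simp: C_def)
  have "C * s powr q \<le> H s" if "0 < s" "s \<le> s0" for s
    using s0(1) _ _ that
  proof (rule halving_induct)
    fix s assume s: "s0 / 2 \<le> s" "s \<le> s0"
    have "C * s powr q \<le> C * s0 powr q"
      using s s0 q r C by (intro mult_left_mono powr_mono2) auto
    also have "\<dots> = H (s0 / 2)" using s0 by (simp add: C_def)
    also have "\<dots> \<le> H s" using s by (intro monoD[OF mono])
    finally show "C * s powr q \<le> H s" .
  next
    fix s assume s: "0 < s" "s \<le> s0" "C * s powr q \<le> H s"
    have "C * (s / 2) powr q = C * ((1/2) * s) powr q" by simp
    also have "\<dots> = (1/2) powr q * (C * s powr q)" using s by (subst powr_mult) auto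
    also have "\<dots> \<le> (1/2) powr q * H s" using s by (intro mult_left_mono) auto
    also have "\<dots> \<le> H (s / 2)" using s0 s by blast
    finally show "C * (s / 2) powr q \<le> H (s / 2)" .
  qed
  then have 1: "\<forall>\<^sub>F s in at_right 0. C * s powr q \<le> H s"
    unfolding eventually_at_right_field using s0 by (auto intro!: exI[of _ s0])
  have "((\<lambda>s. s powr (r - q)) \<longlongrightarrow> 0) (at_right 0)"
    using q by real_asymp
  then have "\<forall>\<^sub>F s in at_right 0. s powr (r - q) < C" using C by (rule order_tendstoD)
  with 1 eventually_at_right_less show ?thesis
  proof eventually_elim
    case (elim s)
    have "s powr r = s powr (r - q) * s powr q"
      using elim by (simp add: powr_diff)
    also have "\<dots> \<le> C * s powr q" using elim by (intro mult_right_mono) auto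
    finally show ?case using elim by simp
  qed
qed

text \<open>Translates limits in the level x into limits in the exceedance probability s: by the
  intermediate value theorem a continuous tail takes every value below \<open>T x0\<close> at a
  point beyond x0.\<close>

lemma tendsto_at_right_0_of_surj:
  fixes T :: "real \<Rightarrow> real"
  assumes cont: "continuous_on UNIV T" and anti: "antimono T" and lim: "(T \<longlongrightarrow> 0) at_top"
    and pos: "\<And>x. T x > 0" and f: "((\<lambda>x. f (T x)) \<longlongrightarrow> l) at_top"
  shows "(f \<longlongrightarrow> l) (at_right 0)"
proof (rule topological_tendstoI)
  fix S assume "open S" "l \<in> S"
  then have "\<forall>\<^sub>F x in at_top. f (T x) \<in> S" using f by (rule topological_tendstoD[rotated])
  then obtain x0 where x0: "\<And>x. x \<ge> x0 \<Longrightarrow> f (T x) \<in> S" unfolding eventually_at_top_linorder by blast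
  have "f s \<in> S" if s: "0 < s" "s < T x0" for s
  proof -
    have "\<forall>\<^sub>F x in at_top. T x < s" using lim s by (intro order_tendstoD)
    then obtain x1 where x1: "x1 \<ge> x0" "T x1 < s" unfolding eventually_at_top_linorder
      by (meson linorder_linear order_trans)
    then obtain x where "x0 \<le> x" "T x = s"
      using IVT2'[of T x1 s x0] s continuous_on_subset[OF cont] by fastforce
    then show ?thesis using x0 by blast
  qed
  then show "\<forall>\<^sub>F s in at_right 0. f s \<in> S" unfolding eventually_at_right_field using pos by blast
qed

section \<open>Weibull-like tails and exponential rates\<close>

text \<open>A discrete Gronwall argument that works with increments instead of derivatives: each of
  n equal steps multiplies g by at least 1 - c (b - a)/n, and the product tends to an
  exponential.\<close>

lemma exp_lower_of_increments:
  fixes g :: "real \<Rightarrow> real"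
  assumes step: "\<And>v w. w0 \<le> v \<Longrightarrow> v \<le> w \<Longrightarrow> g v - g w \<le> c * (w - v) * g v"
    and ab: "w0 \<le> a" "a \<le> b" and c: "c \<ge> 0"
  shows "exp (- c * (b - a)) * g a \<le> g b"
proof -
  \<comment> \<open>The bound on n keeps the factor \<open>1 - c * d\<close> nonnegative, so that
    the one-step inequalities can be chained.\<close>
  have "(1 + (- c * (b - a)) / real n) ^ n * g a \<le> g b" if n: "real n > c * (b - a)" for n
  proof -
    have "n > 0" using n ab c by (smt (verit) mult_nonneg_nonneg gr0I of_nat_0)
    define d where "d = (b - a) / real n"
    have d: "d \<ge> 0" "real n * d = b - a" "c * d \<le> 1" "(1 + (- c * (b - a)) / real n) = 1 - c * d"
      using ab \<open>n > 0\<close> n by (auto simp: d_def field_simps)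
    have "(1 - c * d) ^ k * g a \<le> g (a + real k * d)" for k
    proof (induction k)
      case (Suc k)
      have "(1 - c * d) ^ Suc k * g a = (1 - c * d) * ((1 - c * d) ^ k * g a)" by simp
      also have "\<dots> \<le> (1 - c * d) * g (a + real k * d)"
        using Suc d by (intro mult_left_mono) auto
      also have "\<dots> \<le> g (a + real (Suc k) * d)"
        using add_increasing2[OF mult_nonneg_nonneg[OF of_nat_0_le_iff d(1)] ab(1), of k] step[of "a + real k * d" "a + real (Suc k) * d"] ab d
        by (simp add: algebra_simps)
      finally show ?case .
    qed simp
    from this[of n] d show ?thesis by simp
  qed
  then have "\<forall>\<^sub>F n in sequentially. (1 + (- c * (b - a)) / real n) ^ n * g a \<le> g b"
    using eventually_compose_filterlim[OF eventually_gt_at_top filterlim_real_sequentially]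
    by (rule eventually_mono[rotated]) blast
  then show ?thesis
    by (intro tendsto_upperbound[OF tendsto_mult[OF tendsto_exp_limit_sequentially tendsto_const]])
      auto
qed

text \<open>The same product with factors 1 + c (b - a)/n: the drop is measured against the value at
  the right end, so each step back to the left gains such a factor.\<close>

lemma exp_upper_of_increments:
  fixes g :: "real \<Rightarrow> real"
  assumes step: "\<And>v w. w0 \<le> v \<Longrightarrow> v \<le> w \<Longrightarrow> c * (w - v) * g w \<le> g v - g w"
    and ab: "w0 \<le> a" "a \<le> b" and c: "c \<ge> 0"
  shows "exp (c * (b - a)) * g b \<le> g a"
proof -
  have "(1 + (c * (b - a)) / real n) ^ n * g b \<le> g a" if n: "n > 0" for n
  proof -
    define d where "d = (b - a) / real n"
    have d: "d \<ge> 0" "real n * d = b - a" "(1 + (c * (b - a)) / real n) = 1 + c * d"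
      using ab n by (auto simp: d_def field_simps)
    have "(1 + c * d) ^ k * g (a + real k * d) \<le> g a" for k
    proof (induction k)
      case (Suc k)
      have "(1 + c * d) ^ Suc k * g (a + real (Suc k) * d)
          = (1 + c * d) ^ k * ((1 + c * d) * g (a + real (Suc k) * d))" by simp
      also have "\<dots> \<le> (1 + c * d) ^ k * g (a + real k * d)"
        using add_increasing2[OF mult_nonneg_nonneg[OF of_nat_0_le_iff d(1)] ab(1), of k] step[of "a + real k * d" "a + real (Suc k) * d"] ab d c
        by (intro mult_left_mono) (auto simp: algebra_simps)
      finally show ?case using Suc by linarith
    qed simp
    from this[of n] d show ?thesis by simp
  qed
  then have "\<forall>\<^sub>F n in sequentially. (1 + (c * (b - a)) / real n) ^ n * g b \<le> g a"
    by (auto intro: eventually_mono[OF eventually_gt_at_top])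
  then show ?thesis
    by (intro tendsto_upperbound[OF tendsto_mult[OF tendsto_exp_limit_sequentially tendsto_const]])
      auto
qed

section \<open>Elementary properties of tails\<close>

lemma (in prob_space) tail_antimono:
  assumes "X \<in> borel_measurable M"
  shows "antimono (tail M X)"
  unfolding tail_def using assms by (intro antimonoI finite_measure_mono) auto

lemma (in prob_space) tail_measurable [measurable]:
  assumes "X \<in> borel_measurable M"
  shows "tail M X \<in> borel_measurable borel"
proof -
  have "(\<lambda>x. - tail M X x) \<in> borel_measurable borel"
    using tail_antimono[OF assms] by (intro borel_measurable_mono) (simp add: monotone_def)
  from borel_measurable_uminus[OF this] show ?thesis by simp
qed

lemma (in prob_space) tail_bounds: "0 \<le> tail M X x" "tail M X x \<le> 1"
  by (simp_all add: tail_def)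

lemma regularly_varying_ev_pos:
  assumes "regularly_varying g \<kappa>"
  shows "\<forall>\<^sub>F t in at_top. g t > 0"
proof -
  have "((\<lambda>t. g (t * 1) / g t) \<longlongrightarrow> 1 powr \<kappa>) at_top"
    using assms unfolding regularly_varying_def by (metis zero_less_one)
  then have "\<forall>\<^sub>F t in at_top. g (t * 1) / g t > 0" by (rule order_tendstoD) simp
  with eventually_ge_at_top[of 0] show ?thesis
  proof eventually_elim
    case (elim t)
    then have "g t \<ge> 0" using assms unfolding regularly_varying_def by blast
    then show ?case using elim by (cases "g t = 0") auto
  qed
qed

text \<open>The unknown factor \<open>u\<close> and the exponential cancel in the quotient of the
  two asymptotics. What is kept of the Weibull assumption is that the hazard rate, density over
  tail, behaves like the derivative of \<theta> x^\<alpha>.\<close>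

lemma weibull_like_tail_hazard:
  assumes w: "weibull_like_tail M X \<alpha> \<theta>"
  obtains f where "\<And>x. f x \<ge> 0" "distributed M lborel X (\<lambda>x. ennreal (f x))"
    "((\<lambda>x. f x / (tail M X x * (\<theta> * \<alpha> * x powr (\<alpha> - 1)))) \<longlongrightarrow> 1) at_top"
    "\<forall>\<^sub>F x in at_top. tail M X x > 0"
proof -
  obtain u \<kappa> f where u: "regularly_varying u \<kappa>"
    and T: "tail M X \<sim>[at_top] (\<lambda>x. u x * exp (- \<theta> * x powr \<alpha>))"
    and f: "\<forall>x. f x \<ge> 0" "distributed M lborel X (\<lambda>x. ennreal (f x))"
      "f \<sim>[at_top] (\<lambda>x. u x * \<theta> * \<alpha> * x powr (\<alpha> - 1) * exp (- \<theta> * x powr \<alpha>))"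
    and pos: "\<alpha> > 0" "\<theta> > 0"
    using w unfolding weibull_like_tail_def by blast
  note up = regularly_varying_ev_pos[OF u]
  have T1: "((\<lambda>x. tail M X x / (u x * exp (- \<theta> * x powr \<alpha>))) \<longlongrightarrow> 1) at_top"
    by (rule asymp_equivD_strong[OF T]) (use up in \<open>auto elim: eventually_mono\<close>)
  have f1: "((\<lambda>x. f x / (u x * \<theta> * \<alpha> * x powr (\<alpha> - 1) * exp (- \<theta> * x powr \<alpha>))) \<longlongrightarrow> 1) at_top"
    by (rule asymp_equivD_strong[OF f(3)])
      (use eventually_conj[OF up eventually_gt_at_top[of 0]] pos in \<open>auto elim!: eventually_mono\<close>)
  have "\<forall>\<^sub>F x in at_top. tail M X x / (u x * exp (- \<theta> * x powr \<alpha>)) > 0"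
    using T1 by (rule order_tendstoD) simp
  with up have Tp: "\<forall>\<^sub>F x in at_top. tail M X x > 0"
    by eventually_elim (auto simp: zero_less_divide_iff zero_less_mult_iff mult_less_0_iff)
  have "((\<lambda>x. f x / (u x * \<theta> * \<alpha> * x powr (\<alpha> - 1) * exp (- \<theta> * x powr \<alpha>)) /
      (tail M X x / (u x * exp (- \<theta> * x powr \<alpha>)))) \<longlongrightarrow> 1 / 1) at_top"
    (is "(?q \<longlongrightarrow> _) _") by (intro tendsto_divide f1 T1) auto
  then have "(?q \<longlongrightarrow> 1) at_top" by (simp only: div_by_1)
  then have "((\<lambda>x. f x / (tail M X x * (\<theta> * \<alpha> * x powr (\<alpha> - 1)))) \<longlongrightarrow> 1) at_top"
  proof (rule Lim_transform_eventually)
    show "\<forall>\<^sub>F x in at_top. f x / (u x * \<theta> * \<alpha> * x powr (\<alpha> - 1) * exp (- \<theta> * x powr \<alpha>)) /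
        (tail M X x / (u x * exp (- \<theta> * x powr \<alpha>)))
      = f x / (tail M X x * (\<theta> * \<alpha> * x powr (\<alpha> - 1)))"
      using up Tp by eventually_elim (simp add: field_simps)
  qed
  with that f Tp show ?thesis by blast
qed

text \<open>The hazard rate in integrated form: -ln T grows like \<theta> x^\<alpha> up to a
  relative error \<epsilon>. A density need not be a pointwise derivative of the tail, so increments
  of T are written as integrals of f, bounded by freezing T at one end of the interval, and turned
  into exponential bounds.\<close>

lemma (in prob_space) weibull_like_tail_log_increment:
  assumes w: "weibull_like_tail M X \<alpha> \<theta>" and \<epsilon>: "0 < \<epsilon>" "\<epsilon> < 1"
  obtains x0 where "x0 > 0" "\<And>x. x \<ge> x0 \<Longrightarrow> tail M X x > 0"
    "\<And>a b. a \<ge> x0 \<Longrightarrow> b \<ge> x0 \<Longrightarrow>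
       \<bar>ln (tail M X a) - ln (tail M X b) - (\<theta> * b powr \<alpha> - \<theta> * a powr \<alpha>)\<bar>
         \<le> \<epsilon> * \<bar>\<theta> * b powr \<alpha> - \<theta> * a powr \<alpha>\<bar>"
proof -
  have pos: "\<alpha> > 0" "\<theta> > 0" using w by (auto simp: weibull_like_tail_def)
  obtain f where f: "\<And>x. f x \<ge> 0" "distributed M lborel X (\<lambda>x. ennreal (f x))"
    and lim: "((\<lambda>x. f x / (tail M X x * (\<theta> * \<alpha> * x powr (\<alpha> - 1)))) \<longlongrightarrow> 1) at_top"
    and Tp: "\<forall>\<^sub>F x in at_top. tail M X x > 0"
    using weibull_like_tail_hazard[OF w] by blast
  let ?T = "tail M X"
  define V' where "V' x = \<theta> * \<alpha> * x powr (\<alpha> - 1)" for x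
  have "\<forall>\<^sub>F x in at_top. f x / (?T x * V' x) > 1 - \<epsilon>" "\<forall>\<^sub>F x in at_top. f x / (?T x * V' x) < 1 + \<epsilon>"
    unfolding V'_def by (rule order_tendstoD[OF lim]; use \<epsilon> in simp)+
  with Tp eventually_ge_at_top[of 1]
  have "\<forall>\<^sub>F x in at_top. x \<ge> 1 \<and> ?T x > 0 \<and> (1 - \<epsilon>) * (?T x * V' x) \<le> f x \<and> f x \<le> (1 + \<epsilon>) * (?T x * V' x)"
  proof eventually_elim
    case (elim x)
    have "?T x * V' x > 0" using elim pos by (auto simp: V'_def)
    with elim show ?case by (simp add: pos_less_divide_eq pos_divide_less_eq)
  qed
  then obtain x0 where x0: "\<And>x. x \<ge> x0 \<Longrightarrow> x \<ge> 1 \<and> ?T x > 0 \<and>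
      (1 - \<epsilon>) * (?T x * V' x) \<le> f x \<and> f x \<le> (1 + \<epsilon>) * (?T x * V' x)"
    unfolding eventually_at_top_linorder by blast
  have x01: "x0 \<ge> 1" using x0 by blast
  have Xm[measurable]: "X \<in> borel_measurable M" using distributed_measurable[OF f(2)] by simp
  note anti = tail_antimono[OF Xm]
  have fm[measurable]: "(\<lambda>x. ennreal (f x)) \<in> borel_measurable borel"
    using distributed_borel_measurable[OF f(2)] by simp
  have incr: "ennreal (?T a - ?T b) = (\<integral>\<^sup>+x. ennreal (f x) * indicator {a..b} x \<partial>lborel)"
    if "a \<le> b" for a b
  proof -
    have "?T a - ?T b = prob ({\<omega> \<in> space M. X \<omega> > a} - {\<omega> \<in> space M. X \<omega> > b})"
      unfolding tail_def using that by (subst finite_measure_Diff) auto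
    also have "{\<omega> \<in> space M. X \<omega> > a} - {\<omega> \<in> space M. X \<omega> > b} = X -` {a<..b} \<inter> space M"
      by auto
    finally have "ennreal (?T a - ?T b) = emeasure M (X -` {a<..b} \<inter> space M)"
      by (simp add: emeasure_eq_measure)
    also have "\<dots> = (\<integral>\<^sup>+x. ennreal (f x) * indicator {a<..b} x \<partial>lborel)"
      using f by (intro distributed_emeasure) auto
    also have "\<dots> = (\<integral>\<^sup>+x. ennreal (f x) * indicator {a..b} x \<partial>lborel)"
      using AE_lborel_singleton[of a]
      by (intro nn_integral_cong_AE) (auto elim!: eventually_mono split: split_indicator)
    finally show ?thesis .
  qed
  have V: "(\<integral>\<^sup>+x. ennreal (C * V' x) * indicator {a..b} x \<partial>lborel)
      = ennreal (C * (\<theta> * b powr \<alpha> - \<theta> * a powr \<alpha>))" if "C \<ge> 0" "x0 \<le> a" "a \<le> b" for C a b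
  proof -
    have "(\<integral>\<^sup>+x. ennreal (C * V' x) * indicator {a..b} x \<partial>lborel)
        = C * (\<theta> * b powr \<alpha>) - C * (\<theta> * a powr \<alpha>)"
      using that x01 pos
      by (intro nn_integral_FTC_Icc) (auto simp: V'_def intro!: derivative_eq_intros)
    then show ?thesis by (simp add: algebra_simps)
  qed
  have Vmono: "\<theta> * a powr \<alpha> \<le> \<theta> * b powr \<alpha>" if "x0 \<le> a" "a \<le> b" for a b
    using that x01 pos by (auto intro!: mult_left_mono powr_mono2)
  have up: "?T a - ?T b \<le> (1 + \<epsilon>) * (\<theta> * b powr \<alpha> - \<theta> * a powr \<alpha>) * ?T a"
    if ab: "x0 \<le> a" "a \<le> b" for a b
  proof -
    have "ennreal (?T a - ?T b) \<le> (\<integral>\<^sup>+x. ennreal ((1 + \<epsilon>) * ?T a * V' x) * indicator {a..b} x \<partial>lborel)"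
      unfolding incr[OF ab(2)]
    proof (intro nn_integral_mono)
      fix x
      have "f x \<le> (1 + \<epsilon>) * ?T a * V' x" if "a \<le> x"
      proof -
        have "f x \<le> (1 + \<epsilon>) * (?T x * V' x)" using x0 that ab by simp
        also have "\<dots> \<le> (1 + \<epsilon>) * (?T a * V' x)"
          using that anti pos \<epsilon> by (intro mult_left_mono mult_right_mono) (auto simp: V'_def antimonoD)
        finally show ?thesis by simp
      qed
      then show "ennreal (f x) * indicator {a..b} x \<le> ennreal ((1 + \<epsilon>) * ?T a * V' x) * indicator {a..b} x"
        by (auto split: split_indicator intro!: ennreal_leI)
    qed
    also have "\<dots> = ennreal ((1 + \<epsilon>) * ?T a * (\<theta> * b powr \<alpha> - \<theta> * a powr \<alpha>))"
      using ab \<epsilon> tail_bounds by (intro V) auto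
    finally show ?thesis
      using Vmono[OF ab] \<epsilon> tail_bounds(1)[of X a]
      by (subst (asm) ennreal_le_iff) (auto simp: mult_ac)
  qed
  have lo: "(1 - \<epsilon>) * (\<theta> * b powr \<alpha> - \<theta> * a powr \<alpha>) * ?T b \<le> ?T a - ?T b"
    if ab: "x0 \<le> a" "a \<le> b" for a b
  proof -
    have "ennreal ((1 - \<epsilon>) * ?T b * (\<theta> * b powr \<alpha> - \<theta> * a powr \<alpha>))
       = (\<integral>\<^sup>+x. ennreal ((1 - \<epsilon>) * ?T b * V' x) * indicator {a..b} x \<partial>lborel)"
      using ab \<epsilon> tail_bounds by (intro V[symmetric]) auto
    also have "\<dots> \<le> ennreal (?T a - ?T b)"
      unfolding incr[OF ab(2)]
    proof (intro nn_integral_mono)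
      fix x
      have "(1 - \<epsilon>) * ?T b * V' x \<le> f x" if "a \<le> x" "x \<le> b"
      proof -
        have "(1 - \<epsilon>) * (?T b * V' x) \<le> (1 - \<epsilon>) * (?T x * V' x)"
          using that anti pos \<epsilon> by (intro mult_left_mono mult_right_mono) (auto simp: V'_def antimonoD)
        also have "\<dots> \<le> f x" using x0 that ab by simp
        finally show ?thesis by simp
      qed
      then show "ennreal ((1 - \<epsilon>) * ?T b * V' x) * indicator {a..b} x \<le> ennreal (f x) * indicator {a..b} x"
        by (auto split: split_indicator intro!: ennreal_leI)
    qed
    finally show ?thesis
      using antimonoD[OF anti ab(2)]
      by (subst (asm) ennreal_le_iff) (auto simp: mult_ac)
  qed
  \<comment> \<open>The tail in the variable w = \<theta> x^\<alpha>, where the hazard rate is close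
    to 1; \<open>up\<close> and \<open>lo\<close> become increment conditions with c = 1 +
    \<epsilon> and c = 1 - \<epsilon>.\<close>
  define g where "g w = ?T ((w / \<theta>) powr (1 / \<alpha>))" for w
  have g: "g (\<theta> * x powr \<alpha>) = ?T x" if "x \<ge> x0" for x
    using that x01 pos by (simp add: g_def powr_powr)
  have inv: "\<exists>x\<ge>x0. w = \<theta> * x powr \<alpha>" if "w \<ge> \<theta> * x0 powr \<alpha>" for w
  proof (intro exI conjI)
    have "x0 powr \<alpha> \<le> w / \<theta>" using that pos by (simp add: field_simps)
    moreover from this have "w / \<theta> > 0" using x01 by (smt (verit) powr_gt_zero)
    ultimately have "(x0 powr \<alpha>) powr (1 / \<alpha>) \<le> (w / \<theta>) powr (1 / \<alpha>)"
      using pos by (intro powr_mono2) auto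
    then show "x0 \<le> (w / \<theta>) powr (1 / \<alpha>)" using x01 pos by (simp add: powr_powr)
    show "w = \<theta> * ((w / \<theta>) powr (1 / \<alpha>)) powr \<alpha>"
      using pos \<open>w / \<theta> > 0\<close> by (simp add: powr_powr zero_less_divide_iff)
  qed
  have cmp: "x \<le> y" if "\<theta> * x powr \<alpha> \<le> \<theta> * y powr \<alpha>" "x \<ge> x0" "y \<ge> x0" for x y
    using that pos x01 by (smt (verit) mult_le_cancel_left_pos powr_less_mono2)
  have bnd: "\<bar>ln (?T a) - ln (?T b) - (\<theta> * b powr \<alpha> - \<theta> * a powr \<alpha>)\<bar>
         \<le> \<epsilon> * \<bar>\<theta> * b powr \<alpha> - \<theta> * a powr \<alpha>\<bar>" if ab: "x0 \<le> a" "a \<le> b" for a b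
  proof -
    let ?D = "\<theta> * b powr \<alpha> - \<theta> * a powr \<alpha>"
    have D: "?D \<ge> 0" using Vmono[OF ab] by simp
    have Tab: "?T a > 0" "?T b > 0" using x0 ab by auto
    have base: "\<theta> * x0 powr \<alpha> \<le> \<theta> * a powr \<alpha>" using Vmono ab by simp
    have "exp (- (1 + \<epsilon>) * ?D) * g (\<theta> * a powr \<alpha>) \<le> g (\<theta> * b powr \<alpha>)"
    proof (rule exp_lower_of_increments[OF _ base])
      fix v w assume "\<theta> * x0 powr \<alpha> \<le> v" "v \<le> w"
      then obtain x y where "x \<ge> x0" "v = \<theta> * x powr \<alpha>" "y \<ge> x0" "w = \<theta> * y powr \<alpha>"
        using inv by (meson order_trans)
      then show "g v - g w \<le> (1 + \<epsilon>) * (w - v) * g v"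
        using up[of x y] cmp[of x y] \<open>v \<le> w\<close> g by simp
    qed (use D \<epsilon> in auto)
    then have "exp (- (1 + \<epsilon>) * ?D) * ?T a \<le> ?T b" using ab g by simp
    then have "ln (exp (- (1 + \<epsilon>) * ?D) * ?T a) \<le> ln (?T b)" using Tab by (subst ln_le_cancel_iff) auto
    then have 1: "ln (?T a) - ln (?T b) \<le> (1 + \<epsilon>) * ?D" using Tab by (simp add: ln_mult algebra_simps)
    have "exp ((1 - \<epsilon>) * ?D) * g (\<theta> * b powr \<alpha>) \<le> g (\<theta> * a powr \<alpha>)"
    proof (rule exp_upper_of_increments[OF _ base])
      fix v w assume "\<theta> * x0 powr \<alpha> \<le> v" "v \<le> w"
      then obtain x y where "x \<ge> x0" "v = \<theta> * x powr \<alpha>" "y \<ge> x0" "w = \<theta> * y powr \<alpha>"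
        using inv by (meson order_trans)
      then show "(1 - \<epsilon>) * (w - v) * g w \<le> g v - g w"
        using lo[of x y] cmp[of x y] \<open>v \<le> w\<close> g by simp
    qed (use D \<epsilon> in auto)
    then have "exp ((1 - \<epsilon>) * ?D) * ?T b \<le> ?T a" using ab g by simp
    then have "ln (exp ((1 - \<epsilon>) * ?D) * ?T b) \<le> ln (?T a)" using Tab by (subst ln_le_cancel_iff) auto
    then have 2: "ln (?T a) - ln (?T b) \<ge> (1 - \<epsilon>) * ?D" using Tab by (simp add: ln_mult algebra_simps)
    show ?thesis using 1 2 D by (simp add: abs_le_iff algebra_simps)
  qed
  show ?thesis
  proof (rule that)
    fix a b assume "a \<ge> x0" "b \<ge> x0"
    then show "\<bar>ln (?T a) - ln (?T b) - (\<theta> * b powr \<alpha> - \<theta> * a powr \<alpha>)\<bar>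
         \<le> \<epsilon> * \<bar>\<theta> * b powr \<alpha> - \<theta> * a powr \<alpha>\<bar>"
      using bnd[of a b] bnd[of b a] by (cases "a \<le> b") (auto simp: abs_minus_commute)
  qed (use x0 x01 in auto)
qed

lemma (in prob_space) weibull_like_tail_ratio:
  assumes w: "weibull_like_tail M X \<alpha> \<theta>"
    and ab: "filterlim a at_top F" "filterlim b at_top F"
    and l: "((\<lambda>x. \<theta> * b x powr \<alpha> - \<theta> * a x powr \<alpha>) \<longlongrightarrow> l) F"
  shows "((\<lambda>x. tail M X (a x) / tail M X (b x)) \<longlongrightarrow> exp l) F"
proof -
  let ?T = "tail M X" and ?D = "\<lambda>x. \<theta> * b x powr \<alpha> - \<theta> * a x powr \<alpha>"
  have ev: "\<forall>\<^sub>F x in F. a x \<ge> x0 \<and> b x \<ge> x0" for x0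
    using ab by (simp add: filterlim_at_top eventually_conj)
  have "((\<lambda>x. (ln (?T (a x)) - ln (?T (b x)) - ?D x)) \<longlongrightarrow> 0) F"
  proof (rule tendstoI)
    fix e :: real assume "e > 0"
    \<comment> \<open>The increment is eventually below |l| + 1, so this \<epsilon> makes the error
      at most e/2; the cap 1/2 ensures \<epsilon> < 1.\<close>
    define \<epsilon> where "\<epsilon> = min (1/2) (e / (2 * (\<bar>l\<bar> + 1)))"
    have \<epsilon>: "0 < \<epsilon>" "\<epsilon> < 1" using \<open>e > 0\<close> by (auto simp: \<epsilon>_def)
    obtain x0 where x0: "\<And>a b. a \<ge> x0 \<Longrightarrow> b \<ge> x0 \<Longrightarrow>
       \<bar>ln (tail M X a) - ln (tail M X b) - (\<theta> * b powr \<alpha> - \<theta> * a powr \<alpha>)\<bar>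
         \<le> \<epsilon> * \<bar>\<theta> * b powr \<alpha> - \<theta> * a powr \<alpha>\<bar>"
      using weibull_like_tail_log_increment[OF w \<epsilon>] by metis
    have "\<forall>\<^sub>F x in F. \<bar>?D x\<bar> < \<bar>l\<bar> + 1"
      using tendsto_rabs[OF l] by (rule order_tendstoD) simp
    with ev[of x0] show "\<forall>\<^sub>F x in F. dist (ln (?T (a x)) - ln (?T (b x)) - ?D x) 0 < e"
    proof eventually_elim
      case (elim x)
      have "\<bar>ln (?T (a x)) - ln (?T (b x)) - ?D x\<bar> \<le> \<epsilon> * \<bar>?D x\<bar>" using x0 elim by blast
      also have "\<dots> \<le> (e / (2 * (\<bar>l\<bar> + 1))) * (\<bar>l\<bar> + 1)"
        using elim \<epsilon> by (intro mult_mono) (auto simp: \<epsilon>_def)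
      also have "\<dots> = e / 2" by (simp add: field_simps add_nonneg_eq_0_iff)
      finally show ?case using \<open>e > 0\<close> by simp
    qed
  qed
  from tendsto_add[OF this l] have "((\<lambda>x. ln (?T (a x)) - ln (?T (b x))) \<longlongrightarrow> l) F" by simp
  then have *: "((\<lambda>x. exp (ln (?T (a x)) - ln (?T (b x)))) \<longlongrightarrow> exp l) F" by (intro tendsto_intros)
  obtain x0 where x0: "\<And>x. x \<ge> x0 \<Longrightarrow> ?T x > 0"
    using weibull_like_tail_log_increment[OF w, of "1/2"] by (metis half_gt_zero_iff less_numeral_extra(1) field_sum_of_halves less_add_same_cancel1)
  show ?thesis
  proof (rule Lim_transform_eventually[OF *])
    show "\<forall>\<^sub>F x in F. exp (ln (?T (a x)) - ln (?T (b x))) = ?T (a x) / ?T (b x)"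
      using ev[of x0] by eventually_elim (simp add: exp_diff x0)
  qed
qed

text \<open>For positive P this is liminf -ln P(x) / x^p \<ge> r, and the companion below is limsup
  \<le> r. The form with exponentials also covers P with zeros, and the strict slack in \<rho>
  absorbs constant factors. Holding for all r expresses decay faster than every exp(-r x^p).\<close>

definition exp_rate_ge :: "real \<Rightarrow> real \<Rightarrow> (real \<Rightarrow> real) \<Rightarrow> bool" where
  "exp_rate_ge p r P \<longleftrightarrow> (\<forall>\<rho><r. \<forall>\<^sub>F x in at_top. P x \<le> exp (- \<rho> * x powr p))"

definition exp_rate_le :: "real \<Rightarrow> real \<Rightarrow> (real \<Rightarrow> real) \<Rightarrow> bool" where
  "exp_rate_le p r P \<longleftrightarrow> (\<forall>\<rho>>r. \<forall>\<^sub>F x in at_top. exp (- \<rho> * x powr p) \<le> P x)"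

lemma ev_powr_ge: "p > 0 \<Longrightarrow> \<forall>\<^sub>F x::real in at_top. x powr p \<ge> C"
  by (rule eventually_compose_filterlim[OF eventually_ge_at_top]) real_asymp

lemma (in prob_space) weibull_like_tail_exp_rate:
  assumes w: "weibull_like_tail M X \<alpha> \<theta>"
  shows "exp_rate_ge \<alpha> \<theta> (tail M X)" "exp_rate_le \<alpha> \<theta> (tail M X)"
proof -
  have pos: "\<alpha> > 0" "\<theta> > 0" using w by (auto simp: weibull_like_tail_def)
  let ?T = "tail M X"
  have *: "\<forall>\<^sub>F x in at_top. exp (- (1 + \<delta>) * \<theta> * x powr \<alpha>) \<le> ?T x \<and> ?T x \<le> exp (- (1 - \<delta>) * \<theta> * x powr \<alpha>)"
    if \<delta>: "0 < \<delta>" "\<delta> < 1" for \<delta>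
  proof -
    obtain x0 where x0: "x0 > 0" "\<And>x. x \<ge> x0 \<Longrightarrow> ?T x > 0" "\<And>a b. a \<ge> x0 \<Longrightarrow> b \<ge> x0 \<Longrightarrow>
       \<bar>ln (tail M X a) - ln (tail M X b) - (\<theta> * b powr \<alpha> - \<theta> * a powr \<alpha>)\<bar>
         \<le> \<delta> / 2 * \<bar>\<theta> * b powr \<alpha> - \<theta> * a powr \<alpha>\<bar>"
      using weibull_like_tail_log_increment[OF w, of "\<delta> / 2"] \<delta> by auto
    \<comment> \<open>One half of \<delta> pays for the relative error of the increment between x0
      and x, the other half for the contributions of the fixed point x0, which K collects.\<close>
    define K where "K = \<bar>ln (?T x0)\<bar> + 2 * \<theta> * x0 powr \<alpha>"
    have "\<forall>\<^sub>F x in at_top. x powr \<alpha> \<ge> K / (\<delta> / 2 * \<theta>)" using pos by (intro ev_powr_ge)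
    with eventually_ge_at_top[of x0] show ?thesis
    proof eventually_elim
      case (elim x)
      have K: "K \<le> \<delta> / 2 * (\<theta> * x powr \<alpha>)" using elim pos \<delta> by (simp add: field_simps)
      have "\<theta> * x0 powr \<alpha> \<le> \<theta> * x powr \<alpha>" using elim pos x0 by (intro mult_left_mono powr_mono2) auto
      then have "\<bar>\<theta> * x0 powr \<alpha> - \<theta> * x powr \<alpha>\<bar> = \<theta> * x powr \<alpha> - \<theta> * x0 powr \<alpha>" by simp
      with x0(3)[of x x0] elim
      have "\<bar>ln (?T x) - ln (?T x0) + (\<theta> * x powr \<alpha> - \<theta> * x0 powr \<alpha>)\<bar>
         \<le> \<delta> / 2 * (\<theta> * x powr \<alpha> - \<theta> * x0 powr \<alpha>)" by (simp add: algebra_simps)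
      moreover have "\<delta> / 2 * (\<theta> * x0 powr \<alpha>) \<le> 1 * (\<theta> * x0 powr \<alpha>)"
        by (rule mult_right_mono) (use pos \<delta> in auto)
      moreover have "0 \<le> \<delta> / 2 * (\<theta> * x0 powr \<alpha>)" using pos \<delta> by auto
      ultimately have "ln (?T x) \<le> - (\<theta> * x powr \<alpha>) + \<delta> * (\<theta> * x powr \<alpha>)"
        "- (\<theta> * x powr \<alpha>) - \<delta> * (\<theta> * x powr \<alpha>) \<le> ln (?T x)"
        using K unfolding K_def by (auto simp: abs_le_iff right_diff_distrib abs_if split: if_splits)
      then have "exp (ln (?T x)) \<le> exp (- (1 - \<delta>) * \<theta> * x powr \<alpha>)"
        "exp (- (1 + \<delta>) * \<theta> * x powr \<alpha>) \<le> exp (ln (?T x))"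
        by (simp_all only: exp_le_cancel_iff) (simp_all add: algebra_simps)
      then show ?case using x0(2)[OF elim(1)] by simp
    qed
  qed
  show "exp_rate_ge \<alpha> \<theta> ?T" unfolding exp_rate_ge_def
  proof (intro allI impI)
    fix \<rho> assume "\<rho> < \<theta>"
    define \<delta> where "\<delta> = min (1/2) ((\<theta> - \<rho>) / \<theta>)"
    have \<delta>: "0 < \<delta>" "\<delta> < 1" "\<rho> \<le> (1 - \<delta>) * \<theta>"
      using \<open>\<rho> < \<theta>\<close> pos by (auto simp: \<delta>_def min_def field_simps)
    show "\<forall>\<^sub>F x in at_top. ?T x \<le> exp (- \<rho> * x powr \<alpha>)"
      using *[OF \<delta>(1,2)]
    proof eventually_elim
      case (elim x)
      have "\<rho> * x powr \<alpha> \<le> (1 - \<delta>) * \<theta> * x powr \<alpha>" using \<delta> by (intro mult_right_mono) auto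
      then show ?case using elim by (smt (verit) exp_le_cancel_iff mult_minus_left)
    qed
  qed
  show "exp_rate_le \<alpha> \<theta> ?T" unfolding exp_rate_le_def
  proof (intro allI impI)
    fix \<rho> assume "\<rho> > \<theta>"
    define \<delta> where "\<delta> = min (1/2) ((\<rho> - \<theta>) / \<theta>)"
    have \<delta>: "0 < \<delta>" "\<delta> < 1" "(1 + \<delta>) * \<theta> \<le> \<rho>"
      using \<open>\<rho> > \<theta>\<close> pos by (auto simp: \<delta>_def min_def field_simps)
    show "\<forall>\<^sub>F x in at_top. exp (- \<rho> * x powr \<alpha>) \<le> ?T x"
      using *[OF \<delta>(1,2)]
    proof eventually_elim
      case (elim x)
      have "(1 + \<delta>) * \<theta> * x powr \<alpha> \<le> \<rho> * x powr \<alpha>" using \<delta> by (intro mult_right_mono) auto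
      then show ?case using elim by (smt (verit) exp_le_cancel_iff mult_minus_left)
    qed
  qed
qed

section \<open>Dependence parameters in terms of the joint tail\<close>

definition joint_exceedance :: "'a measure \<Rightarrow> ('a \<Rightarrow> real) \<Rightarrow> ('a \<Rightarrow> real) \<Rightarrow> real \<Rightarrow> real" where
  "joint_exceedance M W1 W2 s =
     (let F = cdf (distr M borel W1) in \<P>(\<omega> in M. F (W1 \<omega>) > 1 - s \<and> F (W2 \<omega>) > 1 - s))"

lemma (in prob_space) cdf_eq_tail:
  assumes [measurable]: "W \<in> borel_measurable M"
  shows "cdf (distr M borel W) x = 1 - tail M W x"
proof -
  have "cdf (distr M borel W) x = prob {\<omega> \<in> space M. W \<omega> \<le> x}"
    by (simp add: cdf_def measure_distr vimage_def Int_def conj_commute)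
  also have "{\<omega> \<in> space M. W \<omega> \<le> x} = space M - {\<omega> \<in> space M. W \<omega> > x}" by auto
  also have "prob \<dots> = 1 - tail M W x"
    unfolding tail_def by (subst prob_compl) auto
  finally show ?thesis .
qed

lemma (in prob_space) tail_cong_distr:
  assumes "W1 \<in> borel_measurable M" "W2 \<in> borel_measurable M" "distr M borel W1 = distr M borel W2"
  shows "tail M W1 x = tail M W2 x"
  using cdf_eq_tail[OF assms(1), of x] cdf_eq_tail[OF assms(2), of x] assms(3) by simp

lemma (in prob_space) tail_tendsto_0:
  assumes "W \<in> borel_measurable M"
  shows "(tail M W \<longlongrightarrow> 0) at_top"
proof -
  interpret D: real_distribution "distr M borel W" using assms by simp
  have "((\<lambda>x. 1 - cdf (distr M borel W) x) \<longlongrightarrow> 1 - 1) at_top"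
    by (intro tendsto_intros D.cdf_lim_at_top_prob)
  then show ?thesis by (simp add: cdf_eq_tail[OF assms])
qed

lemma (in prob_space) tail_tendsto_at_right_0:
  assumes "W \<in> borel_measurable M" "\<And>x. tail M W x > 0"
  shows "filterlim (tail M W) (at_right 0) at_top"
  using tail_tendsto_0[OF assms(1)] less_imp_neq[OF assms(2)]
  by (auto simp: filterlim_at assms(2))

text \<open>The set where \<open>F(W) = F(x)\<close> and \<open>W > x\<close> is a flat piece of \<open>F\<close>; it is covered by
  countably many intervals \<open>(x, t]\<close> that the distribution does not charge.\<close>
lemma (in prob_space) AE_cdf_less_iff:
  assumes [measurable]: "W \<in> borel_measurable M"
  shows "AE \<omega> in M. cdf (distr M borel W) x < cdf (distr M borel W) (W \<omega>) \<longleftrightarrow> x < W \<omega>"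
proof -
  define F where "F = cdf (distr M borel W)"
  interpret D: real_distribution "distr M borel W" by simp
  have Fmono: "a \<le> b \<Longrightarrow> F a \<le> F b" for a b unfolding F_def by (rule D.cdf_nondecreasing)
  define S where "S = {y. x < y \<and> F y = F x}"
  \<comment> \<open>The rational points of \<open>S\<close> together with its largest element, if
    there is one: a countable set that reaches every point of \<open>S\<close> from above.\<close>
  define C where "C = (S \<inter> \<rat>) \<union> {m \<in> S. \<forall>y\<in>S. y \<le> m}"
  have "finite {m \<in> S. \<forall>y\<in>S. y \<le> m}"
    by (rule finite_subset[of _ "{Sup S}"]) (auto intro!: cSup_eq_maximum[symmetric])
  then have C: "countable C" unfolding C_def
    by (intro countable_Un countable_finite countable_Int2 countable_rat)
  have "AE \<omega> in M. \<not> (x < W \<omega> \<and> W \<omega> \<le> t)" if "t \<in> C" for t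
  proof -
    have t: "x < t" "F t = F x" using that by (auto simp: C_def S_def)
    then have "measure (distr M borel W) {x<..t} = 0"
      using D.cdf_diff_eq[of x t] by (simp add: F_def)
    then have "prob {\<omega> \<in> space M. x < W \<omega> \<and> W \<omega> \<le> t} = 0"
      by (simp add: measure_distr vimage_def Int_def conj_commute)
    then show ?thesis by (subst (asm) prob_eq_0) auto
  qed
  then have "AE \<omega> in M. \<forall>t\<in>C. \<not> (x < W \<omega> \<and> W \<omega> \<le> t)" using C by (subst AE_ball_countable) auto
  then show ?thesis
  proof eventually_elim
    case (elim \<omega>)
    have "F x < F (W \<omega>)" if less: "x < W \<omega>"
    proof (rule ccontr)
      assume "\<not> F x < F (W \<omega>)"
      then have W: "W \<omega> \<in> S" using Fmono[of x "W \<omega>"] less by (auto simp: S_def)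
      then have "W \<omega> \<notin> C" using elim less by blast
      then obtain y where y: "y \<in> S" "W \<omega> < y" using W by (auto simp: C_def not_le)
      obtain q where q: "q \<in> \<rat>" "W \<omega> < q" "q < y" using Rats_dense_in_real[OF y(2)] by blast
      have "q \<in> S" using W y q Fmono[of "W \<omega>" q] Fmono[of q y] by (auto simp: S_def)
      then show False using elim less q by (auto simp: C_def dest!: bspec[of _ _ q])
    qed
    then show ?case using Fmono[of "W \<omega>" x] by (fastforce simp: F_def[symmetric])
  qed
qed

lemma (in prob_space) cdf_compose_measurable [measurable]:
  assumes [measurable]: "W1 \<in> borel_measurable M" "W2 \<in> borel_measurable M"
  shows "(\<lambda>\<omega>. cdf (distr M borel W1) (W2 \<omega>)) \<in> borel_measurable M"
proof -
  interpret D: real_distribution "distr M borel W1" by simp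
  have [measurable]: "cdf (distr M borel W1) \<in> borel_measurable borel"
    by (intro borel_measurable_mono monoI D.cdf_nondecreasing)
  show ?thesis by measurable
qed

text \<open>Atoms in the tail are admitted as long as they are asymptotically negligible; this is what
  makes \<open>P(F(W) > 1 - s)\<close> equivalent to \<open>s\<close>.\<close>
locale tail_pair = prob_space M for M :: "'a measure" +
  fixes W1 W2 :: "'a \<Rightarrow> real"
  assumes W1[measurable]: "W1 \<in> borel_measurable M" and W2[measurable]: "W2 \<in> borel_measurable M"
    and same: "distr M borel W1 = distr M borel W2"
    and tail_pos: "\<And>x. tail M W1 x > 0"
    and light_atoms: "((\<lambda>x. prob {\<omega> \<in> space M. W1 \<omega> \<ge> x} / tail M W1 x) \<longlongrightarrow> 1) at_top"
begin

abbreviation "T \<equiv> tail M W1"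
abbreviation "H \<equiv> joint_exceedance M W1 W2"
abbreviation "G \<equiv> tail M (\<lambda>\<omega>. min (W1 \<omega>) (W2 \<omega>))"

lemma H_mono: "mono H"
  unfolding joint_exceedance_def Let_def by (intro monoI finite_measure_mono) auto

lemma H_nonneg: "H s \<ge> 0"
  by (simp add: joint_exceedance_def Let_def)

text \<open>Exact at every x, also on flat pieces of F, since F(W) > F(x) and W > x agree off a null
  set. As F is read off \<open>W1\<close>, the claim for \<open>W2\<close> passes through the
  equality of laws.\<close>

lemma H_tail: "H (T x) = G x"
proof -
  let ?F = "cdf (distr M borel W1)"
  have "AE \<omega> in M. ?F x < ?F (W2 \<omega>) \<longleftrightarrow> x < W2 \<omega>"
    unfolding same by (rule AE_cdf_less_iff) simp
  moreover have "AE \<omega> in M. ?F x < ?F (W1 \<omega>) \<longleftrightarrow> x < W1 \<omega>"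
    by (rule AE_cdf_less_iff) simp
  ultimately have "AE \<omega> in M. ?F x < ?F (W1 \<omega>) \<and> ?F x < ?F (W2 \<omega>) \<longleftrightarrow> x < min (W1 \<omega>) (W2 \<omega>)"
    by eventually_elim auto
  moreover have "1 - T x = ?F x" by (simp add: cdf_eq_tail)
  ultimately show ?thesis unfolding joint_exceedance_def Let_def tail_def
    by (intro finite_measure_eq_AE) (auto simp: tail_def[symmetric])
qed

text \<open>The denominator of the conditional exceedance. For continuous F it is s itself on (0,1);
  atoms can make it differ from s.\<close>

definition D :: "real \<Rightarrow> real" where
  "D s = prob {\<omega> \<in> space M. cdf (distr M borel W1) (W2 \<omega>) > 1 - s}"

lemma H_le_D: "H s \<le> D s"
  unfolding joint_exceedance_def Let_def D_def by (intro finite_measure_mono) auto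

lemma cond_exceedance_eq: "cond_exceedance M W1 W2 (1 - s) = H s / D s"
  by (simp add: cond_exceedance_def joint_exceedance_def Let_def D_def cond_prob_def)

text \<open>At the quantile a of level s, both s and \<open>D s\<close> lie between P(W > a) and P(W
  \<ge> a), and the ratio of these two tends to 1.\<close>

lemma D_asymp: "((\<lambda>s. D s / s) \<longlongrightarrow> 1) (at_right 0)"
proof -
  let ?F = "cdf (distr M borel W1)"
  interpret D: real_distribution "distr M borel W1" by simp
  define U where "U x = prob {\<omega> \<in> space M. W1 \<omega> \<ge> x}" for x
  have U_eq: "U x = prob {\<omega> \<in> space M. W2 \<omega> \<ge> x}" for x
  proof -
    have "U x = measure (distr M borel W1) {x..}"
      by (simp add: U_def measure_distr vimage_def Int_def conj_commute)
    also have "\<dots> = prob {\<omega> \<in> space M. W2 \<omega> \<ge> x}"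
      unfolding same by (simp add: measure_distr vimage_def Int_def conj_commute)
    finally show ?thesis .
  qed
  note T_eq = tail_cong_distr[OF W1 W2 same]
  note anti = tail_antimono[OF W1]
  have F_eq: "?F y > 1 - s \<longleftrightarrow> T y < s" for y s by (auto simp: cdf_eq_tail)
  have U_left: "(T \<longlongrightarrow> U a) (at_left a)" for a
  proof -
    have "((\<lambda>x. 1 - ?F x) \<longlongrightarrow> 1 - measure (distr M borel W1) {..<a}) (at_left a)"
      by (intro tendsto_intros D.cdf_at_left)
    moreover have "1 - measure (distr M borel W1) {..<a} = measure (distr M borel W1) {a..}"
      using D.prob_compl[of "{..<a}"] by (simp add: Compl_eq_Diff_UNIV[symmetric])
    moreover have "measure (distr M borel W1) {a..} = U a"
      by (simp add: U_def measure_distr vimage_def Int_def conj_commute)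
    ultimately show ?thesis by (simp add: cdf_eq_tail)
  qed
  have T_right: "(T \<longlongrightarrow> T a) (at_right a)" for a
  proof -
    have "((\<lambda>x. 1 - ?F x) \<longlongrightarrow> 1 - ?F a) (at_right a)"
      using D.cdf_is_right_cont[of a] by (intro tendsto_intros) (simp add: continuous_within)
    then show ?thesis by (simp add: cdf_eq_tail)
  qed
  have key: "\<exists>a\<ge>K. T a \<le> D s \<and> T a \<le> s \<and> D s \<le> U a \<and> s \<le> U a"
    if s: "0 < s" "s < 1" "s < T K" for s K
  proof -
    \<comment> \<open>The infimum \<open>a\<close> of this set is the quantile at level s, and
      \<open>s < T K\<close> forces it beyond K. The right limit of T at \<open>a\<close> gives
      \<open>T a \<le> s\<close>, the left limit gives \<open>s \<le> U a\<close>.\<close>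
    define A where "A = {x. T x < s}"
    have "\<forall>\<^sub>F x in at_top. T x < s" using tail_tendsto_0[OF W1] s by (intro order_tendstoD)
    then have ne: "A \<noteq> {}" unfolding A_def eventually_at_top_linorder by auto
    have K: "K \<le> x" if "x \<in> A" for x
      using that s antimonoD[OF anti, of x K] by (force simp: A_def)
    have bdd: "bdd_below A" by (rule bdd_belowI[of _ K]) (rule K)
    define a where "a = Inf A"
    have "K \<le> a" unfolding a_def using K ne by (intro cInf_greatest) auto
    have above: "T y < s" if y: "y > a" for y
    proof -
      obtain x where "x \<in> A" "x < y" using cInf_lessD[OF ne, of y] y unfolding a_def by blast
      then show ?thesis using antimonoD[OF anti, of x y] by (force simp: A_def)
    qed
    have below: "a \<le> y" if "T y < s" for y
      using that bdd unfolding a_def by (intro cInf_lower) (auto simp: A_def)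
    have "T a \<le> s"
      by (rule tendsto_upperbound[OF T_right])
        (auto intro: eventually_mono[OF eventually_at_right_less] less_imp_le above)
    moreover have "s \<le> U a"
    proof (rule tendsto_lowerbound[OF U_left])
      have "\<forall>\<^sub>F y in at_left a. y < a"
        by (auto simp: eventually_at_filter)
      then show "\<forall>\<^sub>F y in at_left a. s \<le> T y"
        by eventually_elim (use below in \<open>force simp: not_le[symmetric]\<close>)
    qed auto
    moreover have "T a \<le> D s"
    proof -
      have "T a = prob {\<omega> \<in> space M. a < W2 \<omega>}" using T_eq[of a] by (simp add: tail_def)
      also have "\<dots> \<le> D s" unfolding D_def F_eq
        using above by (intro finite_measure_mono) auto
      finally show ?thesis .
    qed
    moreover have "D s \<le> U a" unfolding D_def U_eq F_eq
      using below by (intro finite_measure_mono) auto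
    ultimately show ?thesis using \<open>K \<le> a\<close> by blast
  qed
  show ?thesis
  proof (rule tendstoI)
    fix e :: real assume e: "e > 0"
    have "\<forall>\<^sub>F x in at_top. U x / T x < 1 + e"
      using light_atoms e unfolding U_def by (intro order_tendstoD) auto
    then obtain K where K: "\<And>x. x \<ge> K \<Longrightarrow> U x / T x < 1 + e"
      unfolding eventually_at_top_linorder by blast
    have "dist (D s / s) 1 < e" if s: "0 < s" "s < min 1 (T K)" for s
    proof -
      obtain a where a: "a \<ge> K" "T a \<le> D s" "T a \<le> s" "D s \<le> U a" "s \<le> U a"
        using key[of s K] s by auto
      have U: "U a < (1 + e) * T a" using K[OF a(1)] tail_pos[of a] by (simp add: pos_divide_less_eq)
      have "D s < (1 + e) * s" using U a e mult_left_mono[of "T a" s "1 + e"] by linarith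
      moreover have sD: "s < (1 + e) * D s" using U a e mult_left_mono[of "T a" "D s" "1 + e"] by linarith
      moreover have "D s > 0" using a tail_pos[of a] by linarith
      \<comment> \<open>Follows from \<open>s < (1 + e) * D s\<close>, as (1 - e)(1 + e) \<le> 1;
        for e \<ge> 1 the left side is not positive.\<close>
      moreover have "(1 - e) * s < D s"
      proof (cases "e < 1")
        case True
        have "(1 - e) * s < (1 - e) * ((1 + e) * D s)" using True sD by (intro mult_strict_left_mono) auto
        also have "\<dots> = D s - e\<^sup>2 * D s" by (simp add: algebra_simps power2_eq_square)
        also have "\<dots> \<le> D s" using \<open>D s > 0\<close> by simp
        finally show ?thesis .
      next
        case False
        then have "(1 - e) * s \<le> 0" using s by (simp add: mult_nonpos_nonneg)
        then show ?thesis using \<open>D s > 0\<close> by linarith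
      qed
      ultimately show ?thesis using s by (simp add: dist_real_def abs_less_iff field_simps)
    qed
    then show "\<forall>\<^sub>F s in at_right 0. dist (D s / s) 1 < e"
      unfolding eventually_at_right_field using tail_pos[of K] by (intro exI[of _ "min 1 (T K)"]) auto
  qed
qed

lemma D_ev_pos: "\<forall>\<^sub>F s in at_right 0. D s > 0"
proof -
  have "\<forall>\<^sub>F s in at_right 0. D s / s > 0" using D_asymp by (rule order_tendstoD) simp
  with eventually_at_right_less show ?thesis by eventually_elim (simp add: zero_less_divide_iff)
qed

lemma has_tail_dependence_iff:
  "has_tail_dependence M W1 W2 chi \<longleftrightarrow> ((\<lambda>s. H s / s) \<longlongrightarrow> chi) (at_right 0)"
proof -
  have "has_tail_dependence M W1 W2 chi \<longleftrightarrow> ((\<lambda>s. H s / D s) \<longlongrightarrow> chi) (at_right 0)"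
    unfolding has_tail_dependence_def
    by (simp add: filterlim_at_left_to_right at_right_to_0[of "- 1"] filterlim_filtermap
        cond_exceedance_eq)
  also have "\<dots> \<longleftrightarrow> ((\<lambda>s. H s / s) \<longlongrightarrow> chi) (at_right 0)"
  proof
    assume "((\<lambda>s. H s / D s) \<longlongrightarrow> chi) (at_right 0)"
    from tendsto_mult[OF this D_asymp] have *: "((\<lambda>s. H s / D s * (D s / s)) \<longlongrightarrow> chi) (at_right 0)" by simp
    show "((\<lambda>s. H s / s) \<longlongrightarrow> chi) (at_right 0)"
      by (rule Lim_transform_eventually[OF *]) (use D_ev_pos in \<open>eventually_elim, simp\<close>)
  next
    assume "((\<lambda>s. H s / s) \<longlongrightarrow> chi) (at_right 0)"
    from tendsto_divide[OF this D_asymp] have *: "((\<lambda>s. H s / s / (D s / s)) \<longlongrightarrow> chi) (at_right 0)" by simp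
    show "((\<lambda>s. H s / D s) \<longlongrightarrow> chi) (at_right 0)"
      by (rule Lim_transform_eventually[OF *]) (use eventually_at_right_less in \<open>eventually_elim, simp\<close>)
  qed
  finally show ?thesis .
qed

lemma D_scale:
  assumes "x > 0"
  shows "((\<lambda>s. D (s * x) / D s) \<longlongrightarrow> x) (at_right 0)"
proof -
  have "filterlim (\<lambda>s. s * x) (at_right 0) (at_right 0)" using assms by real_asymp
  from filterlim_compose[OF D_asymp this] have "((\<lambda>s. D (s * x) / (s * x)) \<longlongrightarrow> 1) (at_right 0)" .
  from tendsto_mult[OF tendsto_divide[OF this D_asymp] tendsto_const[of x]]
  have *: "((\<lambda>s. D (s * x) / (s * x) / (D s / s) * x) \<longlongrightarrow> x) (at_right 0)" by simp
  show ?thesis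
    by (rule Lim_transform_eventually[OF *]) (use eventually_at_right_less[of 0] in \<open>eventually_elim, use assms in simp\<close>)
qed

text \<open>On (0,1) the defining equation reads H(s) = L(s) s^(1/\<eta> - 1) D(s), and D, being
  asymptotic to s, has index 1. Hence slow variation of L amounts to index 1/\<eta> of H; for the
  converse, L is solved from the equation.\<close>

lemma has_coeff_tail_dependence_iff:
  "has_coeff_tail_dependence M W1 W2 \<eta> \<longleftrightarrow>
     0 < \<eta> \<and> \<eta> \<le> 1 \<and> regularly_varying_at_zero H (1 / \<eta>)"
proof (intro iffI conjI; (elim conjE)?)
  assume "has_coeff_tail_dependence M W1 W2 \<eta>"
  then obtain L where \<eta>: "0 < \<eta>" "\<eta> \<le> 1" and L: "slowly_varying_at_zero L"
    "\<And>u. u \<in> {0<..<1} \<Longrightarrow> cond_exceedance M W1 W2 u = L (1 - u) * (1 - u) powr (1 / \<eta> - 1)"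
    unfolding has_coeff_tail_dependence_def by blast
  show "0 < \<eta>" "\<eta> \<le> 1" by fact+
  have HD: "H s = L s * s powr (1 / \<eta> - 1) * D s" if "0 < s" "s < 1" for s
  \<comment> \<open>Where D vanishes, the conditional probability is 0 by the division convention
    and says nothing about H; the bound of H by D does.\<close>
  proof (cases "D s = 0")
    case True
    then show ?thesis using H_le_D[of s] H_nonneg[of s] by simp
  next
    case False
    then show ?thesis using L(2)[of "1 - s"] that cond_exceedance_eq[of s] by (simp add: field_simps)
  qed
  show "regularly_varying_at_zero H (1 / \<eta>)"
    unfolding regularly_varying_at_zero_def
  proof (intro allI impI)
    fix x :: real assume x: "x > 0"
    have "((\<lambda>s. L (s * x) / L s * (x powr (1 / \<eta> - 1)) * (D (s * x) / D s))
        \<longlongrightarrow> 1 * x powr (1 / \<eta> - 1) * x) (at_right 0)"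
      using L(1) x by (intro tendsto_mult tendsto_const D_scale) (auto simp: slowly_varying_at_zero_def)
    also have "1 * x powr (1 / \<eta> - 1) * x = x powr (1 / \<eta>)"
      using x by (simp add: powr_diff)
    finally have *: "((\<lambda>s. L (s * x) / L s * (x powr (1 / \<eta> - 1)) * (D (s * x) / D s))
        \<longlongrightarrow> x powr (1 / \<eta>)) (at_right 0)" .
    show "((\<lambda>s. H (s * x) / H s) \<longlongrightarrow> x powr (1 / \<eta>)) (at_right 0)"
    proof (rule Lim_transform_eventually[OF *])
      \<comment> \<open>Both s and s x have to lie in (0,1), where the equation for H holds.\<close>
      have "\<forall>\<^sub>F s in at_right 0. s \<in> {0<..<min 1 (1 / x)}" using x by (intro eventually_at_right_real) auto
      then show "\<forall>\<^sub>F s in at_right 0. L (s * x) / L s * (x powr (1 / \<eta> - 1)) * (D (s * x) / D s)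
          = H (s * x) / H s"
        by eventually_elim (use x in \<open>simp add: HD powr_mult field_simps\<close>)
    qed
  qed
next
  assume \<eta>: "0 < \<eta>" "\<eta> \<le> 1" and rv: "regularly_varying_at_zero H (1 / \<eta>)"
  define L where "L s = H s / D s * s powr (1 - 1 / \<eta>)" for s
  have "slowly_varying_at_zero L" unfolding slowly_varying_at_zero_def
  proof (intro allI impI)
    fix x :: real assume x: "x > 0"
    have "((\<lambda>s. H (s * x) / H s / (D (s * x) / D s) * x powr (1 - 1 / \<eta>))
        \<longlongrightarrow> x powr (1 / \<eta>) / x * x powr (1 - 1 / \<eta>)) (at_right 0)"
      using rv x by (intro tendsto_mult tendsto_divide tendsto_const D_scale)
        (auto simp: regularly_varying_at_zero_def)
    also have "x powr (1 / \<eta>) / x * x powr (1 - 1 / \<eta>) = 1"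
      using x by (simp add: powr_diff)
    finally have *: "((\<lambda>s. H (s * x) / H s / (D (s * x) / D s) * x powr (1 - 1 / \<eta>)) \<longlongrightarrow> 1) (at_right 0)" .
    show "((\<lambda>s. L (s * x) / L s) \<longlongrightarrow> 1) (at_right 0)"
    proof (rule Lim_transform_eventually[OF *])
      show "\<forall>\<^sub>F s in at_right 0. H (s * x) / H s / (D (s * x) / D s) * x powr (1 - 1 / \<eta>) = L (s * x) / L s"
        using eventually_at_right_less[of 0]
        by eventually_elim (use x in \<open>simp add: L_def powr_mult field_simps\<close>)
    qed
  qed
  moreover have "cond_exceedance M W1 W2 u = L (1 - u) * (1 - u) powr (1 / \<eta> - 1)" if "u \<in> {0<..<1}" for u
    using that cond_exceedance_eq[of "1 - u"]
    by (simp add: L_def mult.assoc flip: powr_add)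
  ultimately show "has_coeff_tail_dependence M W1 W2 \<eta>"
    unfolding has_coeff_tail_dependence_def using \<eta> by blast
qed

end

section \<open>Sums with independent noise\<close>

text \<open>Fubini for the product of the two laws, pulled back to M, with \<omega>' acting as an
  independent copy. Freezing Z leads to the convolution formula for tails; freezing A shows that
  atomless noise leaves no atoms in a sum.\<close>

lemma (in prob_space) indep_pair_emeasure:
  fixes A Z :: "'a \<Rightarrow> real"
  assumes ind: "indep_var borel A borel Z" and P: "Measurable.pred (borel \<Otimes>\<^sub>M borel) (\<lambda>p. P (fst p) (snd p))"
  shows "emeasure M {\<omega> \<in> space M. P (A \<omega>) (Z \<omega>)}
      = (\<integral>\<^sup>+\<omega>. emeasure M {\<omega>' \<in> space M. P (A \<omega>') (Z \<omega>)} \<partial>M)"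
    and "emeasure M {\<omega> \<in> space M. P (A \<omega>) (Z \<omega>)}
      = (\<integral>\<^sup>+\<omega>. emeasure M {\<omega>' \<in> space M. P (A \<omega>) (Z \<omega>')} \<partial>M)"
proof -
  have [measurable]: "A \<in> borel_measurable M" "Z \<in> borel_measurable M"
    using ind indep_var_rv1 indep_var_rv2 by blast+
  let ?A = "distr M borel A" and ?Z = "distr M borel Z"
  interpret A: prob_space ?A by (rule prob_space_distr) simp
  interpret Z: prob_space ?Z by (rule prob_space_distr) simp
  interpret AZ: pair_sigma_finite ?A ?Z ..
  let ?S = "{p. P (fst p) (snd p)}"
  have S: "?S \<in> sets (borel \<Otimes>\<^sub>M borel)" using P by (simp add: pred_def space_pair_measure)
  then have S': "?S \<in> sets (?A \<Otimes>\<^sub>M ?Z)" by (simp cong: sets_pair_measure_cong)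
  have Pair: "Pair a -` ?S \<in> sets borel" "(\<lambda>x. (x, z)) -` ?S \<in> sets borel" for a z :: real
    using sets_Pair1[OF S] sets_Pair2[OF S] by auto
  have eq: "emeasure M {\<omega> \<in> space M. P (A \<omega>) (Z \<omega>)} = emeasure (?A \<Otimes>\<^sub>M ?Z) ?S"
  proof -
    have "?A \<Otimes>\<^sub>M ?Z = distr M (borel \<Otimes>\<^sub>M borel) (\<lambda>x. (A x, Z x))"
      using ind by (simp add: indep_var_distribution_eq)
    then have "emeasure (?A \<Otimes>\<^sub>M ?Z) ?S = emeasure M ((\<lambda>x. (A x, Z x)) -` ?S \<inter> space M)"
      using S by (simp add: emeasure_distr)
    also have "(\<lambda>x. (A x, Z x)) -` ?S \<inter> space M = {\<omega> \<in> space M. P (A \<omega>) (Z \<omega>)}" by auto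
    finally show ?thesis by simp
  qed
  have m: "(\<lambda>z. emeasure ?A ((\<lambda>x. (x, z)) -` ?S)) \<in> borel_measurable borel"
    using AZ.measurable_emeasure_Pair2[OF S'] by simp
  have m': "(\<lambda>a. emeasure ?Z (Pair a -` ?S)) \<in> borel_measurable borel"
    using Z.measurable_emeasure_Pair[OF S'] by simp
  have "emeasure (?A \<Otimes>\<^sub>M ?Z) ?S = (\<integral>\<^sup>+z. emeasure ?A ((\<lambda>x. (x, z)) -` ?S) \<partial>?Z)"
    by (rule AZ.emeasure_pair_measure_alt2[OF S'])
  also have "\<dots> = (\<integral>\<^sup>+\<omega>. emeasure ?A ((\<lambda>x. (x, Z \<omega>)) -` ?S) \<partial>M)"
    using m by (subst nn_integral_distr) auto
  also have "\<dots> = (\<integral>\<^sup>+\<omega>. emeasure M {\<omega>' \<in> space M. P (A \<omega>') (Z \<omega>)} \<partial>M)"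
    using Pair by (intro nn_integral_cong) (simp add: emeasure_distr vimage_def Int_def conj_commute)
  finally show "emeasure M {\<omega> \<in> space M. P (A \<omega>) (Z \<omega>)}
      = (\<integral>\<^sup>+\<omega>. emeasure M {\<omega>' \<in> space M. P (A \<omega>') (Z \<omega>)} \<partial>M)" unfolding eq .
  have "emeasure (?A \<Otimes>\<^sub>M ?Z) ?S = (\<integral>\<^sup>+a. emeasure ?Z (Pair a -` ?S) \<partial>?A)"
    by (rule Z.emeasure_pair_measure_alt[OF S'])
  also have "\<dots> = (\<integral>\<^sup>+\<omega>. emeasure ?Z (Pair (A \<omega>) -` ?S) \<partial>M)"
    using m' by (subst nn_integral_distr) auto
  also have "\<dots> = (\<integral>\<^sup>+\<omega>. emeasure M {\<omega>' \<in> space M. P (A \<omega>) (Z \<omega>')} \<partial>M)"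
    using Pair by (intro nn_integral_cong) (simp add: emeasure_distr vimage_def Int_def conj_commute)
  finally show "emeasure M {\<omega> \<in> space M. P (A \<omega>) (Z \<omega>)}
      = (\<integral>\<^sup>+\<omega>. emeasure M {\<omega>' \<in> space M. P (A \<omega>) (Z \<omega>')} \<partial>M)" unfolding eq .
qed

lemma (in prob_space) tail_add_indep:
  fixes A Z :: "'a \<Rightarrow> real"
  assumes ind: "indep_var borel A borel Z"
  shows "tail M (\<lambda>\<omega>. A \<omega> + Z \<omega>) x = expectation (\<lambda>\<omega>. tail M A (x - Z \<omega>))"
proof -
  have [measurable]: "A \<in> borel_measurable M" "Z \<in> borel_measurable M"
    using ind indep_var_rv1 indep_var_rv2 by blast+
  have "ennreal (tail M (\<lambda>\<omega>. A \<omega> + Z \<omega>) x) = emeasure M {\<omega> \<in> space M. A \<omega> + Z \<omega> > x}"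
    by (simp add: tail_def emeasure_eq_measure)
  also have "\<dots> = (\<integral>\<^sup>+\<omega>. emeasure M {\<omega>' \<in> space M. A \<omega>' + Z \<omega> > x} \<partial>M)"
    by (rule indep_pair_emeasure(1)[OF ind]) measurable
  also have "\<dots> = (\<integral>\<^sup>+\<omega>. ennreal (tail M A (x - Z \<omega>)) \<partial>M)"
    by (intro nn_integral_cong) (simp add: tail_def emeasure_eq_measure less_diff_eq diff_less_eq)
  also have "\<dots> = ennreal (expectation (\<lambda>\<omega>. tail M A (x - Z \<omega>)))"
    by (intro nn_integral_eq_integral integrable_const_bound[of _ 1]) (auto simp: tail_bounds)
  finally show ?thesis
    by (subst (asm) ennreal_inj) (auto simp: tail_bounds intro!: integral_nonneg)
qed

lemma (in prob_space) prob_add_indep_no_atoms: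
  fixes A Z :: "'a \<Rightarrow> real"
  assumes ind: "indep_var borel A borel Z" and Z: "\<And>z. prob {\<omega> \<in> space M. Z \<omega> = z} = 0"
  shows "prob {\<omega> \<in> space M. A \<omega> + Z \<omega> = x} = 0"
proof -
  have [measurable]: "A \<in> borel_measurable M" "Z \<in> borel_measurable M"
    using ind indep_var_rv1 indep_var_rv2 by blast+
  have "emeasure M {\<omega> \<in> space M. A \<omega> + Z \<omega> = x}
      = (\<integral>\<^sup>+\<omega>. emeasure M {\<omega>' \<in> space M. A \<omega> + Z \<omega>' = x} \<partial>M)"
    by (rule indep_pair_emeasure(2)[OF ind]) measurable
  also have "\<dots> = (\<integral>\<^sup>+\<omega>. 0 \<partial>M)"
  proof (rule nn_integral_cong)
    fix \<omega>
    have "{\<omega>' \<in> space M. A \<omega> + Z \<omega>' = x} = {\<omega>' \<in> space M. Z \<omega>' = x - A \<omega>}" by auto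
    then show "emeasure M {\<omega>' \<in> space M. A \<omega> + Z \<omega>' = x} = 0" using Z by (simp add: emeasure_eq_measure)
  qed
  finally show ?thesis by (simp add: measure_def)
qed

lemma (in prob_space) tail_indep_product:
  fixes A Z :: "'a \<Rightarrow> real"
  assumes "indep_var borel A borel Z"
  shows "prob {\<omega> \<in> space M. A \<omega> > u \<and> Z \<omega> > v} = tail M A u * tail M Z v"
proof -
  have "prob ((\<lambda>\<omega>. (A \<omega>, Z \<omega>)) -` ({u<..} \<times> {v<..}) \<inter> space M)
      = prob (A -` {u<..} \<inter> space M) * prob (Z -` {v<..} \<inter> space M)"
    by (rule indep_varD[OF assms]) auto
  then show ?thesis by (simp add: tail_def vimage_def Int_def conj_commute)
qed

section \<open>Tails of sums by dominated convergence\<close>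

text \<open>Provides the integrable majorant. Beyond x0 a unit shift to the left costs at most a
  factor K, so a shift by y costs at most an exponential in y. Shifts landing below x0 are handled
  by T \<le> 1, compared with the shift that ends exactly at x0.\<close>

lemma antimono_shift_exp_bound:
  fixes T :: "real \<Rightarrow> real"
  assumes anti: "antimono T" and pos: "\<And>x. T x > 0" and le1: "\<And>x. T x \<le> 1"
    and lim: "((\<lambda>x. T (x - 1) / T x) \<longlongrightarrow> l) at_top"
  obtains C k where "\<forall>\<^sub>F x in at_top. \<forall>y. T (x - y) / T x \<le> C * exp (k * \<bar>y\<bar>)"
proof -
  define K where "K = max 1 (l + 1)"
  have "\<forall>\<^sub>F x in at_top. T (x - 1) / T x < K" using lim by (rule order_tendstoD) (simp add: K_def)
  then obtain x0 where "\<And>x. x \<ge> x0 \<Longrightarrow> T (x - 1) / T x < K"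
    unfolding eventually_at_top_linorder by blast
  then have x0: "\<And>x. x \<ge> x0 \<Longrightarrow> T (x - 1) \<le> K * T x"
    using pos by (simp add: pos_divide_less_eq less_imp_le)
  define k where "k = ln K"
  have k: "k \<ge> 0" "exp k = K" by (auto simp: k_def K_def)
  have K: "K \<ge> 1" by (simp add: K_def)
  \<comment> \<open>The last unit step starts at x - n + 1, which the condition keeps at or above
    x0.\<close>
  have nat: "T (x - real n) \<le> K ^ n * T x" if "x - real n \<ge> x0 - 1" for x n
    using that
  proof (induction n)
    case (Suc n)
    have "T (x - real (Suc n)) = T ((x - real n) - 1)" by (simp add: algebra_simps)
    also have "\<dots> \<le> K * T (x - real n)" using Suc.prems by (intro x0) simp
    also have "\<dots> \<le> K * (K ^ n * T x)" using Suc K by (intro mult_left_mono) auto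
    finally show ?case by simp
  qed simp
  have real: "T (x - y) \<le> exp (k * (y + 1)) * T x" if "y \<ge> 0" "x - y \<ge> x0" for x y
  proof -
    define n where "n = nat \<lceil>y\<rceil>"
    have n: "y \<le> real n" "real n < y + 1" using that(1) unfolding n_def by linarith+
    have "T (x - y) \<le> T (x - real n)" using n by (intro antimonoD[OF anti]) simp
    also have "\<dots> \<le> K ^ n * T x" using n that by (intro nat) simp
    also have "K ^ n = exp (real n * k)" by (simp add: exp_of_nat_mult k)
    also have "\<dots> \<le> exp (k * (y + 1))" using n k by (simp add: mult.commute mult_left_mono)
    finally show ?thesis using pos[of x] by simp
  qed
  \<comment> \<open>\<open>exp k\<close> pays for rounding y up to an integer,
    \<open>1 / T x0\<close> for replacing T by 1 below x0.\<close>
  define C where "C = exp k / T x0"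
  have C: "exp k \<le> C" "1 \<le> C" using pos[of x0] le1[of x0] k unfolding C_def
    by (auto simp: le_divide_eq mult_le_cancel_left1 intro: order_trans[of _ 1])
  have "T (x - y) / T x \<le> C * exp (k * \<bar>y\<bar>)" if x: "x \<ge> x0" for x y
  proof -
    consider "y < 0" | "y \<ge> 0" "x - y \<ge> x0" | "y \<ge> 0" "x - y < x0" by linarith
    then show ?thesis
    proof cases
      case 1
      have "T (x - y) / T x \<le> 1" using antimonoD[OF anti, of x "x - y"] pos[of x] 1 by simp
      also have "\<dots> \<le> C * exp (k * \<bar>y\<bar>)" using C k by (smt (verit) mult_le_cancel_left1 one_le_exp_iff mult_nonneg_nonneg abs_ge_zero)
      finally show ?thesis .
    next
      case 2
      have "T (x - y) / T x \<le> exp (k * (y + 1))" using real[OF 2] pos[of x] by (simp add: pos_divide_le_eq)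
      also have "\<dots> = exp k * exp (k * \<bar>y\<bar>)" using 2 by (simp add: algebra_simps exp_add)
      also have "\<dots> \<le> C * exp (k * \<bar>y\<bar>)" using C by (intro mult_right_mono) auto
      finally show ?thesis .
    next
      case 3
      have "T (x - y) \<le> 1" by (rule le1)
      also have "1 = T (x - (x - x0)) / T x0" using pos[of x0] by simp
      also have "\<dots> \<le> exp (k * ((x - x0) + 1)) * T x / T x0"
        using real[of "x - x0" x] x pos[of x0] by (intro divide_right_mono) auto
      also have "\<dots> \<le> exp (k * (y + 1)) * T x / T x0"
        using 3 k pos by (intro divide_right_mono mult_right_mono) (auto simp: mult_left_mono less_imp_le)
      also have "\<dots> = C * exp (k * \<bar>y\<bar>) * T x" using 3 by (simp add: C_def algebra_simps exp_add)
      finally show ?thesis using pos[of x] by (simp add: pos_divide_le_eq)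
    qed
  qed
  then show ?thesis by (intro that[of C k]) (auto simp: eventually_at_top_linorder)
qed

text \<open>The integrand is A(x - z)/T(x - z) times T(x - z)/T(x), with limits chi and exp(\<theta>
  z), and A \<le> T lets the majorant for T serve. Taking for A the marginal tail itself (chi = 1)
  treats the marginal, taking the joint tail treats the envelopes.\<close>

lemma (in prob_space) shifted_expectation_limit:
  fixes T A :: "real \<Rightarrow> real" and Z :: "'a \<Rightarrow> real"
  assumes anti: "antimono T" and pos: "\<And>x. T x > 0" and le1: "\<And>x. T x \<le> 1"
    and lim: "\<And>y. ((\<lambda>x. T (x - y) / T x) \<longlongrightarrow> exp (\<theta> * y)) at_top"
    and A[measurable]: "A \<in> borel_measurable borel" and A0: "\<And>x. 0 \<le> A x" and AT: "\<And>x. A x \<le> T x"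
    and chi: "((\<lambda>x. A x / T x) \<longlongrightarrow> chi) at_top"
    and Z[measurable]: "Z \<in> borel_measurable M" and int: "\<And>c. integrable M (\<lambda>\<omega>. exp (c * \<bar>Z \<omega>\<bar>))"
  shows "((\<lambda>x. expectation (\<lambda>\<omega>. A (x - Z \<omega>)) / T x) \<longlongrightarrow> chi * expectation (\<lambda>\<omega>. exp (\<theta> * Z \<omega>))) at_top"
proof -
  obtain C k where Ck: "\<forall>\<^sub>F x in at_top. \<forall>y. T (x - y) / T x \<le> C * exp (k * \<bar>y\<bar>)"
    using antimono_shift_exp_bound[OF anti pos le1 lim] by blast
  have "((\<lambda>x. expectation (\<lambda>\<omega>. A (x - Z \<omega>) / T x)) \<longlongrightarrow> expectation (\<lambda>\<omega>. chi * exp (\<theta> * Z \<omega>))) at_top"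
  proof (rule integral_dominated_convergence_at_top)
    show "integrable M (\<lambda>\<omega>. C * exp (k * \<bar>Z \<omega>\<bar>))" using int by simp
    show "\<forall>\<^sub>F x in at_top. AE \<omega> in M. norm (A (x - Z \<omega>) / T x) \<le> C * exp (k * \<bar>Z \<omega>\<bar>)"
      using Ck
    proof eventually_elim
      case (elim x)
      have "norm (A (x - y) / T x) \<le> C * exp (k * \<bar>y\<bar>)" for y
      proof -
        have "norm (A (x - y) / T x) \<le> T (x - y) / T x"
          using A0[of "x - y"] AT[of "x - y"] pos[of x] by (simp add: divide_right_mono)
        then show ?thesis using elim by (meson order_trans)
      qed
      then show ?case by simp
    qed
    show "AE \<omega> in M. ((\<lambda>x. A (x - Z \<omega>) / T x) \<longlongrightarrow> chi * exp (\<theta> * Z \<omega>)) at_top"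
    proof (rule AE_I2)
      fix \<omega>
      have "filterlim (\<lambda>x. x - Z \<omega>) at_top at_top" by real_asymp
      from tendsto_mult[OF filterlim_compose[OF chi this] lim[of "Z \<omega>"]]
      show "((\<lambda>x. A (x - Z \<omega>) / T x) \<longlongrightarrow> chi * exp (\<theta> * Z \<omega>)) at_top"
        using less_imp_neq[OF pos] by (simp add: pos[THEN less_imp_neq, symmetric])
    qed
  qed (use Z in auto)
  then show ?thesis by simp
qed

section \<open>Gaussian noise: exponential moments and tails\<close>

lemma (in prob_space) normal_exp_integrable:
  assumes d: "distributed M lborel e (\<lambda>x. ennreal (normal_density 0 \<tau> x))" and \<tau>: "\<tau> > 0"
  shows "integrable M (\<lambda>\<omega>. exp (c * \<bar>e \<omega>\<bar>))"
proof -
  have [measurable]: "e \<in> borel_measurable M" using distributed_measurable[OF d] by simp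
  have 1: "integrable M (\<lambda>\<omega>. exp (c * e \<omega>))" for c
  proof -
    \<comment> \<open>Completing the square: tilting N(0, \<tau>^2) by exp(c x) gives a multiple of
      N(c \<tau>^2, \<tau>^2).\<close>
    have "normal_density 0 \<tau> x * exp (c * x) = exp (c\<^sup>2 * \<tau>\<^sup>2 / 2) * normal_density (c * \<tau>\<^sup>2) \<tau> x" for x
    proof -
      have "- (x - 0)\<^sup>2 / (2 * \<tau>\<^sup>2) + c * x = c\<^sup>2 * \<tau>\<^sup>2 / 2 + - (x - c * \<tau>\<^sup>2)\<^sup>2 / (2 * \<tau>\<^sup>2)"
        using \<tau> by (simp add: field_simps power2_eq_square)
      then show ?thesis unfolding normal_density_def by (simp add: mult_ac flip: exp_add)
    qed
    then have "integrable lborel (\<lambda>x. normal_density 0 \<tau> x * exp (c * x))" using \<tau> by simp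
    then show ?thesis by (subst (asm) distributed_integrable[OF d]) auto
  qed
  have "integrable M (\<lambda>\<omega>. exp (c * e \<omega>) + exp (- c * e \<omega>))" by (intro Bochner_Integration.integrable_add 1)
  then show ?thesis
  proof (rule Bochner_Integration.integrable_bound)
    have "exp (c * \<bar>e \<omega>\<bar>) \<le> exp (c * e \<omega>) + exp (- c * e \<omega>)" for \<omega>
      by (cases "e \<omega> \<ge> 0") auto
    then show "AE \<omega> in M. norm (exp (c * \<bar>e \<omega>\<bar>)) \<le> norm (exp (c * e \<omega>) + exp (- c * e \<omega>))"
      by (intro AE_I2) (simp add: order_trans[OF _ abs_ge_self])
  qed simp
qed

text \<open>For y > x \<ge> 0 one has y^2 \<ge> x^2 + (y - x)^2, so the density at y is at most the
  claimed bound times the density of N(x, \<tau>^2), whose integral is 1.\<close>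

lemma (in prob_space) normal_tail_upper:
  assumes d: "distributed M lborel e (\<lambda>x. ennreal (normal_density 0 \<tau> x))" and \<tau>: "\<tau> > 0" and x: "x \<ge> 0"
  shows "tail M e x \<le> exp (- (1 / (2 * \<tau>\<^sup>2)) * x\<^sup>2)"
proof -
  have [measurable]: "e \<in> borel_measurable M" using distributed_measurable[OF d] by simp
  let ?c = "exp (- (1 / (2 * \<tau>\<^sup>2)) * x\<^sup>2)"
  have "ennreal (tail M e x) = emeasure M (e -` {x<..} \<inter> space M)"
    by (simp add: tail_def emeasure_eq_measure vimage_def Int_def conj_commute)
  also have "\<dots> = (\<integral>\<^sup>+y. ennreal (normal_density 0 \<tau> y) * indicator {x<..} y \<partial>lborel)"
    using d by (intro distributed_emeasure) auto
  also have "\<dots> \<le> (\<integral>\<^sup>+y. ennreal ?c * ennreal (normal_density x \<tau> y) \<partial>lborel)"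
  proof (intro nn_integral_mono)
    fix y
    have "normal_density 0 \<tau> y \<le> ?c * normal_density x \<tau> y" if "y > x"
    proof -
      have "x * x \<le> x * y" using that x by (intro mult_left_mono) auto
      then have "- y\<^sup>2 \<le> - x\<^sup>2 - (y - x)\<^sup>2" by (simp add: power2_eq_square algebra_simps)
      then have "- y\<^sup>2 / (2 * \<tau>\<^sup>2) \<le> (- x\<^sup>2 - (y - x)\<^sup>2) / (2 * \<tau>\<^sup>2)" using \<tau> by (intro divide_right_mono) auto
      also have "\<dots> = - (1 / (2 * \<tau>\<^sup>2)) * x\<^sup>2 + - (y - x)\<^sup>2 / (2 * \<tau>\<^sup>2)" by (simp add: diff_divide_distrib)
      finally show ?thesis unfolding normal_density_def using \<tau>
        by (simp add: divide_right_mono flip: exp_add)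
    qed
    then show "ennreal (normal_density 0 \<tau> y) * indicator {x<..} y \<le> ennreal ?c * ennreal (normal_density x \<tau> y)"
      by (auto split: split_indicator simp flip: ennreal_mult intro!: ennreal_leI)
  qed
  also have "\<dots> = ennreal ?c"
  proof -
    interpret N: prob_space "density lborel (normal_density x \<tau>)" by (rule prob_space_normal_density[OF \<tau>])
    have "(\<integral>\<^sup>+y. ennreal (normal_density x \<tau> y) \<partial>lborel) = 1"
      using N.emeasure_space_1 by (simp add: emeasure_density)
    then show ?thesis by (simp add: nn_integral_cmult)
  qed
  finally show ?thesis by simp
qed

text \<open>The density decreases on the positive half-line, so the mass of the unit interval after
  x is enough. The shift by 1 does not affect the quadratic rate.\<close>

lemma (in prob_space) normal_tail_lower:
  assumes d: "distributed M lborel e (\<lambda>x. ennreal (normal_density 0 \<tau> x))" and \<tau>: "\<tau> > 0" and x: "x \<ge> 0"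
  shows "normal_density 0 \<tau> (x + 1) \<le> tail M e x"
proof -
  have [measurable]: "e \<in> borel_measurable M" using distributed_measurable[OF d] by simp
  have "ennreal (normal_density 0 \<tau> (x + 1))
      = (\<integral>\<^sup>+y. ennreal (normal_density 0 \<tau> (x + 1)) * indicator {x<..x+1} y \<partial>lborel)"
    by (simp add: nn_integral_cmult_indicator)
  also have "\<dots> \<le> (\<integral>\<^sup>+y. ennreal (normal_density 0 \<tau> y) * indicator {x<..} y \<partial>lborel)"
  proof (intro nn_integral_mono)
    fix y
    have "normal_density 0 \<tau> (x + 1) \<le> normal_density 0 \<tau> y" if "y > x" "y \<le> x + 1"
    proof -
      have "y\<^sup>2 \<le> (x + 1)\<^sup>2" using that x by (intro power_mono) auto
      then have "- (x + 1)\<^sup>2 / (2 * \<tau>\<^sup>2) \<le> - y\<^sup>2 / (2 * \<tau>\<^sup>2)" using \<tau> by (intro divide_right_mono) auto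
      then show ?thesis unfolding normal_density_def using \<tau> by (simp add: divide_right_mono)
    qed
    then show "ennreal (normal_density 0 \<tau> (x + 1)) * indicator {x<..x+1} y
        \<le> ennreal (normal_density 0 \<tau> y) * indicator {x<..} y"
      by (auto split: split_indicator intro!: ennreal_leI)
  qed
  also have "\<dots> = emeasure M (e -` {x<..} \<inter> space M)"
    using d by (intro distributed_emeasure[symmetric]) auto
  also have "\<dots> = ennreal (tail M e x)"
    by (simp add: tail_def emeasure_eq_measure vimage_def Int_def conj_commute)
  finally show ?thesis by (simp add: tail_bounds)
qed

lemma (in prob_space) normal_exp_rate:
  assumes d: "distributed M lborel e (\<lambda>x. ennreal (normal_density 0 \<tau> x))" and \<tau>: "\<tau> > 0"
  shows "exp_rate_ge 2 (1 / (2 * \<tau>\<^sup>2)) (tail M e)" "exp_rate_le 2 (1 / (2 * \<tau>\<^sup>2)) (tail M e)"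
proof -
  show "exp_rate_ge 2 (1 / (2 * \<tau>\<^sup>2)) (tail M e)" unfolding exp_rate_ge_def
  proof (intro allI impI)
    fix \<rho> assume \<rho>: "\<rho> < 1 / (2 * \<tau>\<^sup>2)"
    show "\<forall>\<^sub>F x in at_top. tail M e x \<le> exp (- \<rho> * x powr 2)"
      using eventually_gt_at_top[of 0]
    proof eventually_elim
      case (elim x)
      have "tail M e x \<le> exp (- (1 / (2 * \<tau>\<^sup>2)) * x\<^sup>2)" using elim by (intro normal_tail_upper[OF d \<tau>]) simp
      also have "\<dots> \<le> exp (- \<rho> * x powr 2)"
        using mult_right_mono[OF less_imp_le[OF \<rho>], of "x\<^sup>2"] elim by simp
      finally show ?case .
    qed
  qed
  show "exp_rate_le 2 (1 / (2 * \<tau>\<^sup>2)) (tail M e)" unfolding exp_rate_le_def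
  proof (intro allI impI)
    fix \<rho> assume \<rho>: "\<rho> > 1 / (2 * \<tau>\<^sup>2)"
    define b where "b = 1 / (2 * \<tau>\<^sup>2)"
    define q where "q = 1 / sqrt (2 * pi * \<tau>\<^sup>2)"
    have q: "q > 0" using \<tau> by (simp add: q_def)
    have b: "b < \<rho>" using \<rho> by (simp add: b_def)
    have nd: "normal_density 0 \<tau> y = exp (ln q - b * y\<^sup>2)" for y
    proof -
      have "normal_density 0 \<tau> y = q * exp (- (b * y\<^sup>2))"
        unfolding normal_density_def q_def b_def by simp
      then show ?thesis using q by (simp add: exp_diff exp_minus field_simps)
    qed
    have "filterlim (\<lambda>x. \<rho> * x\<^sup>2 - b * (x + 1)\<^sup>2 + ln q) at_top at_top"
      using b by real_asymp
    then have "\<forall>\<^sub>F x in at_top. \<rho> * x\<^sup>2 - b * (x + 1)\<^sup>2 + ln q \<ge> 0" by (simp add: filterlim_at_top)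
    with eventually_gt_at_top[of 0] show "\<forall>\<^sub>F x in at_top. exp (- \<rho> * x powr 2) \<le> tail M e x"
    proof eventually_elim
      case (elim x)
      have "exp (- \<rho> * x powr 2) \<le> normal_density 0 \<tau> (x + 1)" unfolding nd using elim by simp
      also have "\<dots> \<le> tail M e x" using elim by (intro normal_tail_lower[OF d \<tau>]) simp
      finally show ?case .
    qed
  qed
qed

section \<open>Calculus of exponential rates\<close>

lemma exp_rate_geD: "exp_rate_ge p r P \<Longrightarrow> \<rho> < r \<Longrightarrow> \<forall>\<^sub>F x in at_top. P x \<le> exp (- \<rho> * x powr p)"
  unfolding exp_rate_ge_def by blast

lemma exp_rate_leD: "exp_rate_le p r P \<Longrightarrow> r < \<rho> \<Longrightarrow> \<forall>\<^sub>F x in at_top. exp (- \<rho> * x powr p) \<le> P x"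
  unfolding exp_rate_le_def by blast

lemma exp_rate_ge_weaken: "exp_rate_ge p r P \<Longrightarrow> r' \<le> r \<Longrightarrow> exp_rate_ge p r' P"
  unfolding exp_rate_ge_def by (meson less_le_trans)

text \<open>Closes arguments that lose an arbitrarily small part of the rate through a splitting
  point or a mesh size.\<close>

lemma exp_rate_ge_limit:
  assumes "\<And>\<rho>. \<rho> < r \<Longrightarrow> exp_rate_ge p \<rho> P"
  shows "exp_rate_ge p r P"
  unfolding exp_rate_ge_def
proof (intro allI impI)
  fix \<rho> assume "\<rho> < r"
  then obtain q where "\<rho> < q" "q < r" using dense by blast
  then show "\<forall>\<^sub>F x in at_top. P x \<le> exp (- \<rho> * x powr p)" by (intro exp_rate_geD[OF assms])
qed

lemma exp_rate_ge_mono: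
  assumes "exp_rate_ge p r P" "\<forall>\<^sub>F x in at_top. Q x \<le> P x"
  shows "exp_rate_ge p r Q"
  unfolding exp_rate_ge_def
proof (intro allI impI)
  fix \<rho> assume "\<rho> < r"
  then have "\<forall>\<^sub>F x in at_top. P x \<le> exp (- \<rho> * x powr p)" by (rule exp_rate_geD[OF assms(1)])
  with assms(2) show "\<forall>\<^sub>F x in at_top. Q x \<le> exp (- \<rho> * x powr p)" by eventually_elim simp
qed

lemma exp_rate_le_mono:
  assumes "exp_rate_le p r P" "\<forall>\<^sub>F x in at_top. P x \<le> Q x"
  shows "exp_rate_le p r Q"
  unfolding exp_rate_le_def
proof (intro allI impI)
  fix \<rho> assume "\<rho> > r"
  then have "\<forall>\<^sub>F x in at_top. exp (- \<rho> * x powr p) \<le> P x" by (rule exp_rate_leD[OF assms(1)])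
  with assms(2) show "\<forall>\<^sub>F x in at_top. exp (- \<rho> * x powr p) \<le> Q x" by eventually_elim simp
qed

lemma exp_rate_ge_mult:
  assumes P: "exp_rate_ge p r P" "\<And>x. P x \<ge> 0" and Q: "exp_rate_ge p q Q" "\<And>x. Q x \<ge> 0"
  shows "exp_rate_ge p (r + q) (\<lambda>x. P x * Q x)"
  unfolding exp_rate_ge_def
proof (intro allI impI)
  fix \<rho> assume \<rho>: "\<rho> < r + q"
  define d where "d = (r + q - \<rho>) / 2"
  have d: "d > 0" "\<rho> = (r - d) + (q - d)" using \<rho> by (auto simp: d_def field_simps)
  have "\<forall>\<^sub>F x in at_top. P x \<le> exp (- (r - d) * x powr p)"
    "\<forall>\<^sub>F x in at_top. Q x \<le> exp (- (q - d) * x powr p)"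
    using d(1) by (intro exp_rate_geD[OF P(1)] exp_rate_geD[OF Q(1)]; simp)+
  then show "\<forall>\<^sub>F x in at_top. P x * Q x \<le> exp (- \<rho> * x powr p)"
  proof eventually_elim
    case (elim x)
    have "P x * Q x \<le> exp (- (r - d) * x powr p) * exp (- (q - d) * x powr p)"
      using elim P(2) Q(2) by (intro mult_mono) auto
    also have "\<dots> = exp (- \<rho> * x powr p)" unfolding d(2) by (simp add: algebra_simps flip: exp_add)
    finally show ?case .
  qed
qed

lemma exp_rate_le_mult:
  assumes P: "exp_rate_le p r P" and Q: "exp_rate_le p q Q"
  shows "exp_rate_le p (r + q) (\<lambda>x. P x * Q x)"
  unfolding exp_rate_le_def
proof (intro allI impI)
  fix \<rho> assume \<rho>: "\<rho> > r + q"
  define d where "d = (\<rho> - (r + q)) / 2"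
  have d: "d > 0" "\<rho> = (r + d) + (q + d)" using \<rho> by (auto simp: d_def field_simps)
  have "\<forall>\<^sub>F x in at_top. P x \<ge> exp (- (r + d) * x powr p)"
    "\<forall>\<^sub>F x in at_top. Q x \<ge> exp (- (q + d) * x powr p)"
    using d(1) by (intro exp_rate_leD[OF P] exp_rate_leD[OF Q]; simp)+
  then show "\<forall>\<^sub>F x in at_top. P x * Q x \<ge> exp (- \<rho> * x powr p)"
  proof eventually_elim
    case (elim x)
    have "exp (- \<rho> * x powr p) = exp (- (r + d) * x powr p) * exp (- (q + d) * x powr p)"
      unfolding d(2) by (simp add: algebra_simps flip: exp_add)
    also have "\<dots> \<le> P x * Q x" using elim by (intro mult_mono) (auto intro: order_trans[OF exp_ge_zero])
    finally show ?case .
  qed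
qed

lemma exp_rate_const:
  assumes "p > 0"
  shows "exp_rate_ge p 0 (\<lambda>_. c)" and "c > 0 \<Longrightarrow> exp_rate_le p 0 (\<lambda>_. c)"
proof -
  show "exp_rate_ge p 0 (\<lambda>_. c)" unfolding exp_rate_ge_def
  proof (intro allI impI)
    fix \<rho> :: real assume \<rho>: "\<rho> < 0"
    have "\<forall>\<^sub>F x::real in at_top. x powr p \<ge> c / (- \<rho>)" using assms by (rule ev_powr_ge)
    then show "\<forall>\<^sub>F x in at_top. c \<le> exp (- \<rho> * x powr p)"
    proof eventually_elim
      case (elim x)
      have "c \<le> - \<rho> * x powr p" using elim \<rho> by (simp add: field_simps)
      also have "\<dots> \<le> exp (- \<rho> * x powr p)" by (smt (verit) exp_ge_add_one_self)
      finally show ?case .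
    qed
  qed
  assume c: "c > 0"
  show "exp_rate_le p 0 (\<lambda>_. c)" unfolding exp_rate_le_def
  proof (intro allI impI)
    fix \<rho> :: real assume \<rho>: "\<rho> > 0"
    have "\<forall>\<^sub>F x::real in at_top. x powr p \<ge> - ln c / \<rho>" using assms by (rule ev_powr_ge)
    then show "\<forall>\<^sub>F x in at_top. exp (- \<rho> * x powr p) \<le> c"
    proof eventually_elim
      case (elim x)
      have "- \<rho> * x powr p \<le> ln c" using elim \<rho> by (simp add: field_simps)
      then have "exp (- \<rho> * x powr p) \<le> exp (ln c)" by (simp only: exp_le_cancel_iff)
      then show ?case using c by simp
    qed
  qed
qed

lemma exp_rate_ge_add:
  assumes "exp_rate_ge p r P" "exp_rate_ge p r Q" "p > 0"
  shows "exp_rate_ge p r (\<lambda>x. P x + Q x)"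
proof (rule exp_rate_ge_limit)
  fix \<rho> assume "\<rho> < r"
  have "exp_rate_ge p (0 + \<rho>) (\<lambda>x. 2 * exp (- \<rho> * x powr p))"
  proof (intro exp_rate_ge_mult exp_rate_const \<open>p > 0\<close>)
    show "exp_rate_ge p \<rho> (\<lambda>x. exp (- \<rho> * x powr p))" unfolding exp_rate_ge_def
      by (intro allI impI always_eventually) (simp add: mult_right_mono)
  qed auto
  moreover have "\<forall>\<^sub>F x in at_top. P x \<le> exp (- \<rho> * x powr p)" "\<forall>\<^sub>F x in at_top. Q x \<le> exp (- \<rho> * x powr p)"
    by (rule exp_rate_geD; fact)+
  then have "\<forall>\<^sub>F x in at_top. P x + Q x \<le> 2 * exp (- \<rho> * x powr p)" by eventually_elim simp
  ultimately show "exp_rate_ge p \<rho> (\<lambda>x. P x + Q x)" by (simp add: exp_rate_ge_mono)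
qed

lemma exp_rate_ge_sum:
  assumes "finite I" "\<And>i. i \<in> I \<Longrightarrow> exp_rate_ge p r (P i)" "p > 0"
  shows "exp_rate_ge p r (\<lambda>x. \<Sum>i\<in>I. P i x)"
  using assms(1,2)
proof (induction I rule: finite_induct)
  case empty
  then show ?case by (simp add: exp_rate_ge_def)
next
  case (insert i I)
  have "exp_rate_ge p r (\<lambda>x. P i x + (\<Sum>i\<in>I. P i x))"
    by (intro exp_rate_ge_add \<open>p > 0\<close>) (use insert in auto)
  then show ?case using insert by simp
qed

lemma exp_rate_ge_scale:
  assumes "exp_rate_ge p r P" "s > 0"
  shows "exp_rate_ge p (r * s powr p) (\<lambda>x. P (s * x))"
  unfolding exp_rate_ge_def
proof (intro allI impI)
  fix \<rho> assume "\<rho> < r * s powr p"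
  then have "\<rho> / s powr p < r" using assms by (simp add: field_simps)
  then have "\<forall>\<^sub>F x in at_top. P x \<le> exp (- (\<rho> / s powr p) * x powr p)"
    by (rule exp_rate_geD[OF assms(1)])
  moreover have "filterlim (\<lambda>x. s * x) at_top at_top" using assms by real_asymp
  ultimately have "\<forall>\<^sub>F x in at_top. P (s * x) \<le> exp (- (\<rho> / s powr p) * (s * x) powr p)"
    by (rule eventually_compose_filterlim)
  with eventually_gt_at_top[of 0] show "\<forall>\<^sub>F x in at_top. P (s * x) \<le> exp (- \<rho> * x powr p)"
    by eventually_elim (use assms in \<open>simp add: powr_mult\<close>)
qed

lemma exp_rate_le_scale:
  assumes "exp_rate_le p r P" "s > 0"
  shows "exp_rate_le p (r * s powr p) (\<lambda>x. P (s * x))"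
  unfolding exp_rate_le_def
proof (intro allI impI)
  fix \<rho> assume "\<rho> > r * s powr p"
  then have "\<rho> / s powr p > r" using assms by (simp add: field_simps)
  then have "\<forall>\<^sub>F x in at_top. P x \<ge> exp (- (\<rho> / s powr p) * x powr p)"
    by (rule exp_rate_leD[OF assms(1)])
  moreover have "filterlim (\<lambda>x. s * x) at_top at_top" using assms by real_asymp
  ultimately have "\<forall>\<^sub>F x in at_top. P (s * x) \<ge> exp (- (\<rho> / s powr p) * (s * x) powr p)"
    by (rule eventually_compose_filterlim)
  with eventually_gt_at_top[of 0] show "\<forall>\<^sub>F x in at_top. P (s * x) \<ge> exp (- \<rho> * x powr p)"
    by eventually_elim (use assms in \<open>simp add: powr_mult\<close>)
qed

text \<open>A positive rate on the scale x^q is an infinite rate on a smaller power x^p. This is the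
  sense of lighter in both directions: Gaussian noise against a Weibull index below 2, and a Weibull
  index above 2 against the noise.\<close>

lemma exp_rate_ge_lower_order:
  assumes "exp_rate_ge q r P" "r > 0" "p < q"
  shows "exp_rate_ge p r' P"
  unfolding exp_rate_ge_def
proof (intro allI impI)
  fix \<rho> assume "\<rho> < r'"
  have "\<forall>\<^sub>F x in at_top. P x \<le> exp (- (r / 2) * x powr q)" using assms by (intro exp_rate_geD) auto
  moreover have "\<forall>\<^sub>F x::real in at_top. x powr (q - p) \<ge> \<rho> / (r / 2)" using assms by (intro ev_powr_ge) simp
  ultimately show "\<forall>\<^sub>F x in at_top. P x \<le> exp (- \<rho> * x powr p)"
    using eventually_gt_at_top[of 0]
  proof eventually_elim
    case (elim x)
    have "\<rho> * x powr p \<le> ((r / 2) * x powr (q - p)) * x powr p"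
      using elim assms by (intro mult_right_mono) (auto simp: field_simps)
    also have "\<dots> = (r / 2) * x powr q" using elim by (simp add: powr_diff)
    finally show ?case using elim(1) by (smt (verit) exp_le_cancel_iff mult_minus_left)
  qed
qed

lemma exp_rate_le_ge_imp_le:
  assumes "exp_rate_le p r P" "exp_rate_ge p q P" "p > 0"
  shows "q \<le> r"
proof (rule ccontr)
  assume "\<not> q \<le> r"
  then obtain c where "r < c" "c < q" using dense[of r q] by auto
  then obtain d where cd: "r < c" "c < d" "d < q" using dense[of c q] by auto
  have "\<forall>\<^sub>F x in at_top. exp (- c * x powr p) \<le> P x" "\<forall>\<^sub>F x in at_top. P x \<le> exp (- d * x powr p)"
    using cd by (intro exp_rate_leD[OF assms(1)] exp_rate_geD[OF assms(2)]; simp)+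
  with eventually_gt_at_top[of 0] have "\<forall>\<^sub>F x::real in at_top. False"
  proof eventually_elim
    case (elim x)
    then have "exp (- c * x powr p) \<le> exp (- d * x powr p)" by linarith
    then have "d * x powr p \<le> c * x powr p" by simp
    then show ?case using elim cd by simp
  qed
  then show False by simp
qed

section \<open>Rates of sums\<close>

text \<open>A sum exceeds x only if A > s x or Z > (1 - s) x. The second event has every rate, so
  the rate r s^p of the first remains, and s tends to 1.\<close>

lemma (in prob_space) exp_rate_ge_add_light:
  fixes A Z :: "'a \<Rightarrow> real"
  assumes [measurable]: "A \<in> borel_measurable M" "Z \<in> borel_measurable M"
    and A: "exp_rate_ge p r (tail M A)" and Z: "\<And>q. exp_rate_ge p q (tail M Z)" and p: "p > 0"
  shows "exp_rate_ge p r (tail M (\<lambda>\<omega>. A \<omega> + Z \<omega>))"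
proof (rule exp_rate_ge_limit)
  fix \<rho> assume \<rho>: "\<rho> < r"
  have split: "exp_rate_ge p (r * s powr p) (tail M (\<lambda>\<omega>. A \<omega> + Z \<omega>))" if s: "0 < s" "s < 1" for s
  proof (rule exp_rate_ge_mono)
    \<comment> \<open>The rate asked of Z is the one that becomes r s^p after rescaling by 1 -
      s.\<close>
    show "exp_rate_ge p (r * s powr p) (\<lambda>x. tail M A (s * x) + tail M Z ((1 - s) * x))"
      using s exp_rate_ge_scale[OF Z[of "r * s powr p / (1 - s) powr p"], of "1 - s"]
      by (intro exp_rate_ge_add exp_rate_ge_scale A p) simp_all
    have "tail M (\<lambda>\<omega>. A \<omega> + Z \<omega>) x \<le> tail M A (s * x) + tail M Z ((1 - s) * x)" for x
    proof -
      have "tail M (\<lambda>\<omega>. A \<omega> + Z \<omega>) x \<le>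
          prob ({\<omega> \<in> space M. A \<omega> > s * x} \<union> {\<omega> \<in> space M. Z \<omega> > (1 - s) * x})"
        unfolding tail_def by (intro finite_measure_mono) (auto simp: algebra_simps)
      also have "\<dots> \<le> tail M A (s * x) + tail M Z ((1 - s) * x)"
        unfolding tail_def by (intro measure_Un_le) auto
      finally show ?thesis .
    qed
    then show "\<forall>\<^sub>F x in at_top. tail M (\<lambda>\<omega>. A \<omega> + Z \<omega>) x \<le> tail M A (s * x) + tail M Z ((1 - s) * x)" by simp
  qed
  have "((\<lambda>s. r * s powr p) \<longlongrightarrow> r * 1 powr p) (at_left 1)" by (intro tendsto_intros) auto
  then have "\<forall>\<^sub>F s in at_left 1. \<rho> < r * s powr p" using \<rho> by (intro order_tendstoD) auto
  moreover have "\<forall>\<^sub>F s in at_left (1::real). s \<in> {0<..<1}" by (rule eventually_at_left_real) simp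
  ultimately have "\<forall>\<^sub>F s in at_left (1::real). \<rho> < r * s powr p \<and> s \<in> {0<..<1}" by eventually_elim auto
  then obtain s where "\<rho> < r * s powr p" "0 < s" "s < 1"
    by (metis (no_types, lifting) eventually_happens greaterThanLessThan_iff trivial_limit_at_left_real)
  then show "exp_rate_ge p \<rho> (tail M (\<lambda>\<omega>. A \<omega> + Z \<omega>))" by (intro exp_rate_ge_weaken[OF split less_imp_le])
qed

text \<open>The event A > x and Z > 0 is enough, and independence makes Z cost a constant factor
  only.\<close>

lemma (in prob_space) exp_rate_le_add_indep:
  fixes A Z :: "'a \<Rightarrow> real"
  assumes ind: "indep_var borel A borel Z" and A: "exp_rate_le p r (tail M A)"
    and Z: "tail M Z 0 > 0" and p: "p > 0"
  shows "exp_rate_le p r (tail M (\<lambda>\<omega>. A \<omega> + Z \<omega>))"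
proof -
  have [measurable]: "A \<in> borel_measurable M" "Z \<in> borel_measurable M"
    using ind indep_var_rv1 indep_var_rv2 by blast+
  have "exp_rate_le p (r + 0) (\<lambda>x. tail M A x * tail M Z 0)"
    by (intro exp_rate_le_mult A exp_rate_const p Z)
  moreover have "tail M A x * tail M Z 0 \<le> tail M (\<lambda>\<omega>. A \<omega> + Z \<omega>) x" for x
    unfolding tail_indep_product[OF ind, symmetric] by (subst tail_def, intro finite_measure_mono) auto
  ultimately show ?thesis by (simp add: exp_rate_le_mono)
qed

text \<open>Cleared of the denominator, the difference of the two sides is (a u - b v)^2. Thus ab/(a
  + b) is the least cost of splitting a unit excess, attained at a u = b v.\<close>

lemma weighted_square_sum_ge:
  fixes a b u v :: real
  assumes "a > 0" "b > 0"
  shows "a * b / (a + b) * (u + v)\<^sup>2 \<le> a * u\<^sup>2 + b * v\<^sup>2"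
proof -
  have "(a + b) * (a * u\<^sup>2 + b * v\<^sup>2) - a * b * (u + v)\<^sup>2 = (a * u - b * v)\<^sup>2"
    by (simp add: power2_eq_square algebra_simps)
  then have "a * b * (u + v)\<^sup>2 \<le> (a + b) * (a * u\<^sup>2 + b * v\<^sup>2)"
    by (smt (verit) zero_le_power2)
  then show ?thesis using assms by (simp add: pos_divide_le_eq mult.commute)
qed

text \<open>Restricts to A > s x and Z > (1 - s) x at the optimal split s = b/(a + b), where the two
  costs add up to ab/(a + b).\<close>

lemma (in prob_space) exp_rate_le_add_gaussian:
  fixes A Z :: "'a \<Rightarrow> real"
  assumes ind: "indep_var borel A borel Z" and A: "exp_rate_le 2 a (tail M A)"
    and Z: "exp_rate_le 2 b (tail M Z)" and ab: "a > 0" "b > 0"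
  shows "exp_rate_le 2 (a * b / (a + b)) (tail M (\<lambda>\<omega>. A \<omega> + Z \<omega>))"
proof -
  have [measurable]: "A \<in> borel_measurable M" "Z \<in> borel_measurable M"
    using ind indep_var_rv1 indep_var_rv2 by blast+
  define s where "s = b / (a + b)"
  have s: "s > 0" "1 - s > 0" using ab by (auto simp: s_def field_simps)
  have "exp_rate_le 2 (a * s powr 2 + b * (1 - s) powr 2) (\<lambda>x. tail M A (s * x) * tail M Z ((1 - s) * x))"
    using s by (intro exp_rate_le_mult exp_rate_le_scale A Z)
  moreover have "a * s powr 2 + b * (1 - s) powr 2 = a * b / (a + b)"
  proof -
    have "1 - s = a / (a + b)" using ab by (simp add: s_def field_simps)
    then have "a * s powr 2 + b * (1 - s) powr 2 = a * (b / (a + b))\<^sup>2 + b * (a / (a + b))\<^sup>2"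
      using s unfolding s_def by simp
    also have "\<dots> = (a * b * (a + b)) / (a + b)\<^sup>2"
      by (simp add: power_divide power2_eq_square add_divide_distrib algebra_simps)
    also have "\<dots> = a * b / (a + b)" using ab by (simp add: power2_eq_square)
    finally show ?thesis .
  qed
  moreover have "tail M A (s * x) * tail M Z ((1 - s) * x) \<le> tail M (\<lambda>\<omega>. A \<omega> + Z \<omega>) x" for x
    unfolding tail_indep_product[OF ind, symmetric]
    by (subst tail_def, intro finite_measure_mono) (auto simp: algebra_simps)
  ultimately show ?thesis by (simp add: exp_rate_le_mono)
qed

text \<open>Discretizing the position of \<open>A\<close> on a grid of mesh \<open>x / n\<close> loses a factor \<open>(1 - 1/n)\<^sup>2\<close>
  in the rate, which disappears as \<open>n\<close> grows.\<close>
lemma (in prob_space) exp_rate_ge_add_gaussian: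
  fixes A Z :: "'a \<Rightarrow> real"
  assumes ind: "indep_var borel A borel Z" and A: "exp_rate_ge 2 a (tail M A)"
    and Z: "exp_rate_ge 2 b (tail M Z)" and ab: "a > 0" "b > 0"
  shows "exp_rate_ge 2 (a * b / (a + b)) (tail M (\<lambda>\<omega>. A \<omega> + Z \<omega>))"
proof -
  have [measurable]: "A \<in> borel_measurable M" "Z \<in> borel_measurable M"
    using ind indep_var_rv1 indep_var_rv2 by blast+
  define c where "c = a * b / (a + b)"
  have c: "c > 0" "c \<le> a" "c \<le> b" using ab by (auto simp: c_def field_simps)
  \<comment> \<open>The factor s = 0 occurs at the two ends of the grid, where the tail at 0 is a
    constant of rate 0.\<close>
  have scale0: "exp_rate_ge 2 (r * s\<^sup>2) (\<lambda>x. tail M X (s * x))"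
    if "exp_rate_ge 2 r (tail M X)" "s \<ge> 0" for X r s
  proof (cases "s = 0")
    case True
    then show ?thesis using exp_rate_const(1)[of 2 "tail M X 0"] by simp
  next
    case False
    then show ?thesis using exp_rate_ge_scale[OF that(1), of s] that(2) by simp
  qed
  have grid: "exp_rate_ge 2 (c * (1 - 1 / real n)\<^sup>2) (tail M (\<lambda>\<omega>. A \<omega> + Z \<omega>))" if n: "n > 0" for n
  proof -
    \<comment> \<open>If A lies between k x/n and (k + 1) x/n, then Z exceeds x - (k + 1) x/n; these
      are the corners of the cell. The two fractions add up to 1 - 1/n instead of 1.\<close>
    let ?u = "\<lambda>k. real k / real n" and ?v = "\<lambda>k. (real n - real k - 1) / real n"
    have le1: "(1 - 1 / real n)\<^sup>2 \<le> 1" using n by (intro power_le_one) (auto simp: field_simps)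
    have cn: "c * (1 - 1 / real n)\<^sup>2 \<le> c" using le1 c by (simp add: mult_left_le)
    have cell: "exp_rate_ge 2 (c * (1 - 1 / real n)\<^sup>2) (\<lambda>x. tail M A (?u k * x) * tail M Z (?v k * x))"
      if k: "k < n" for k
    proof -
      have "exp_rate_ge 2 (a * (?u k)\<^sup>2 + b * (?v k)\<^sup>2) (\<lambda>x. tail M A (?u k * x) * tail M Z (?v k * x))"
        using k by (intro exp_rate_ge_mult scale0 A Z tail_bounds) (auto simp: field_simps)
      moreover have "?u k + ?v k = 1 - 1 / real n" using n by (simp add: field_simps)
      then have "c * (1 - 1 / real n)\<^sup>2 \<le> a * (?u k)\<^sup>2 + b * (?v k)\<^sup>2"
        using weighted_square_sum_ge[OF ab, of "?u k" "?v k"] by (simp add: c_def)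
      ultimately show ?thesis by (rule exp_rate_ge_weaken)
    qed
    show ?thesis
    proof (rule exp_rate_ge_mono)
      \<comment> \<open>The two single tails cover A > x and A \<le> 0; in the latter case Z alone
        exceeds x.\<close>
      show "exp_rate_ge 2 (c * (1 - 1 / real n)\<^sup>2)
          (\<lambda>x. tail M A x + tail M Z x + (\<Sum>k<n. tail M A (?u k * x) * tail M Z (?v k * x)))"
        by (intro exp_rate_ge_add exp_rate_ge_sum cell exp_rate_ge_weaken[OF A order_trans[OF cn c(2)]]
            exp_rate_ge_weaken[OF Z order_trans[OF cn c(3)]]) simp_all
      show "\<forall>\<^sub>F x in at_top. tail M (\<lambda>\<omega>. A \<omega> + Z \<omega>) x
          \<le> tail M A x + tail M Z x + (\<Sum>k<n. tail M A (?u k * x) * tail M Z (?v k * x))"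
        using eventually_gt_at_top[of 0]
      proof eventually_elim
        case (elim x)
        let ?E = "\<lambda>k. {\<omega> \<in> space M. A \<omega> > ?u k * x \<and> Z \<omega> > ?v k * x}"
        let ?A = "{\<omega> \<in> space M. A \<omega> > x}" and ?Z = "{\<omega> \<in> space M. Z \<omega> > x}"
        have sub: "{\<omega> \<in> space M. A \<omega> + Z \<omega> > x} \<subseteq> (?A \<union> ?Z) \<union> (\<Union>k<n. ?E k)"
        proof
          fix \<omega> assume \<omega>: "\<omega> \<in> {\<omega> \<in> space M. A \<omega> + Z \<omega> > x}"
          consider "A \<omega> \<le> 0" | "A \<omega> > x" | "0 < A \<omega>" "A \<omega> \<le> x" by linarith
          then show "\<omega> \<in> (?A \<union> ?Z) \<union> (\<Union>k<n. ?E k)"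
          proof cases
            case 3
            \<comment> \<open>Cells are open on the left and closed on the right: for 0 < A \<le> x,
              rounding up and subtracting 1 lands between 0 and n - 1 and leaves A strictly above
              the lower corner.\<close>
            define k where "k = nat (\<lceil>A \<omega> * real n / x\<rceil> - 1)"
            have pos: "A \<omega> * real n / x > 0" "A \<omega> * real n / x \<le> real n"
              using 3 n elim by (auto simp: field_simps)
            have k: "real k < A \<omega> * real n / x" "A \<omega> * real n / x \<le> real k + 1" "k < n"
              using pos unfolding k_def by linarith+
            have "?u k * x < A \<omega>" using k(1) elim n by (simp add: field_simps)
            moreover have "A \<omega> \<le> (real k + 1) / real n * x" using k(2) elim n by (simp add: field_simps)
            then have "?v k * x \<le> x - A \<omega>" using n by (simp add: field_simps)
            ultimately have "\<omega> \<in> ?E k" using \<omega> by simp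
            then show ?thesis using k(3) by blast
          next
            case 1
            then have "Z \<omega> > x" using \<omega> by simp
            then show ?thesis using \<omega> by simp
          next
            case 2
            then show ?thesis using \<omega> by simp
          qed
        qed
        have "tail M (\<lambda>\<omega>. A \<omega> + Z \<omega>) x \<le> prob ((?A \<union> ?Z) \<union> (\<Union>k<n. ?E k))"
          unfolding tail_def by (intro finite_measure_mono sub) measurable
        also have "\<dots> \<le> prob (?A \<union> ?Z) + prob (\<Union>k<n. ?E k)"
          by (intro measure_Un_le) measurable
        also have "\<dots> \<le> (prob ?A + prob ?Z) + (\<Sum>k<n. prob (?E k))"
        proof (rule add_mono)
          show "prob (?A \<union> ?Z) \<le> prob ?A + prob ?Z" by (rule measure_Un_le) measurable
          show "prob (\<Union>k<n. ?E k) \<le> (\<Sum>k<n. prob (?E k))" by (rule measure_UNION_le) simp_all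
        qed
        finally show ?case by (simp add: tail_def[of M A x] tail_def[of M Z x] tail_indep_product[OF ind])
      qed
    qed
  qed
  show ?thesis unfolding c_def[symmetric]
  proof (rule exp_rate_ge_limit)
    fix \<rho> assume "\<rho> < c"
    have "(\<lambda>n. c * (1 - 1 / real n)\<^sup>2) \<longlonglongrightarrow> c" by real_asymp
    then have "\<forall>\<^sub>F n in sequentially. \<rho> < c * (1 - 1 / real n)\<^sup>2" using \<open>\<rho> < c\<close> by (rule order_tendstoD)
    then have "\<forall>\<^sub>F n in sequentially. \<rho> < c * (1 - 1 / real n)\<^sup>2 \<and> n > 0"
      using eventually_gt_at_top by (rule eventually_conj)
    then obtain n where "\<rho> < c * (1 - 1 / real n)\<^sup>2" "n > 0"
      using eventually_happens by force
    then show "exp_rate_ge 2 \<rho> (tail M (\<lambda>\<omega>. A \<omega> + Z \<omega>))"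
      by (intro exp_rate_ge_weaken[OF grid less_imp_le])
  qed
qed

text \<open>Positivity of \<theta> is forced: -ln of the tail is eventually positive and its ratio
  to \<theta> x^2 tends to 1. The slack in \<rho> turns this limit into the two one-sided
  rates.\<close>

lemma (in prob_space) gaussian_rate_exp_rate:
  assumes Y: "Y \<in> borel_measurable M" and g: "gaussian_rate M Y \<theta>" and pos: "\<And>x. tail M Y x > 0"
  shows "\<theta> > 0" "exp_rate_ge 2 \<theta> (tail M Y)" "exp_rate_le 2 \<theta> (tail M Y)"
proof -
  let ?T = "tail M Y"
  have asy: "(\<lambda>x. - ln (?T x)) \<sim>[at_top] (\<lambda>x. \<theta> * x\<^sup>2)" using g by (simp add: gaussian_rate_def)
  have lt1: "\<forall>\<^sub>F x in at_top. ?T x < 1" using tail_tendsto_0[OF Y] by (rule order_tendstoD) simp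
  then have lnp: "\<forall>\<^sub>F x in at_top. - ln (?T x) > 0" by eventually_elim (use pos in simp)
  have lim: "((\<lambda>x. - ln (?T x) / (\<theta> * x\<^sup>2)) \<longlongrightarrow> 1) at_top"
    by (rule asymp_equivD_strong[OF asy]) (use lnp in \<open>auto elim: eventually_mono\<close>)
  have "\<forall>\<^sub>F x in at_top. - ln (?T x) / (\<theta> * x\<^sup>2) > 0" using lim by (rule order_tendstoD) simp
  with lnp have "\<forall>\<^sub>F x::real in at_top. \<theta> > 0"
    by eventually_elim (auto simp: zero_less_divide_iff zero_less_mult_iff divide_less_0_iff mult_less_0_iff)
  then show \<theta>: "\<theta> > 0" by simp
  show "exp_rate_ge 2 \<theta> ?T" unfolding exp_rate_ge_def
  proof (intro allI impI)
    fix \<rho> assume "\<rho> < \<theta>"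
    then have "\<forall>\<^sub>F x in at_top. - ln (?T x) / (\<theta> * x\<^sup>2) > \<rho> / \<theta>"
      using \<theta> by (intro order_tendstoD[OF lim]) simp
    with eventually_gt_at_top[of 0] show "\<forall>\<^sub>F x in at_top. ?T x \<le> exp (- \<rho> * x powr 2)"
    proof eventually_elim
      case (elim x)
      have "ln (?T x) \<le> - \<rho> * x powr 2" using elim \<theta> by (simp add: field_simps)
      then have "exp (ln (?T x)) \<le> exp (- \<rho> * x powr 2)" by (simp only: exp_le_cancel_iff)
      then show ?case using pos by simp
    qed
  qed
  show "exp_rate_le 2 \<theta> ?T" unfolding exp_rate_le_def
  proof (intro allI impI)
    fix \<rho> assume "\<rho> > \<theta>"
    then have "\<forall>\<^sub>F x in at_top. - ln (?T x) / (\<theta> * x\<^sup>2) < \<rho> / \<theta>"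
      using \<theta> by (intro order_tendstoD[OF lim]) simp
    with eventually_gt_at_top[of 0] show "\<forall>\<^sub>F x in at_top. exp (- \<rho> * x powr 2) \<le> ?T x"
    proof eventually_elim
      case (elim x)
      have "- \<rho> * x powr 2 \<le> ln (?T x)" using elim \<theta> by (simp add: field_simps)
      then have "exp (- \<rho> * x powr 2) \<le> exp (ln (?T x))" by (simp only: exp_le_cancel_iff)
      then show ?case using pos by simp
    qed
  qed
qed

section \<open>From marginal rates to joint rates\<close>

context tail_pair
begin

lemma T_to_0: "filterlim T (at_right 0) at_top"
  using W1 tail_pos by (rule tail_tendsto_at_right_0)

context
  fixes \<eta> assumes coeff: "has_coeff_tail_dependence M W1 W2 \<eta>"
begin

lemma rv: "regularly_varying_at_zero H (1 / \<eta>)" and \<eta>: "0 < \<eta>" "\<eta> \<le> 1"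
  using coeff by (auto simp: has_coeff_tail_dependence_iff)

lemma G_upper: "0 < r \<Longrightarrow> r < 1 / \<eta> \<Longrightarrow> \<forall>\<^sub>F x in at_top. G x \<le> T x powr r"
  using eventually_compose_filterlim[OF regularly_varying_at_zero_upper[OF rv H_nonneg H_mono] T_to_0]
  by (simp add: H_tail)

lemma G_lower: "1 / \<eta> < r \<Longrightarrow> \<forall>\<^sub>F x in at_top. T x powr r \<le> G x"
  using eventually_compose_filterlim[OF regularly_varying_at_zero_lower[OF rv H_nonneg H_mono] T_to_0] \<eta>(1)
  by (simp add: H_tail order_less_trans[OF divide_pos_pos[OF zero_less_one \<eta>(1)]])

lemma G_pos: "G x > 0"
proof -
  have "\<forall>\<^sub>F y in at_top. H (T y) > 0"
    by (rule eventually_compose_filterlim[OF regularly_varying_at_zero_ev_pos[OF rv H_nonneg] T_to_0])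
  then obtain y where "y \<ge> x" "G y > 0"
    unfolding eventually_at_top_linorder H_tail by (meson linorder_linear order_trans)
  moreover have "G y \<le> G x" by (rule antimonoD[OF tail_antimono]) (use \<open>y \<ge> x\<close> in simp_all)
  ultimately show ?thesis by simp
qed

text \<open>With r below 1/\<eta>, Potter's bound gives G \<le> T^r, and T^r \<le> exp(-q r x^p) for
  q below t; r and q are taken close enough to these limits that q r \<ge> \<rho>.\<close>

lemma exp_rate_ge_G:
  assumes T: "exp_rate_ge p t T" and t: "t > 0"
  shows "exp_rate_ge p (t / \<eta>) G"
  unfolding exp_rate_ge_def
proof (intro allI impI)
  fix \<rho> assume "\<rho> < t / \<eta>"
  \<comment> \<open>The maximum with 0 keeps r, and below q, positive, as \<rho> may be
    negative.\<close>
  then have "max 0 (\<rho> / t) < 1 / \<eta>" using \<eta> t by (simp add: field_simps)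
  then obtain r where r: "max 0 (\<rho> / t) < r" "r < 1 / \<eta>" using dense by blast
  then have "max 0 (\<rho> / r) < t" using t by (simp add: field_simps)
  then obtain q where q: "max 0 (\<rho> / r) < q" "q < t" using dense by blast
  have "\<forall>\<^sub>F x in at_top. T x \<le> exp (- q * x powr p)" using q by (intro exp_rate_geD[OF T])
  moreover have "\<forall>\<^sub>F x in at_top. G x \<le> T x powr r" using r by (intro G_upper) auto
  ultimately show "\<forall>\<^sub>F x in at_top. G x \<le> exp (- \<rho> * x powr p)"
  proof eventually_elim
    case (elim x)
    have "T x powr r \<le> exp (- q * x powr p) powr r"
      using elim r tail_pos by (intro powr_mono2) (auto simp: less_imp_le)
    also have "\<dots> = exp (- (q * r) * x powr p)" by (simp add: exp_powr_real mult_ac)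
    also have "\<dots> \<le> exp (- \<rho> * x powr p)"
    proof -
      have "\<rho> \<le> q * r" using q r by (simp add: field_simps)
      then have "\<rho> * x powr p \<le> q * r * x powr p" by (intro mult_right_mono) auto
      then show ?thesis by simp
    qed
    finally show ?case using elim by simp
  qed
qed

lemma exp_rate_le_G:
  assumes T: "exp_rate_le p t T" and t: "t > 0"
  shows "exp_rate_le p (t / \<eta>) G"
  unfolding exp_rate_le_def
proof (intro allI impI)
  fix \<rho> assume "\<rho> > t / \<eta>"
  then have "1 / \<eta> < \<rho> / t" using \<eta> t by (simp add: field_simps)
  then obtain r where r: "1 / \<eta> < r" "r < \<rho> / t" using dense by blast
  have r0: "r > 0" using r(1) \<eta> by (smt (verit) divide_pos_pos)
  then have "t < \<rho> / r" using r t by (simp add: field_simps)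
  then obtain q where q: "t < q" "q < \<rho> / r" using dense by blast
  have "\<forall>\<^sub>F x in at_top. exp (- q * x powr p) \<le> T x" using q by (intro exp_rate_leD[OF T])
  moreover have "\<forall>\<^sub>F x in at_top. T x powr r \<le> G x" using r by (intro G_lower) auto
  ultimately show "\<forall>\<^sub>F x in at_top. exp (- \<rho> * x powr p) \<le> G x"
  proof eventually_elim
    case (elim x)
    have "q * r \<le> \<rho>" using q r0 by (simp add: field_simps)
    then have "q * r * x powr p \<le> \<rho> * x powr p" by (intro mult_right_mono) auto
    then have "exp (- \<rho> * x powr p) \<le> exp (- (q * r) * x powr p)" by simp
    also have "\<dots> = exp (- q * x powr p) powr r" by (simp add: exp_powr_real mult_ac)
    also have "\<dots> \<le> T x powr r" using elim r0 by (intro powr_mono2) auto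
    finally show ?case using elim by simp
  qed
qed

text \<open>The place where \<eta> is confined: G inherits the rate t/\<eta> from the marginal, and
  a bound on the rate of G obtained by other means has to be compatible with it.\<close>

lemma coeff_rate_bounds:
  assumes p: "p > 0" and t: "t > 0"
  shows "exp_rate_ge p g G \<Longrightarrow> exp_rate_le p t T \<Longrightarrow> g \<le> t / \<eta>"
    and "exp_rate_le p g G \<Longrightarrow> exp_rate_ge p t T \<Longrightarrow> t / \<eta> \<le> g"
  using exp_rate_le_ge_imp_le[OF exp_rate_le_G[OF _ t] _ p, of g]
    exp_rate_le_ge_imp_le[OF _ exp_rate_ge_G[OF _ t] p, of g] by simp_all

end

end

section \<open>Noisy pairs\<close>

lemma (in prob_space) prob_ge_eq_tail:
  assumes [measurable]: "W \<in> borel_measurable M" and "prob {\<omega> \<in> space M. W \<omega> = x} = 0"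
  shows "prob {\<omega> \<in> space M. W \<omega> \<ge> x} = tail M W x"
proof -
  have "{\<omega> \<in> space M. W \<omega> \<ge> x} = {\<omega> \<in> space M. W \<omega> > x} \<union> {\<omega> \<in> space M. W \<omega> = x}" by auto
  also have "prob \<dots> = prob {\<omega> \<in> space M. W \<omega> > x} + prob {\<omega> \<in> space M. W \<omega> = x}"
    by (intro finite_measure_Union) auto
  finally show ?thesis using assms(2) by (simp add: tail_def)
qed

lemma (in prob_space) distributed_no_atoms:
  assumes d: "distributed M lborel W f"
  shows "prob {\<omega> \<in> space M. W \<omega> = x} = 0"
proof -
  have "emeasure M (W -` {x} \<inter> space M) = (\<integral>\<^sup>+y. f y * indicator {x} y \<partial>lborel)"
    using d by (intro distributed_emeasure) auto
  also have "\<dots> = 0" by (rule nn_integral_null_set) (simp add: null_sets_def)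
  finally show ?thesis by (simp add: measure_def vimage_def Int_def conj_commute)
qed

lemma (in prob_space) tail_pos_of_ev:
  assumes "W \<in> borel_measurable M" "\<forall>\<^sub>F x in at_top. tail M W x > 0"
  shows "tail M W x > 0"
proof -
  obtain y where "y \<ge> x" "tail M W y > 0"
    using assms(2) unfolding eventually_at_top_linorder by (meson linorder_linear order_trans)
  moreover have "tail M W y \<le> tail M W x"
    by (rule antimonoD[OF tail_antimono]) (use assms \<open>y \<ge> x\<close> in simp_all)
  ultimately show ?thesis by simp
qed

lemma (in prob_space) continuous_tail:
  assumes W[measurable]: "W \<in> borel_measurable M" and "\<And>x. prob {\<omega> \<in> space M. W \<omega> = x} = 0"
  shows "continuous_on UNIV (tail M W)"
proof -
  interpret D: real_distribution "distr M borel W" by simp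
  have "isCont (cdf (distr M borel W)) x" for x
    unfolding D.isCont_cdf using assms(2)[of x]
    by (simp add: measure_distr vimage_def Int_def conj_commute)
  then have "continuous_on UNIV (\<lambda>x. 1 - cdf (distr M borel W) x)"
    by (intro continuous_intros continuous_at_imp_continuous_on) auto
  then show ?thesis by (simp add: cdf_eq_tail)
qed

lemma (in prob_space) distributed_tail_pair:
  assumes "W1 \<in> borel_measurable M" "W2 \<in> borel_measurable M" "distr M borel W1 = distr M borel W2"
    and "\<And>x. prob {\<omega> \<in> space M. W1 \<omega> = x} = 0" "\<And>x. tail M W1 x > 0"
  shows "tail_pair M W1 W2"
proof
  have "((\<lambda>x. 1::real) \<longlongrightarrow> 1) at_top" by simp
  then show "((\<lambda>x. prob {\<omega> \<in> space M. W1 \<omega> \<ge> x} / tail M W1 x) \<longlongrightarrow> 1) at_top"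
    using assms(5)[THEN less_imp_neq] by (simp add: prob_ge_eq_tail assms assms(5)[THEN less_imp_neq, symmetric])
qed (use assms in auto)

lemma (in prob_space) weibull_like_tail_pair:
  assumes "W1 \<in> borel_measurable M" "W2 \<in> borel_measurable M" "distr M borel W1 = distr M borel W2"
    and w: "weibull_like_tail M W1 \<alpha> \<theta>"
  shows "tail_pair M W1 W2"
proof -
  obtain f where f: "distributed M lborel W1 (\<lambda>x. ennreal (f x))" "\<forall>\<^sub>F x in at_top. tail M W1 x > 0"
    using weibull_like_tail_hazard[OF w] by metis
  show ?thesis
    using assms(1-3) distributed_no_atoms[OF f(1)] tail_pos_of_ev[OF assms(1) f(2)]
    by (rule distributed_tail_pair)
qed

text \<open>A regularly varying tail may have atoms, but P(W \<ge> x) \<le> T(x - 1), which is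
  asymptotic to T(x).\<close>

lemma (in prob_space) long_tailed_tail_pair:
  assumes [measurable]: "W1 \<in> borel_measurable M" "W2 \<in> borel_measurable M"
    and "distr M borel W1 = distr M borel W2" and pos: "\<And>x. tail M W1 x > 0"
    and lim: "((\<lambda>x. tail M W1 (x - 1) / tail M W1 x) \<longlongrightarrow> 1) at_top"
  shows "tail_pair M W1 W2"
proof
  show "((\<lambda>x. prob {\<omega> \<in> space M. W1 \<omega> \<ge> x} / tail M W1 x) \<longlongrightarrow> 1) at_top"
  proof (rule tendsto_sandwich[OF _ _ tendsto_const lim])
    have "tail M W1 x \<le> prob {\<omega> \<in> space M. W1 \<omega> \<ge> x}" "prob {\<omega> \<in> space M. W1 \<omega> \<ge> x} \<le> tail M W1 (x - 1)" for x
      unfolding tail_def by (intro finite_measure_mono; auto)+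
    then show "\<forall>\<^sub>F x in at_top. 1 \<le> prob {\<omega> \<in> space M. W1 \<omega> \<ge> x} / tail M W1 x"
      "\<forall>\<^sub>F x in at_top. prob {\<omega> \<in> space M. W1 \<omega> \<ge> x} / tail M W1 x \<le> tail M W1 (x - 1) / tail M W1 x"
      using pos by (simp_all add: divide_right_mono less_imp_le)
  qed
qed (use assms in auto)

text \<open>Eventually x - y lies between c x and c' x for any 0 < c < 1 < c', so monotonicity traps
  the ratio between quantities tending to c'^\<kappa> and c^\<kappa>, both close to 1.\<close>

lemma regularly_varying_shift:
  fixes T :: "real \<Rightarrow> real"
  assumes rv: "regularly_varying T \<kappa>" and anti: "antimono T" and pos: "\<And>x. T x > 0"
  shows "((\<lambda>x. T (x - y) / T x) \<longlongrightarrow> 1) at_top"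
proof -
  have lim: "((\<lambda>x. T (x * c) / T x) \<longlongrightarrow> c powr \<kappa>) at_top" if "c > 0" for c
    using rv that by (simp add: regularly_varying_def)
  have cont: "((\<lambda>c::real. c powr \<kappa>) \<longlongrightarrow> 1) (at 1)"
    using tendsto_powr[OF tendsto_ident_at[of "1::real" UNIV] tendsto_const[of \<kappa>]] by simp
  show ?thesis
  proof (rule order_tendstoI)
    fix a :: real assume "a < 1"
    then have "\<forall>\<^sub>F c in at_right (1::real). a < c powr \<kappa>"
      using order_tendstoD(1)[OF cont] by (simp add: eventually_at_split)
    moreover have "\<forall>\<^sub>F c in at_right (1::real). 1 < c" by (rule eventually_at_right_less)
    ultimately have "\<forall>\<^sub>F c in at_right (1::real). a < c powr \<kappa> \<and> 1 < c" by (rule eventually_conj)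
    then obtain c where c: "a < c powr \<kappa>" "1 < c" using eventually_happens by force
    have "\<forall>\<^sub>F x in at_top. a < T (x * c) / T x" using c by (intro order_tendstoD(1)[OF lim]) auto
    moreover have "\<forall>\<^sub>F x in at_top. x - y \<le> x * c" using c by real_asymp
    ultimately show "\<forall>\<^sub>F x in at_top. a < T (x - y) / T x"
    proof eventually_elim
      case (elim x)
      have "T (x * c) / T x \<le> T (x - y) / T x"
        using antimonoD[OF anti elim(2)] pos[of x] by (simp add: divide_right_mono)
      then show ?case using elim by simp
    qed
  next
    fix a :: real assume "a > 1"
    then have "\<forall>\<^sub>F c in at_left (1::real). a > c powr \<kappa>"
      using order_tendstoD(2)[OF cont] by (simp add: eventually_at_split)
    moreover have "\<forall>\<^sub>F c in at_left (1::real). c \<in> {0<..<1}" by (rule eventually_at_left_real) simp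
    ultimately have "\<forall>\<^sub>F c in at_left (1::real). a > c powr \<kappa> \<and> c \<in> {0<..<1}" by (rule eventually_conj)
    then obtain c where c: "a > c powr \<kappa>" "0 < c" "c < 1" using eventually_happens by force
    have "\<forall>\<^sub>F x in at_top. a > T (x * c) / T x" using c by (intro order_tendstoD(2)[OF lim]) auto
    moreover have "\<forall>\<^sub>F x in at_top. x - y \<ge> x * c" using c by real_asymp
    ultimately show "\<forall>\<^sub>F x in at_top. a > T (x - y) / T x"
    proof eventually_elim
      case (elim x)
      have "T (x * c) / T x \<ge> T (x - y) / T x"
        using antimonoD[OF anti elim(2)] pos[of x] by (simp add: divide_right_mono)
      then show ?case using elim by simp
    qed
  qed
qed

text \<open>The roles are exchanged: the noise supplies the rate and A only has to be positive. Used
  when the noise has the heavier tail.\<close>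

lemma (in prob_space) exp_rate_le_add_indep':
  fixes A Z :: "'a \<Rightarrow> real"
  assumes ind: "indep_var borel A borel Z" and Z: "exp_rate_le p r (tail M Z)"
    and A: "tail M A 0 > 0" and p: "p > 0"
  shows "exp_rate_le p r (tail M (\<lambda>\<omega>. A \<omega> + Z \<omega>))"
proof -
  have [measurable]: "A \<in> borel_measurable M" "Z \<in> borel_measurable M"
    using ind indep_var_rv1 indep_var_rv2 by blast+
  have "exp_rate_le p (0 + r) (\<lambda>x. tail M A 0 * tail M Z x)"
    by (intro exp_rate_le_mult A exp_rate_const p Z)
  moreover have "tail M A 0 * tail M Z x \<le> tail M (\<lambda>\<omega>. A \<omega> + Z \<omega>) x" for x
    unfolding tail_indep_product[OF ind, symmetric] by (subst tail_def, intro finite_measure_mono) auto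
  ultimately show ?thesis by (simp add: exp_rate_le_mono)
qed

section \<open>The noisy pair and its envelopes\<close>

locale noisy_pair = prob_space M for M :: "'a measure" +
  fixes X1s X2s e1 e2 :: "'a \<Rightarrow> real" and \<tau> :: real
  assumes X1s[measurable]: "X1s \<in> borel_measurable M" and X2s[measurable]: "X2s \<in> borel_measurable M"
    and same_s: "distr M borel X1s = distr M borel X2s" and \<tau>: "\<tau> > 0"
    and e1: "distributed M lborel e1 (\<lambda>x. ennreal (normal_density 0 \<tau> x))"
    and e2: "distributed M lborel e2 (\<lambda>x. ennreal (normal_density 0 \<tau> x))"
    and indep_e: "indep_var borel e1 borel e2"
    and indep_X_e: "indep_var borel (\<lambda>\<omega>. (X1s \<omega>, X2s \<omega>)) borel (\<lambda>\<omega>. (e1 \<omega>, e2 \<omega>))"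
begin

abbreviation "X1 \<equiv> (\<lambda>\<omega>. X1s \<omega> + e1 \<omega>)"
abbreviation "X2 \<equiv> (\<lambda>\<omega>. X2s \<omega> + e2 \<omega>)"
abbreviation "Xmin \<equiv> (\<lambda>\<omega>. min (X1s \<omega>) (X2s \<omega>))"
abbreviation "Xmax \<equiv> (\<lambda>\<omega>. max (X1s \<omega>) (X2s \<omega>))"
abbreviation "emin \<equiv> (\<lambda>\<omega>. min (e1 \<omega>) (e2 \<omega>))"
abbreviation "emax \<equiv> (\<lambda>\<omega>. max (e1 \<omega>) (e2 \<omega>))"
abbreviation "emean \<equiv> (\<lambda>\<omega>. (e1 \<omega> + e2 \<omega>) / 2)"
abbreviation "Ts \<equiv> tail M X1s"
abbreviation "Gs \<equiv> tail M Xmin"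
abbreviation "TX \<equiv> tail M X1"
abbreviation "GX \<equiv> tail M (\<lambda>\<omega>. min (X1 \<omega>) (X2 \<omega>))"

lemma e1_measurable[measurable]: "e1 \<in> borel_measurable M"
  and e2_measurable[measurable]: "e2 \<in> borel_measurable M"
  using distributed_measurable[OF e1] distributed_measurable[OF e2] by simp_all

lemma indep_compose:
  fixes f g :: "real \<times> real \<Rightarrow> real"
  assumes "f \<in> borel_measurable borel" "g \<in> borel_measurable borel"
  shows "indep_var borel (\<lambda>\<omega>. f (X1s \<omega>, X2s \<omega>)) borel (\<lambda>\<omega>. g (e1 \<omega>, e2 \<omega>))"
  using indep_var_compose[OF indep_X_e assms] by (simp add: comp_def)

lemma indep_X1: "indep_var borel X1s borel e1"
  and indep_X2: "indep_var borel X2s borel e2"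
  and indep_min_min: "indep_var borel Xmin borel emin"
  and indep_min_max: "indep_var borel Xmin borel emax"
  and indep_max_mean: "indep_var borel Xmax borel emean"
  using indep_compose[of fst fst] indep_compose[of snd snd]
    indep_compose[of "\<lambda>p. min (fst p) (snd p)" "\<lambda>p. min (fst p) (snd p)"]
    indep_compose[of "\<lambda>p. min (fst p) (snd p)" "\<lambda>p. max (fst p) (snd p)"]
    indep_compose[of "\<lambda>p. max (fst p) (snd p)" "\<lambda>p. (fst p + snd p) / 2"]
  by (simp_all add: borel_prod[symmetric])

lemma tail_e_pos: "tail M e1 x > 0" "tail M e2 x > 0"
proof -
  have "\<forall>\<^sub>F x in at_top. tail M e x > 0"
    if d: "distributed M lborel e (\<lambda>x. ennreal (normal_density 0 \<tau> x))" for e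
    using eventually_ge_at_top[of 0]
  proof eventually_elim
    case (elim x)
    then show ?case
      using normal_tail_lower[OF d \<tau> elim] normal_density_pos[OF \<tau>, of 0 "x + 1"] by linarith
  qed
  from this[OF e1] this[OF e2] show "tail M e1 x > 0" "tail M e2 x > 0"
    by (auto intro: tail_pos_of_ev)
qed

lemma tail_emin: "tail M emin x = tail M e1 x * tail M e2 x"
  unfolding tail_indep_product[OF indep_e, symmetric] by (simp add: tail_def)

lemma tail_emax: "tail M emax x \<le> tail M e1 x + tail M e2 x"
proof -
  have "tail M emax x \<le> prob ({\<omega> \<in> space M. e1 \<omega> > x} \<union> {\<omega> \<in> space M. e2 \<omega> > x})"
    unfolding tail_def by (intro finite_measure_mono) auto
  also have "\<dots> \<le> tail M e1 x + tail M e2 x" unfolding tail_def by (intro measure_Un_le) auto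
  finally show ?thesis .
qed

text \<open>The condition on Z covers one noise, the minimum and the maximum at once, since each of
  them picks one of the two noises at every point.\<close>

lemma noise_exp_integrable:
  assumes [measurable]: "Z \<in> borel_measurable M" and Z: "\<And>\<omega>. \<bar>Z \<omega>\<bar> = \<bar>e1 \<omega>\<bar> \<or> \<bar>Z \<omega>\<bar> = \<bar>e2 \<omega>\<bar>"
  shows "integrable M (\<lambda>\<omega>. exp (c * \<bar>Z \<omega>\<bar>))"
proof (rule Bochner_Integration.integrable_bound)
  show "integrable M (\<lambda>\<omega>. exp (c * \<bar>e1 \<omega>\<bar>) + exp (c * \<bar>e2 \<omega>\<bar>))"
    by (intro Bochner_Integration.integrable_add normal_exp_integrable[OF e1 \<tau>] normal_exp_integrable[OF e2 \<tau>])
  show "AE \<omega> in M. norm (exp (c * \<bar>Z \<omega>\<bar>)) \<le> norm (exp (c * \<bar>e1 \<omega>\<bar>) + exp (c * \<bar>e2 \<omega>\<bar>))"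
  proof (rule AE_I2)
    fix \<omega>
    show "norm (exp (c * \<bar>Z \<omega>\<bar>)) \<le> norm (exp (c * \<bar>e1 \<omega>\<bar>) + exp (c * \<bar>e2 \<omega>\<bar>))"
      using Z[of \<omega>] by (auto intro: order_trans[OF _ abs_ge_self])
  qed
qed simp

text \<open>The bound with the mean holds because a minimum is at most the mean of the two sums, and
  the mean of the signals is at most their maximum. It accepts a larger signal in return for
  averaged noise.\<close>

lemma GX_ge: "tail M (\<lambda>\<omega>. Xmin \<omega> + emin \<omega>) x \<le> GX x"
  and GX_le_max: "GX x \<le> tail M (\<lambda>\<omega>. Xmin \<omega> + emax \<omega>) x"
  and GX_le_mean: "GX x \<le> tail M (\<lambda>\<omega>. Xmax \<omega> + emean \<omega>) x"
proof -
  have *: "min a b + min c d \<le> min (a + c) (b + d)" "min (a + c) (b + d) \<le> min a b + max c d"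
    "min (a + c) (b + d) \<le> max a b + (c + d) / 2" for a b c d :: real
    by (auto simp: min_def max_def field_simps)
  show "tail M (\<lambda>\<omega>. Xmin \<omega> + emin \<omega>) x \<le> GX x"
    unfolding tail_def by (rule finite_measure_mono) (use *(1) less_le_trans in \<open>blast, simp\<close>)
  show "GX x \<le> tail M (\<lambda>\<omega>. Xmin \<omega> + emax \<omega>) x"
    unfolding tail_def by (rule finite_measure_mono) (use *(2) less_le_trans in \<open>blast, simp\<close>)
  show "GX x \<le> tail M (\<lambda>\<omega>. Xmax \<omega> + emean \<omega>) x"
    unfolding tail_def by (rule finite_measure_mono) (use *(3) less_le_trans in \<open>blast, simp\<close>)
qed

lemma X_no_atoms: "prob {\<omega> \<in> space M. X1 \<omega> = x} = 0"
  by (intro prob_add_indep_no_atoms[OF indep_X1] distributed_no_atoms[OF e1])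

text \<open>Each noisy tail is a signal tail averaged over the same normal density, so the equality
  of the signal laws carries over.\<close>

lemma same_X: "distr M borel X1 = distr M borel X2"
proof (rule cdf_unique)
  show "cdf (distr M borel X1) = cdf (distr M borel X2)"
  proof
    fix x
    have m[measurable]: "Ts \<in> borel_measurable borel" by simp
    have m': "(\<lambda>z. Ts (x - z)) \<in> borel_measurable lborel" by simp
    have "TX x = expectation (\<lambda>\<omega>. Ts (x - e1 \<omega>))" by (rule tail_add_indep[OF indep_X1])
    also have "\<dots> = (\<integral>z. normal_density 0 \<tau> z * Ts (x - z) \<partial>lborel)"
      by (rule distributed_integral[OF e1 m', symmetric]) simp
    also have "\<dots> = expectation (\<lambda>\<omega>. Ts (x - e2 \<omega>))"
      by (rule distributed_integral[OF e2 m']) simp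
    also have "\<dots> = expectation (\<lambda>\<omega>. tail M X2s (x - e2 \<omega>))"
      by (simp add: tail_cong_distr[OF X1s X2s same_s])
    also have "\<dots> = tail M X2 x" by (rule tail_add_indep[OF indep_X2, symmetric])
    finally show "cdf (distr M borel X1) x = cdf (distr M borel X2) x" by (simp add: cdf_eq_tail)
  qed
qed auto

text \<open>The minimum is large only if both noises are, so two rates 1/(2 \<tau>^2) add up; the
  maximum keeps the single rate by a union bound; the mean is normal with variance
  \<tau>^2/2.\<close>

lemma noise_rates:
  shows "exp_rate_ge 2 (1 / (2 * \<tau>\<^sup>2)) (tail M e1)" "exp_rate_le 2 (1 / (2 * \<tau>\<^sup>2)) (tail M e1)"
    and "exp_rate_ge 2 (1 / (2 * \<tau>\<^sup>2)) (tail M emax)" "exp_rate_le 2 (1 / \<tau>\<^sup>2) (tail M emin)"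
    and "exp_rate_ge 2 (1 / \<tau>\<^sup>2) (tail M emean)"
proof -
  note r1 = normal_exp_rate[OF e1 \<tau>] and r2 = normal_exp_rate[OF e2 \<tau>]
  show "exp_rate_ge 2 (1 / (2 * \<tau>\<^sup>2)) (tail M e1)" "exp_rate_le 2 (1 / (2 * \<tau>\<^sup>2)) (tail M e1)" by fact+
  show "exp_rate_ge 2 (1 / (2 * \<tau>\<^sup>2)) (tail M emax)"
    by (rule exp_rate_ge_mono[OF exp_rate_ge_add[OF r1(1) r2(1)]]) (simp_all add: tail_emax)
  have "exp_rate_le 2 (1 / (2 * \<tau>\<^sup>2) + 1 / (2 * \<tau>\<^sup>2)) (tail M emin)"
    by (rule exp_rate_le_mono[OF exp_rate_le_mult[OF r1(2) r2(2)]]) (simp add: tail_emin)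
  then show "exp_rate_le 2 (1 / \<tau>\<^sup>2) (tail M emin)" by simp
  have "distributed M lborel (\<lambda>\<omega>. e1 \<omega> + e2 \<omega>) (normal_density (0 + 0) (sqrt (\<tau>\<^sup>2 + \<tau>\<^sup>2)))"
    using \<tau> by (intro add_indep_normal indep_e e1 e2)
  from normal_density_affine[OF this, of "1 / 2" 0]
  have "distributed M lborel emean (normal_density 0 (sqrt (\<tau>\<^sup>2 + \<tau>\<^sup>2) / 2))"
    using \<tau> by (simp add: add_pos_pos)
  from normal_exp_rate(1)[OF this] show "exp_rate_ge 2 (1 / \<tau>\<^sup>2) (tail M emean)"
    using \<tau> by (simp add: add_pos_pos power_divide)
qed

end

section \<open>Effect of the noise in each regime\<close>

context noisy_pair
begin

lemma TX_pos:
  assumes "\<And>x. Ts x > 0"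
  shows "TX x > 0"
proof -
  have "0 < Ts 0 * tail M e1 x" using assms tail_e_pos by simp
  also have "\<dots> \<le> TX x" unfolding tail_indep_product[OF indep_X1, symmetric]
    by (subst tail_def, rule finite_measure_mono) auto
  finally show ?thesis .
qed

lemma tail_pair_X:
  assumes "\<And>x. Ts x > 0"
  shows "tail_pair M X1 X2"
  using same_X X_no_atoms TX_pos[OF assms] by (intro distributed_tail_pair) auto

lemma emin_pos: "tail M emin 0 > 0"
  using tail_e_pos by (simp add: tail_emin)

text \<open>The chain is X.H(TX x) = GX x ~ Gs x = S.H(Ts x) ~ S.H(TX x), the last equivalence by
  regular variation and TX ~ Ts. As TX is continuous, X.H ~ S.H at 0, and this equivalence hands
  over both parameters together with their existence.\<close>

lemma long_tailed_case:
  assumes pair: "tail_pair M X1s X2s" and long: "\<And>y. ((\<lambda>x. Ts (x - y) / Ts x) \<longlongrightarrow> 1) at_top"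
    and chi: "has_tail_dependence M X1s X2s chi" and coeff: "has_coeff_tail_dependence M X1s X2s \<eta>"
  shows "has_tail_dependence M X1 X2 chi" "has_coeff_tail_dependence M X1 X2 \<eta>"
proof -
  interpret S: tail_pair M X1s X2s by fact
  interpret X: tail_pair M X1 X2 by (rule tail_pair_X[OF S.tail_pos])
  note rv = S.rv[OF coeff] and \<eta> = S.\<eta>[OF coeff] and Gs_pos = S.G_pos[OF coeff]
  have Gs_anti: "antimono Gs" by (intro tail_antimono) simp
  \<comment> \<open>The joint tail inherits the insensitivity to shifts through H. It can therefore
    be normalized by itself, which stays informative when Gs is negligible against Ts.\<close>
  have G_long: "((\<lambda>x. Gs (x - y) / Gs x) \<longlongrightarrow> 1) at_top" for y
    using regularly_varying_at_zero_ratio[OF rv S.H_nonneg S.H_mono S.T_to_0 long[of y]]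
    by (simp add: S.H_tail)
  have limT: "((\<lambda>x. TX x / Ts x) \<longlongrightarrow> 1) at_top"
    using shifted_expectation_limit[OF tail_antimono[OF X1s] S.tail_pos tail_bounds(2), where \<theta> = 0 and A = Ts and Z = e1 and chi = 1]
      long S.tail_pos[THEN less_imp_neq, symmetric]
    by (simp add: tail_add_indep[OF indep_X1] tail_bounds noise_exp_integrable prob_space)
  have limG: "((\<lambda>x. tail M (\<lambda>\<omega>. Xmin \<omega> + Z \<omega>) x / Gs x) \<longlongrightarrow> 1) at_top"
    if ind: "indep_var borel Xmin borel Z" and Z: "\<And>\<omega>. \<bar>Z \<omega>\<bar> = \<bar>e1 \<omega>\<bar> \<or> \<bar>Z \<omega>\<bar> = \<bar>e2 \<omega>\<bar>" for Z
    using shifted_expectation_limit[OF Gs_anti Gs_pos tail_bounds(2), where \<theta> = 0 and A = Gs and Z = Z and chi = 1]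
      G_long Gs_pos[THEN less_imp_neq, symmetric] indep_var_rv2[OF ind]
    by (simp add: tail_add_indep[OF ind] tail_bounds noise_exp_integrable[OF _ Z] prob_space)
  have limGX: "((\<lambda>x. GX x / Gs x) \<longlongrightarrow> 1) at_top"
  proof (rule tendsto_sandwich)
    show "((\<lambda>x. tail M (\<lambda>\<omega>. Xmin \<omega> + emin \<omega>) x / Gs x) \<longlongrightarrow> 1) at_top"
      by (rule limG[OF indep_min_min]) (auto simp: min_def)
    show "((\<lambda>x. tail M (\<lambda>\<omega>. Xmin \<omega> + emax \<omega>) x / Gs x) \<longlongrightarrow> 1) at_top"
      by (rule limG[OF indep_min_max]) (auto simp: max_def)
    show "\<forall>\<^sub>F x in at_top. tail M (\<lambda>\<omega>. Xmin \<omega> + emin \<omega>) x / Gs x \<le> GX x / Gs x"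
      by (intro always_eventually allI divide_right_mono GX_ge tail_bounds)
    show "\<forall>\<^sub>F x in at_top. GX x / Gs x \<le> tail M (\<lambda>\<omega>. Xmin \<omega> + emax \<omega>) x / Gs x"
      by (intro always_eventually allI divide_right_mono GX_le_max tail_bounds)
  qed
  have "((\<lambda>x. inverse (TX x / Ts x)) \<longlongrightarrow> inverse 1) at_top" by (intro tendsto_inverse limT) simp
  then have "((\<lambda>x. Ts x / TX x) \<longlongrightarrow> 1) at_top" by simp
  from regularly_varying_at_zero_ratio[OF rv S.H_nonneg S.H_mono X.T_to_0 this]
  have "((\<lambda>x. Gs x / S.H (TX x)) \<longlongrightarrow> 1) at_top" by (simp add: S.H_tail)
  from tendsto_mult[OF limGX this]
  have "((\<lambda>x. X.H (TX x) / S.H (TX x)) \<longlongrightarrow> 1) at_top"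
    using Gs_pos[THEN less_imp_neq, symmetric] by (simp add: X.H_tail)
  then have ratio: "((\<lambda>s. X.H s / S.H s) \<longlongrightarrow> 1) (at_right 0)"
    by (intro tendsto_at_right_0_of_surj[OF continuous_tail[OF X.W1 X_no_atoms]
      tail_antimono[OF X.W1] tail_tendsto_0[OF X.W1] X.tail_pos])
  have HS: "\<forall>\<^sub>F s in at_right 0. S.H s > 0" by (rule regularly_varying_at_zero_ev_pos[OF rv S.H_nonneg])
  have "((\<lambda>s. X.H s / S.H s * (S.H s / s)) \<longlongrightarrow> 1 * chi) (at_right 0)"
    using chi unfolding S.has_tail_dependence_iff by (intro tendsto_mult ratio)
  then have "((\<lambda>s. X.H s / S.H s * (S.H s / s)) \<longlongrightarrow> chi) (at_right 0)" by simp
  then have "((\<lambda>s. X.H s / s) \<longlongrightarrow> chi) (at_right 0)"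
    by (rule Lim_transform_eventually) (use HS in \<open>eventually_elim, simp\<close>)
  then show "has_tail_dependence M X1 X2 chi" by (simp add: X.has_tail_dependence_iff)
  have "regularly_varying_at_zero X.H (1 / \<eta>)"
    unfolding regularly_varying_at_zero_def
  proof (intro allI impI)
    fix x :: real assume x: "x > 0"
    have fl: "filterlim (\<lambda>s. s * x) (at_right 0) (at_right 0)" using x by real_asymp
    have "((\<lambda>s. X.H (s * x) / S.H (s * x) * (S.H (s * x) / S.H s) / (X.H s / S.H s)) \<longlongrightarrow> 1 * x powr (1 / \<eta>) / 1) (at_right 0)"
      using rv x unfolding regularly_varying_at_zero_def
      by (intro tendsto_divide tendsto_mult ratio filterlim_compose[OF ratio fl]) auto
    then have *: "((\<lambda>s. X.H (s * x) / S.H (s * x) * (S.H (s * x) / S.H s) / (X.H s / S.H s)) \<longlongrightarrow> x powr (1 / \<eta>)) (at_right 0)"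
      by simp
    show "((\<lambda>s. X.H (s * x) / X.H s) \<longlongrightarrow> x powr (1 / \<eta>)) (at_right 0)"
      by (rule Lim_transform_eventually[OF *])
        (use HS eventually_compose_filterlim[OF HS fl] in \<open>eventually_elim, simp\<close>)
  qed
  then show "has_coeff_tail_dependence M X1 X2 \<eta>" using \<eta> by (simp add: X.has_coeff_tail_dependence_iff)
qed

text \<open>All tails are normalized by the noiseless marginal: the noisy marginal gains the factor
  m, the two envelopes gain the moments of the smaller and of the larger noise. The envelopes differ
  by a constant factor, so the limit is presupposed unless chis = 0, where both limits
  vanish.\<close>

lemma exponential_chi:
  assumes pair: "tail_pair M X1s X2s" and exp_T: "\<And>y. ((\<lambda>x. Ts (x - y) / Ts x) \<longlongrightarrow> exp (\<theta> * y)) at_top"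
    and chis: "has_tail_dependence M X1s X2s chis"
  defines "m \<equiv> (\<integral>\<omega>. exp (\<theta> * e1 \<omega>) \<partial>M)"
  shows "has_tail_dependence M X1 X2 chi \<Longrightarrow> chi \<in> {(\<integral>\<omega>. exp (\<theta> * emin \<omega>) \<partial>M) / m * chis .. (\<integral>\<omega>. exp (\<theta> * emax \<omega>) \<partial>M) / m * chis}"
    and "chis = 0 \<Longrightarrow> has_tail_dependence M X1 X2 0"
proof -
  interpret S: tail_pair M X1s X2s by fact
  interpret X: tail_pair M X1 X2 by (rule tail_pair_X[OF S.tail_pos])
  note Ts0 = S.tail_pos[THEN less_imp_neq, symmetric] and TX0 = X.tail_pos[THEN less_imp_neq, symmetric]
  have GsT: "((\<lambda>x. Gs x / Ts x) \<longlongrightarrow> chis) at_top"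
    using filterlim_compose[OF chis[unfolded S.has_tail_dependence_iff] S.T_to_0] by (simp add: S.H_tail)
  have Gs_le: "Gs x \<le> Ts x" for x unfolding tail_def by (rule finite_measure_mono) auto
  have limG: "((\<lambda>x. tail M (\<lambda>\<omega>. Xmin \<omega> + Z \<omega>) x / Ts x) \<longlongrightarrow> chis * (\<integral>\<omega>. exp (\<theta> * Z \<omega>) \<partial>M)) at_top"
    if ind: "indep_var borel Xmin borel Z" and Z: "\<And>\<omega>. \<bar>Z \<omega>\<bar> = \<bar>e1 \<omega>\<bar> \<or> \<bar>Z \<omega>\<bar> = \<bar>e2 \<omega>\<bar>" for Z
    unfolding tail_add_indep[OF ind]
    using indep_var_rv2[OF ind]
    by (intro shifted_expectation_limit[OF tail_antimono[OF X1s] S.tail_pos tail_bounds(2) exp_T _ tail_bounds(1) Gs_le GsT]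
        noise_exp_integrable[OF _ Z]) auto
  have limT: "((\<lambda>x. TX x / Ts x) \<longlongrightarrow> 1 * m) at_top"
    unfolding tail_add_indep[OF indep_X1] m_def
    by (intro shifted_expectation_limit[OF tail_antimono[OF X1s] S.tail_pos tail_bounds(2) exp_T _ tail_bounds(1)]
        noise_exp_integrable) (auto simp: Ts0)
  \<comment> \<open>The Bochner integral of a non-integrable function is 0, so integrability is
    established before positivity.\<close>
  have m: "m > 0"
  proof -
    have int: "integrable M (\<lambda>\<omega>. exp (\<theta> * e1 \<omega>))"
      by (rule Bochner_Integration.integrable_bound[OF noise_exp_integrable[of e1 "\<bar>\<theta>\<bar>"]])
        (auto intro!: AE_I2 simp: abs_mult[symmetric])
    have "m \<noteq> 0"
    proof
      assume "m = 0"
      then have "AE \<omega> in M. exp (\<theta> * e1 \<omega>) = 0"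
        using integral_nonneg_eq_0_iff_AE[OF int] by (simp add: m_def)
      then show False using prob_space.AE_False[OF prob_space_axioms] by simp
    qed
    moreover have "m \<ge> 0" unfolding m_def by (rule integral_nonneg_AE) auto
    ultimately show ?thesis by simp
  qed
  have lo: "((\<lambda>x. tail M (\<lambda>\<omega>. Xmin \<omega> + emin \<omega>) x / Ts x) \<longlongrightarrow> chis * (\<integral>\<omega>. exp (\<theta> * emin \<omega>) \<partial>M)) at_top"
    by (rule limG[OF indep_min_min]) (auto simp: min_def)
  have hi: "((\<lambda>x. tail M (\<lambda>\<omega>. Xmin \<omega> + emax \<omega>) x / Ts x) \<longlongrightarrow> chis * (\<integral>\<omega>. exp (\<theta> * emax \<omega>) \<partial>M)) at_top"
    by (rule limG[OF indep_min_max]) (auto simp: max_def)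
  have le: "tail M (\<lambda>\<omega>. Xmin \<omega> + emin \<omega>) x / Ts x \<le> GX x / Ts x"
    "GX x / Ts x \<le> tail M (\<lambda>\<omega>. Xmin \<omega> + emax \<omega>) x / Ts x" for x
    by (intro divide_right_mono GX_ge GX_le_max tail_bounds)+
  show "chi \<in> {(\<integral>\<omega>. exp (\<theta> * emin \<omega>) \<partial>M) / m * chis .. (\<integral>\<omega>. exp (\<theta> * emax \<omega>) \<partial>M) / m * chis}"
    if "has_tail_dependence M X1 X2 chi"
  proof -
    have "((\<lambda>x. GX x / TX x) \<longlongrightarrow> chi) at_top"
      using filterlim_compose[OF that[unfolded X.has_tail_dependence_iff] X.T_to_0] by (simp add: X.H_tail)
    from tendsto_mult[OF this limT] have lim: "((\<lambda>x. GX x / Ts x) \<longlongrightarrow> chi * m) at_top" by (simp add: TX0)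
    have "chis * (\<integral>\<omega>. exp (\<theta> * emin \<omega>) \<partial>M) \<le> chi * m"
      by (rule tendsto_le[OF _ lim lo]) (auto simp: le)
    moreover have "chi * m \<le> chis * (\<integral>\<omega>. exp (\<theta> * emax \<omega>) \<partial>M)"
      by (rule tendsto_le[OF _ hi lim]) (auto simp: le)
    ultimately show ?thesis using m by (simp add: field_simps)
  qed
  show "has_tail_dependence M X1 X2 0" if "chis = 0"
  proof -
    have "((\<lambda>x. GX x / Ts x) \<longlongrightarrow> 0) at_top"
      by (rule tendsto_sandwich[OF _ _ lo[unfolded that mult_zero_left] hi[unfolded that mult_zero_left]])
        (simp_all add: le)
    from tendsto_divide[OF this limT] have "((\<lambda>x. GX x / TX x) \<longlongrightarrow> 0) at_top"
      using m by (simp add: Ts0)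
    then have "((\<lambda>x. X.H (TX x) / TX x) \<longlongrightarrow> 0) at_top" by (simp add: X.H_tail)
    then have "((\<lambda>s. X.H s / s) \<longlongrightarrow> 0) (at_right 0)"
      by (rule tendsto_at_right_0_of_surj[OF continuous_tail[OF X.W1 X_no_atoms]
        tail_antimono[OF X.W1] tail_tendsto_0[OF X.W1] X.tail_pos])
    then show ?thesis by (simp add: X.has_tail_dependence_iff)
  qed
qed

text \<open>Serves the index 1 as well as those between 1 and 2. On the scale x^\<alpha> the noise
  decays faster than every rate, so TX and GX keep the noiseless rates \<theta> and
  \<theta>/\<eta>s.\<close>

lemma light_noise_coeff:
  assumes w: "weibull_like_tail M X1s \<alpha> \<theta>" and \<alpha>: "\<alpha> < 2"
    and coeff: "has_coeff_tail_dependence M X1s X2s \<eta>s" and coeffX: "has_coeff_tail_dependence M X1 X2 \<eta>"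
  shows "\<eta> = \<eta>s"
proof -
  have pos: "\<alpha> > 0" "\<theta> > 0" using w by (auto simp: weibull_like_tail_def)
  interpret S: tail_pair M X1s X2s using X1s X2s same_s w by (rule weibull_like_tail_pair)
  interpret X: tail_pair M X1 X2 by (rule tail_pair_X[OF S.tail_pos])
  note rT = weibull_like_tail_exp_rate[OF w]
  note rG = S.exp_rate_ge_G[OF coeff rT(1) pos(2)] S.exp_rate_le_G[OF coeff rT(2) pos(2)]
  have light: "exp_rate_ge \<alpha> q (tail M e1)" "exp_rate_ge \<alpha> q (tail M emax)" for q
    using exp_rate_ge_lower_order[OF noise_rates(1) _ \<alpha>] exp_rate_ge_lower_order[OF noise_rates(3) _ \<alpha>] \<tau>
    by simp_all
  have TX: "exp_rate_ge \<alpha> \<theta> TX" "exp_rate_le \<alpha> \<theta> TX"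
    using exp_rate_ge_add_light[OF X1s e1_measurable rT(1) light(1) pos(1)]
      exp_rate_le_add_indep[OF indep_X1 rT(2) tail_e_pos(1) pos(1)] by simp_all
  have "exp_rate_ge \<alpha> (\<theta> / \<eta>s) GX"
    by (rule exp_rate_ge_mono[OF exp_rate_ge_add_light[OF _ _ rG(1) light(2) pos(1)]])
      (simp_all add: GX_le_max)
  from X.coeff_rate_bounds(1)[OF coeffX pos this TX(2)] have 1: "\<theta> / \<eta>s \<le> \<theta> / \<eta>" .
  have "exp_rate_le \<alpha> (\<theta> / \<eta>s) GX"
    by (rule exp_rate_le_mono[OF exp_rate_le_add_indep[OF indep_min_min rG(2) emin_pos pos(1)]])
      (simp add: GX_ge)
  from X.coeff_rate_bounds(2)[OF coeffX pos this TX(1)] have "\<theta> / \<eta> \<le> \<theta> / \<eta>s" .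
  with 1 show ?thesis using pos S.\<eta>[OF coeff] X.\<eta>[OF coeffX] by simp
qed

text \<open>With b = 1/(2 \<tau>^2), TX has the rate t = \<theta>s b/(\<theta>s + b). Combining the
  signal rates with the noise rate b (maximum) or 2 b (mean, minimum) gives three bounds on the rate
  of GX, and each turns into one bound on \<eta>.\<close>

lemma gaussian_coeff:
  assumes w: "weibull_like_tail M X1s 2 \<theta>s"
    and gmin: "gaussian_rate M Xmin \<theta>min" and gmax: "gaussian_rate M Xmax \<theta>max"
    and coeff: "has_coeff_tail_dependence M X1s X2s \<eta>s" and coeffX: "has_coeff_tail_dependence M X1 X2 \<eta>"
  shows "\<eta> \<in> {\<theta>s / (2 * \<theta>min) * ((\<theta>min + 1 / \<tau>\<^sup>2) / (\<theta>s + 1 / (2 * \<tau>\<^sup>2))) ..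
                min (\<theta>s / \<theta>min * ((\<theta>min + 1 / (2 * \<tau>\<^sup>2)) / (\<theta>s + 1 / (2 * \<tau>\<^sup>2))))
                    (\<theta>s / (2 * \<theta>max) * ((\<theta>max + 1 / \<tau>\<^sup>2) / (\<theta>s + 1 / (2 * \<tau>\<^sup>2))))}"
proof -
  have s: "\<theta>s > 0" using w by (auto simp: weibull_like_tail_def)
  interpret S: tail_pair M X1s X2s using X1s X2s same_s w by (rule weibull_like_tail_pair)
  interpret X: tail_pair M X1 X2 by (rule tail_pair_X[OF S.tail_pos])
  note \<eta> = X.\<eta>[OF coeffX]
  have max_pos: "tail M Xmax x > 0" for x
  proof -
    have "Ts x \<le> tail M Xmax x" unfolding tail_def by (rule finite_measure_mono) auto
    then show ?thesis using S.tail_pos[of x] by simp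
  qed
  note rT = weibull_like_tail_exp_rate[OF w]
  note rmin = gaussian_rate_exp_rate[OF _ gmin S.G_pos[OF coeff], simplified]
  note rmax = gaussian_rate_exp_rate[OF _ gmax max_pos, simplified]
  define b where "b = 1 / (2 * \<tau>\<^sup>2)"
  have b: "b > 0" "1 / \<tau>\<^sup>2 = 2 * b" "2 * b > 0" using \<tau> by (auto simp: b_def)
  note rn = noise_rates[folded b_def, unfolded b(2)]
  define t where "t = \<theta>s * b / (\<theta>s + b)"
  have t: "t > 0" using s b by (simp add: t_def add_pos_pos)
  have TX: "exp_rate_ge 2 t TX" "exp_rate_le 2 t TX" unfolding t_def
    using exp_rate_ge_add_gaussian[OF indep_X1 rT(1) rn(1) s b(1)]
      exp_rate_le_add_gaussian[OF indep_X1 rT(2) rn(2) s b(1)] by simp_all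
  have "exp_rate_ge 2 (\<theta>min * b / (\<theta>min + b)) GX"
    by (rule exp_rate_ge_mono[OF exp_rate_ge_add_gaussian[OF indep_min_max rmin(2) rn(3) rmin(1) b(1)]])
      (simp add: GX_le_max)
  from X.coeff_rate_bounds(1)[OF coeffX _ t this TX(2)]
  have 1: "\<theta>min * b / (\<theta>min + b) \<le> t / \<eta>" by simp
  have "exp_rate_ge 2 (\<theta>max * (2 * b) / (\<theta>max + 2 * b)) GX"
    by (rule exp_rate_ge_mono[OF exp_rate_ge_add_gaussian[OF indep_max_mean rmax(2) rn(5) rmax(1) b(3)]])
      (simp add: GX_le_mean)
  from X.coeff_rate_bounds(1)[OF coeffX _ t this TX(2)]
  have 2: "\<theta>max * (2 * b) / (\<theta>max + 2 * b) \<le> t / \<eta>" by simp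
  have "exp_rate_le 2 (\<theta>min * (2 * b) / (\<theta>min + 2 * b)) GX"
    by (rule exp_rate_le_mono[OF exp_rate_le_add_gaussian[OF indep_min_min rmin(3) rn(4) rmin(1) b(3)]])
      (simp add: GX_ge)
  from X.coeff_rate_bounds(2)[OF coeffX _ t this TX(1)]
  have 3: "t / \<eta> \<le> \<theta>min * (2 * b) / (\<theta>min + 2 * b)" by simp
  have upper: "\<eta> \<le> t / g" if "g \<le> t / \<eta>" "g > 0" for g
    using that \<eta>(1) by (simp add: field_simps)
  have lower: "t / g \<le> \<eta>" if "t / \<eta> \<le> g" "g > 0" for g
    using that \<eta>(1) by (simp add: field_simps)
  \<comment> \<open>The factor b of t cancels, which leaves the stated expressions with 1/\<tau>^2
    written as 2 b.\<close>
  have e1: "t / (\<theta>min * b / (\<theta>min + b)) = \<theta>s / \<theta>min * ((\<theta>min + b) / (\<theta>s + b))"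
    and e2: "t / (\<theta>max * (2 * b) / (\<theta>max + 2 * b)) = \<theta>s / (2 * \<theta>max) * ((\<theta>max + 2 * b) / (\<theta>s + b))"
    and e3: "t / (\<theta>min * (2 * b) / (\<theta>min + 2 * b)) = \<theta>s / (2 * \<theta>min) * ((\<theta>min + 2 * b) / (\<theta>s + b))"
    using b(1) by (simp_all add: t_def)
  show ?thesis unfolding b(2) b_def[symmetric]
    using upper[OF 1, unfolded e1 zero_less_divide_iff] upper[OF 2, unfolded e2 zero_less_divide_iff]
      lower[OF 3, unfolded e3 zero_less_divide_iff] b(1) rmin(1) rmax(1)
    by (simp only: atLeastAtMost_iff min.bounded_iff) (metis add_pos_pos b(3) mult_pos_pos)
qed

text \<open>The signal is now lighter than every Gaussian rate, so the noise rules: TX has the rate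
  b of a single noise, and GX has the rate 2 b, bounded through the mean of the noises on one side
  and through their minimum on the other.\<close>

lemma heavy_noise_coeff:
  assumes w: "weibull_like_tail M X1s \<alpha> \<theta>" and \<alpha>: "\<alpha> > 2"
    and coeff: "has_coeff_tail_dependence M X1s X2s \<eta>s" and coeffX: "has_coeff_tail_dependence M X1 X2 \<eta>"
  shows "\<eta> = 1 / 2"
proof -
  have pos: "\<theta> > 0" using w by (auto simp: weibull_like_tail_def)
  interpret S: tail_pair M X1s X2s using X1s X2s same_s w by (rule weibull_like_tail_pair)
  interpret X: tail_pair M X1 X2 by (rule tail_pair_X[OF S.tail_pos])
  have \<alpha>0: "\<alpha> > 0" using \<alpha> by simp
  note rT = weibull_like_tail_exp_rate(1)[OF w]
  have lightT: "exp_rate_ge 2 q Ts" for q using exp_rate_ge_lower_order[OF rT pos \<alpha>] .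
  have max_le: "tail M Xmax x \<le> Ts x + Ts x" for x
  proof -
    have "tail M Xmax x \<le> prob ({\<omega> \<in> space M. X1s \<omega> > x} \<union> {\<omega> \<in> space M. X2s \<omega> > x})"
      unfolding tail_def by (intro finite_measure_mono) auto
    also have "\<dots> \<le> Ts x + tail M X2s x" unfolding tail_def by (intro measure_Un_le) auto
    also have "tail M X2s x = Ts x" by (rule tail_cong_distr[OF X1s X2s same_s, symmetric])
    finally show ?thesis .
  qed
  have lightM: "exp_rate_ge 2 q (tail M Xmax)" for q
    by (rule exp_rate_ge_mono[OF exp_rate_ge_add[OF lightT lightT] always_eventually[OF allI[OF max_le]]]) simp
  define b where "b = 1 / (2 * \<tau>\<^sup>2)"
  have b: "b > 0" "1 / \<tau>\<^sup>2 = 2 * b" using \<tau> by (auto simp: b_def)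
  note rn = noise_rates[folded b_def, unfolded b(2)]
  have TX: "exp_rate_ge 2 b TX" "exp_rate_le 2 b TX"
    using exp_rate_ge_add_light[OF e1_measurable X1s rn(1) lightT]
      exp_rate_le_add_indep'[OF indep_X1 rn(2) S.tail_pos] by (simp_all add: add.commute)
  have "exp_rate_ge 2 (2 * b) GX"
  proof (rule exp_rate_ge_mono)
    show "exp_rate_ge 2 (2 * b) (tail M (\<lambda>\<omega>. emean \<omega> + Xmax \<omega>))"
      by (rule exp_rate_ge_add_light[OF _ _ rn(5) lightM]) simp_all
    show "\<forall>\<^sub>F x in at_top. GX x \<le> tail M (\<lambda>\<omega>. emean \<omega> + Xmax \<omega>) x"
      using GX_le_mean by (simp add: add.commute)
  qed
  from X.coeff_rate_bounds(1)[OF coeffX _ b(1) this TX(2)] have 1: "2 * b \<le> b / \<eta>" by simp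
  have "exp_rate_le 2 (2 * b) GX"
    by (rule exp_rate_le_mono[OF exp_rate_le_add_indep'[OF indep_min_min rn(4) S.G_pos[OF coeff]]])
      (simp_all add: GX_ge)
  from X.coeff_rate_bounds(2)[OF coeffX _ b(1) this TX(1)] have "b / \<eta> \<le> 2 * b" by simp
  with 1 have "b / \<eta> = 2 * b" by simp
  then show ?thesis using b(1) X.\<eta>[OF coeffX] by (simp add: field_simps)
qed

end

text \<open>For an index below 1 the derivative of x^\<alpha> tends to 0, so a fixed shift leaves
  the exponent unchanged in the limit; this makes such Weibull tails long-tailed.\<close>

lemma powr_increment_tendsto_0:
  fixes \<alpha> :: real
  assumes "0 < \<alpha>" "\<alpha> < 1"
  shows "((\<lambda>x. \<theta> * x powr \<alpha> - \<theta> * (x - y) powr \<alpha>) \<longlongrightarrow> 0) at_top"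
proof -
  have "((\<lambda>x. \<theta> * (x powr \<alpha> - (x - y) powr \<alpha>)) \<longlongrightarrow> \<theta> * 0) at_top"
    using assms by (intro tendsto_mult tendsto_const) real_asymp
  then show ?thesis by (simp add: algebra_simps)
qed

theorem proposition3p1:
  fixes M :: "'a measure"
    and X1s X2s e1 e2 X1 X2 :: "'a \<Rightarrow> real"
    and \<tau> chis etas :: real
  assumes "prob_space M"
    and "X1s \<in> borel_measurable M" and "X2s \<in> borel_measurable M"
    and "distr M borel X1s = distr M borel X2s"
    and "\<tau> > 0"
    and "distributed M lborel e1 (\<lambda>x. ennreal (normal_density 0 \<tau> x))"
    and "distributed M lborel e2 (\<lambda>x. ennreal (normal_density 0 \<tau> x))"
    and "prob_space.indep_var M borel e1 borel e2"
    and "prob_space.indep_var M borel (\<lambda>\<omega>. (X1s \<omega>, X2s \<omega>)) borel (\<lambda>\<omega>. (e1 \<omega>, e2 \<omega>))"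
    and "X1 = (\<lambda>\<omega>. X1s \<omega> + e1 \<omega>)" and "X2 = (\<lambda>\<omega>. X2s \<omega> + e2 \<omega>)"
    and "has_tail_dependence M X1s X2s chis"
    and "has_coeff_tail_dependence M X1s X2s etas"
  shows
    "(regularly_varying_tail M X1s \<or> (\<exists>\<alpha> \<theta>. \<alpha> < 1 \<and> weibull_like_tail M X1s \<alpha> \<theta>) \<longrightarrow>
        has_tail_dependence M X1 X2 chis \<and> has_coeff_tail_dependence M X1 X2 etas) \<and>
     (\<forall>\<theta>. weibull_like_tail M X1s 1 \<theta> \<longrightarrow>
        (\<forall>chi. has_tail_dependence M X1 X2 chi \<longrightarrow>
           chi \<in> {(\<integral>\<omega>. exp (\<theta> * min (e1 \<omega>) (e2 \<omega>)) \<partial>M) / (\<integral>\<omega>. exp (\<theta> * e1 \<omega>) \<partial>M) * chis ..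
                (\<integral>\<omega>. exp (\<theta> * max (e1 \<omega>) (e2 \<omega>)) \<partial>M) / (\<integral>\<omega>. exp (\<theta> * e1 \<omega>) \<partial>M) * chis}) \<and>
        (\<forall>\<eta>. has_coeff_tail_dependence M X1 X2 \<eta> \<longrightarrow> \<eta> = etas) \<and>
        (chis = 0 \<longrightarrow> has_tail_dependence M X1 X2 0)) \<and>
     (\<forall>\<alpha> \<theta>. 1 < \<alpha> \<and> \<alpha> < 2 \<and> weibull_like_tail M X1s \<alpha> \<theta> \<longrightarrow>
        (\<forall>\<eta>. has_coeff_tail_dependence M X1 X2 \<eta> \<longrightarrow> \<eta> = etas)) \<and>
     (\<forall>\<theta>s \<theta>min \<theta>max. weibull_like_tail M X1s 2 \<theta>s \<and>
        gaussian_rate M (\<lambda>\<omega>. min (X1s \<omega>) (X2s \<omega>)) \<theta>min \<and>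
        gaussian_rate M (\<lambda>\<omega>. max (X1s \<omega>) (X2s \<omega>)) \<theta>max \<longrightarrow>
        (\<forall>\<eta>. has_coeff_tail_dependence M X1 X2 \<eta> \<longrightarrow>
           \<eta> \<in> {\<theta>s / (2 * \<theta>min) * ((\<theta>min + 1 / \<tau>\<^sup>2) / (\<theta>s + 1 / (2 * \<tau>\<^sup>2))) ..
                min (\<theta>s / \<theta>min * ((\<theta>min + 1 / (2 * \<tau>\<^sup>2)) / (\<theta>s + 1 / (2 * \<tau>\<^sup>2))))
                    (\<theta>s / (2 * \<theta>max) * ((\<theta>max + 1 / \<tau>\<^sup>2) / (\<theta>s + 1 / (2 * \<tau>\<^sup>2))))})) \<and>
     (\<forall>\<alpha> \<theta>. 2 < \<alpha> \<and> weibull_like_tail M X1s \<alpha> \<theta> \<longrightarrow>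
        (\<forall>\<eta>. has_coeff_tail_dependence M X1 X2 \<eta> \<longrightarrow> \<eta> = 1 / 2))"
proof -
  interpret noisy_pair M X1s X2s e1 e2 \<tau>
    by (intro noisy_pair.intro noisy_pair_axioms.intro assms)
  note chis = assms(12) and coeff = assms(13)
  have X: "X1 = (\<lambda>\<omega>. X1s \<omega> + e1 \<omega>)" "X2 = (\<lambda>\<omega>. X2s \<omega> + e2 \<omega>)" by fact+
  have ratio: "((\<lambda>x. Ts (x - y) / Ts x) \<longlongrightarrow> exp l) at_top"
    if "weibull_like_tail M X1s \<alpha> \<theta>" "((\<lambda>x. \<theta> * x powr \<alpha> - \<theta> * (x - y) powr \<alpha>) \<longlongrightarrow> l) at_top" for \<alpha> \<theta> y l
    by (rule weibull_like_tail_ratio[OF that(1) _ _ that(2)]) real_asymp+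
  have 1: "has_tail_dependence M X1 X2 chis \<and> has_coeff_tail_dependence M X1 X2 etas"
    if "regularly_varying_tail M X1s \<or> (\<exists>\<alpha> \<theta>. \<alpha> < 1 \<and> weibull_like_tail M X1s \<alpha> \<theta>)"
    using that
  proof
    assume "regularly_varying_tail M X1s"
    then obtain \<alpha> where rv: "regularly_varying Ts (- \<alpha>)" by (auto simp: regularly_varying_tail_def)
    have pos: "Ts x > 0" for x by (rule tail_pos_of_ev[OF X1s regularly_varying_ev_pos[OF rv]])
    have long: "((\<lambda>x. Ts (x - y) / Ts x) \<longlongrightarrow> 1) at_top" for y
      by (rule regularly_varying_shift[OF rv tail_antimono[OF X1s] pos])
    show ?thesis unfolding X
      using long_tailed_case[OF long_tailed_tail_pair[OF X1s X2s same_s pos long] long chis coeff] by blast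
  next
    assume "\<exists>\<alpha> \<theta>. \<alpha> < 1 \<and> weibull_like_tail M X1s \<alpha> \<theta>"
    then obtain \<alpha> \<theta> where \<alpha>: "\<alpha> < 1" and w: "weibull_like_tail M X1s \<alpha> \<theta>" by blast
    have "\<alpha> > 0" using w by (simp add: weibull_like_tail_def)
    then have long: "((\<lambda>x. Ts (x - y) / Ts x) \<longlongrightarrow> 1) at_top" for y
      using ratio[OF w powr_increment_tendsto_0[OF _ \<alpha>]] by simp
    show ?thesis unfolding X
      using long_tailed_case[OF weibull_like_tail_pair[OF X1s X2s same_s w] long chis coeff] by blast
  qed
  have 2: "(\<forall>chi. has_tail_dependence M X1 X2 chi \<longrightarrow>
           chi \<in> {(\<integral>\<omega>. exp (\<theta> * emin \<omega>) \<partial>M) / (\<integral>\<omega>. exp (\<theta> * e1 \<omega>) \<partial>M) * chis ..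
                (\<integral>\<omega>. exp (\<theta> * emax \<omega>) \<partial>M) / (\<integral>\<omega>. exp (\<theta> * e1 \<omega>) \<partial>M) * chis}) \<and>
        (\<forall>\<eta>. has_coeff_tail_dependence M X1 X2 \<eta> \<longrightarrow> \<eta> = etas) \<and>
        (chis = 0 \<longrightarrow> has_tail_dependence M X1 X2 0)"
    if w: "weibull_like_tail M X1s 1 \<theta>" for \<theta>
  proof -
    have "((\<lambda>x. \<theta> * x powr 1 - \<theta> * (x - y) powr 1) \<longlongrightarrow> \<theta> * y) at_top" for y
    \<comment> \<open>From max 0 y on, both powers are their plain bases and the difference is
      exactly \<theta> y.\<close>
    proof (rule Lim_transform_eventually[OF tendsto_const])
      show "\<forall>\<^sub>F x in at_top. \<theta> * y = \<theta> * x powr 1 - \<theta> * (x - y) powr 1"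
        using eventually_ge_at_top[of "max 0 y"] by eventually_elim (simp add: algebra_simps)
    qed
    then have "((\<lambda>x. Ts (x - y) / Ts x) \<longlongrightarrow> exp (\<theta> * y)) at_top" for y by (rule ratio[OF w])
    note ex = exponential_chi[OF weibull_like_tail_pair[OF X1s X2s same_s w] this chis]
    show ?thesis unfolding X using ex light_noise_coeff[OF w _ coeff] by auto
  qed
  show ?thesis
  proof (intro conjI allI impI; (elim conjE)?)
    fix \<theta> assume "weibull_like_tail M X1s 1 \<theta>"
    note * = 2[OF this]
    show "chi \<in> {(\<integral>\<omega>. exp (\<theta> * emin \<omega>) \<partial>M) / (\<integral>\<omega>. exp (\<theta> * e1 \<omega>) \<partial>M) * chis ..
                (\<integral>\<omega>. exp (\<theta> * emax \<omega>) \<partial>M) / (\<integral>\<omega>. exp (\<theta> * e1 \<omega>) \<partial>M) * chis}"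
      if "has_tail_dependence M X1 X2 chi" for chi using * that by blast
    show "\<eta> = etas" if "has_coeff_tail_dependence M X1 X2 \<eta>" for \<eta> using * that by blast
    show "has_tail_dependence M X1 X2 0" if "chis = 0" using * that by blast
  next
    fix \<alpha> \<theta> \<eta> assume "\<alpha> < 2" "weibull_like_tail M X1s \<alpha> \<theta>" "has_coeff_tail_dependence M X1 X2 \<eta>"
    then show "\<eta> = etas" unfolding X using light_noise_coeff coeff by blast
  next
    fix \<theta>s \<theta>min \<theta>max \<eta>
    assume "weibull_like_tail M X1s 2 \<theta>s" "gaussian_rate M Xmin \<theta>min" "gaussian_rate M Xmax \<theta>max"
      "has_coeff_tail_dependence M X1 X2 \<eta>"
    then show "\<eta> \<in> {\<theta>s / (2 * \<theta>min) * ((\<theta>min + 1 / \<tau>\<^sup>2) / (\<theta>s + 1 / (2 * \<tau>\<^sup>2))) ..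
                min (\<theta>s / \<theta>min * ((\<theta>min + 1 / (2 * \<tau>\<^sup>2)) / (\<theta>s + 1 / (2 * \<tau>\<^sup>2))))
                    (\<theta>s / (2 * \<theta>max) * ((\<theta>max + 1 / \<tau>\<^sup>2) / (\<theta>s + 1 / (2 * \<tau>\<^sup>2))))}"
      unfolding X using gaussian_coeff coeff by blast
  next
    fix \<alpha> \<theta> \<eta> assume "2 < \<alpha>" "weibull_like_tail M X1s \<alpha> \<theta>" "has_coeff_tail_dependence M X1 X2 \<eta>"
    then show "\<eta> = 1 / 2" unfolding X using heavy_noise_coeff coeff by blast
  qed (use 1 in blast)+
qed

end
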